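(* Assume the uniform $q$-variant of the Hardy--Littlewood prime $k$-tuple conjecture (stated in the context). Let $k \geq 1$ be an integer. Suppose $\varphi(q) \asymp \frac{N}{\log N}$. Then, as $N \to \infty$, $$\frac{1}{\varphi(q)}\sum_{\substack{a \bmod q\\ (a,q)=1}} \pi(N;q,a)^k=\sum_{j=1}^k \left\{ {k \atop j} \right\} \left( \frac{N}{\varphi(q)\log N} \right)^j +O\left( \frac{\log\log N}{\log N} \right),$$ where $\left\{ {k \atop j} \right\}$ is the Stirling number of the second kind, i.e., the number of ways to partition a set of $k$ objects into $j$ non-empty subsets. The implied constant depends only on $k$ and the ratio $\varphi(q)/\frac{N}{\log N}$.
   Context: $\varphi$ is Euler's totient function, $\Lambda$ is the von Mangoldt function, $1_{\mathbb{P}}$ is the indicator function of the primes, and $\pi(N;q,a)$ is the number of primes $p\leq N$ with $p\equiv a \ (\mathrm{mod}\ q)$. The condition $\varphi(q)\asymp N/\log N$ means $c_1 N/\log N\leq \varphi(q)\leq c_2 N/\log N$ for some constants $0<c_1\leq c_2$. For a finite set $\mathcal{D}$ of $k$ distinct integers and $q\geq 1$, let $v_p(\mathcal{D})$ be the number of residue classes modulo $p$ occupied by $\mathcal{D}$, and define $$\mathfrak{S}(\mathcal{D};q) := \left( \frac{\varphi(q)}{q} \right)^{-k} \prod_{p \nmid q} \left( 1-\frac{1}{p} \right)^{-k}\left( 1-\frac{v_p(\mathcal{D})}{p} \right).$$ Conjecture (uniform $q$-variant of the Hardy--Littlewood prime $k$-tuple conjecture): there is an absolute constant $0<\delta<1/2$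 such that, for all integers $k,q,D,N\geq 1$ with $\varphi(q) \leq N/\log N$ and $D \leq N$, every set $\mathcal{D} \subseteq [1,D]$ consisting of $k$ distinct multiples of $q$, and every $1 \leq x \leq N$, $$\sum_{\substack{1 \leq n \leq x\\ (n,q)=1}} \prod_{d \in \mathcal{D}}\Lambda(n+d)= \mathfrak{S}(\mathcal{D};q)\, \left| \{ 1 \leq n \leq x : (n,q)=1 \} \right|+O_{k,\delta}(N^{1-\delta}),$$ or equivalently (by partial summation) $$\sum_{\substack{1 \leq n \leq x\\(n,q)=1}} \prod_{d \in \mathcal{D}}1_{\mathbb{P}}(n+d) = \mathfrak{S}(\mathcal{D};q) \sum_{\substack{1 \leq n \leq x\\(n,q)=1}} \left( \prod_{d \in \mathcal{D}} \log (n+d) \right)^{-1} +O_{k,\delta}(N^{1-\delta}).$$ The constant $\delta$ and the implied constants of this conjecture are regarded as given. *)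

theory Defs
  imports
    "HOL-Analysis.Analysis"
    "HOL-Number_Theory.Totient"
    "HOL-Number_Theory.Cong"
    "HOL-Number_Theory.Prime_Powers"
    "HOL-Combinatorics.Stirling"
begin

definition occupied_classes :: "int set \<Rightarrow> nat \<Rightarrow> nat" where
  "occupied_classes \<D> p = card ((\<lambda>d. d mod int p) ` \<D>)"

text \<open>
  The product over the primes not dividing \<open>q\<close> is written as an infinite product over all natural
  numbers, the other factors being \<open>1\<close>. For finite \<open>\<D>\<close> it converges, and it has
  the value \<open>0\<close> when \<open>\<D>\<close> occupies every class modulo some prime not dividing \<open>q\<close>.
\<close>

definition singular_series :: "int set \<Rightarrow> nat \<Rightarrow> real" where
  "singular_series \<D> q =
     inverse ((real (totient q) / real q) ^ card \<D>) *
     (\<Prod>p. if prime p \<and> \<not> p dvd q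
          then inverse ((1 - 1 / real p) ^ card \<D>) * (1 - real (occupied_classes \<D> p) / real p)
          else 1)"

text \<open>
  The constant \<open>\<delta>\<close> is absolute, while the implied constant \<open>C\<close> may depend on \<open>k\<close> and \<open>\<delta>\<close> only.
  For \<open>N = 1\<close> the bound on \<open>totient q\<close> reads \<open>totient q \<le> 1 / 0 = 0\<close> and excludes every \<open>q\<close>;
  nothing is lost, since for \<open>N = 1\<close> the only possibility is \<open>k = q = 1\<close> and \<open>\<D> = {1}\<close>.
\<close>

definition uniform_hardy_littlewood :: bool where
  "uniform_hardy_littlewood \<longleftrightarrow>
     (\<exists>\<delta>::real. 0 < \<delta> \<and> \<delta> < 1 / 2 \<and>
       (\<forall>k::nat. k \<ge> 1 \<longrightarrow>
         (\<exists>C::real. \<forall>(q::nat) (D::nat) (N::nat) (\<D>::nat set) (x::real).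
            q \<ge> 1 \<longrightarrow> D \<ge> 1 \<longrightarrow> N \<ge> 1 \<longrightarrow>
            real (totient q) \<le> real N / ln (real N) \<longrightarrow> D \<le> N \<longrightarrow>
            \<D> \<subseteq> {1..D} \<longrightarrow> card \<D> = k \<longrightarrow> (\<forall>d\<in>\<D>. q dvd d) \<longrightarrow>
            1 \<le> x \<longrightarrow> x \<le> real N \<longrightarrow>
            \<bar>(\<Sum>n | 1 \<le> n \<and> real n \<le> x \<and> coprime n q. \<Prod>d\<in>\<D>. mangoldt (n + d))
              - singular_series (int ` \<D>) q
                * real (card {n::nat. 1 \<le> n \<and> real n \<le> x \<and> coprime n q})\<bar>
            \<le> C * real N powr (1 - \<delta>))))"

definition primes_in_class :: "nat \<Rightarrow> nat \<Rightarrow> nat \<Rightarrow> nat" where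
  "primes_in_class N q a = card {p. prime p \<and> p \<le> N \<and> [p = a] (mod q)}"

end

theory Submission
  imports Defs "HOL-Computational_Algebra.Squarefree" "HOL-Real_Asymp.Real_Asymp"
begin

text \<open>
  Expanding \<open>\<pi>(N; q, a) ^ k\<close> in falling factorials with Stirling coefficients reduces the claim to
  counting \<open>j\<close>-tuples of primes \<open>a + i * q\<close>, \<open>i \<in> I\<close>, with \<open>I \<subseteq> {..<M}\<close> and \<open>M\<close> equal to
  \<open>N div q\<close> or \<open>N div q + 1\<close>. The conjecture, applied with modulus \<open>1\<close> to the set
  \<open>{1 + i * q | i \<in> I}\<close>, turns this count into a sum of singular series over \<open>I\<close>. With
  \<open>P\<close> the primes below a multiple of \<open>ln N\<close> that do not divide \<open>q\<close>, each singular series is, up to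
  explicit factors, the probability that \<open>I\<close> avoids an independent uniformly random residue class
  modulo every \<open>p \<in> P\<close>. The sum is therefore a factorial moment of the number \<open>X\<close> of sifted integers
  in \<open>{..<M}\<close>, whose mean is \<open>l = M * (\<Prod>p\<in>P. 1 - 1 / p)\<close>. Its variance is at most \<open>l\<close>, and an upper
  bound sieve gives \<open>X \<le> K * l\<close> always; hence the factorial moments are \<open>l ^ j * (1 + O(1 / l))\<close>.
  By Mertens' estimate \<open>1 / l\<close> is at most a constant times \<open>ln (ln N) / ln N\<close>, however smooth \<open>q\<close> is.
\<close>

section \<open>Chebyshev and Mertens estimates\<close>

text \<open>With modulus \<open>1\<close> instead of \<open>q\<close> the totient condition of the
  conjecture reads \<open>1 \<le> N / ln N\<close>, so the ratio bound \<open>c\<^sub>2\<close> may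
  exceed 1. The error \<open>N powr (1 - \<delta>)\<close> is lost once per tuple, which is harmless
  because the number of tuples is at most a power of \<open>ln N\<close> times a constant. The
  obstacle is that \<open>q / totient q\<close> can reach the size of \<open>ln (ln N)\<close>. Then
  \<open>M\<close> is shorter by that factor, and the mean \<open>l\<close> seems to be in danger.
  But the small primes responsible for it divide \<open>q\<close>, hence are absent from
  \<open>P\<close>, and the proportion of survivors grows correspondingly. Mertens' product is
  therefore split into the primes dividing \<open>q\<close> and the others, and one bound covers
  every \<open>q\<close>. Only upper estimates for sums and products over primes enter, and the
  product over \<open>P\<close> never has to be evaluated: it cancels between the singular series
  and the moments. The error term of the theorem has two sources: \<open>1 / l\<close>, and the
  replacement of \<open>N\<close> by a multiple of \<open>q\<close>, which costs
  \<open>q / (totient q * ln N)\<close>.\<close>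

lemma prod_primes_dvd:
  fixes A :: "nat set"
  assumes "finite A" "\<And>p. p \<in> A \<Longrightarrow> prime p" "\<And>p. p \<in> A \<Longrightarrow> p dvd n"
  shows "\<Prod>A dvd n"
  using assms
proof (induction A rule: finite_induct)
  case (insert p A)
  have "coprime p (\<Prod>A)"
    by (rule prod_coprime_right) (use insert in \<open>auto intro!: primes_coprime\<close>)
  then show ?case
    using insert by (auto intro: divides_mult)
qed auto

text \<open>Erdos' induction: for \<open>n = 2 * m + 1\<close> the primes in
  \<open>{m + 2..n}\<close> all divide \<open>n choose m\<close>, which is one of two equal entries
  in a row of sum \<open>2 ^ n\<close> and hence at most \<open>4 ^ m\<close>. Even
  \<open>n > 2\<close> are not prime and add nothing.\<close>

lemma primorial_le: "(\<Prod>p | prime p \<and> p \<le> n. p) \<le> (4::nat) ^ n"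
proof (induction n rule: less_induct)
  case (less n)
  consider "n \<le> 2" | "n > 2" "even n" | m where "n = 2 * m + 1" "m \<ge> 1"
  proof -
    have "\<exists>m. n = 2 * m + 1 \<and> m \<ge> 1" if "n > 2" "odd n"
      using that by (auto elim!: oddE)
    then show ?thesis using that(1,2) that(3) not_le by blast
  qed
  then show ?case
  proof cases
    case 1
    then have "{p. prime p \<and> p \<le> n} \<subseteq> {2}"
      by (auto dest: prime_ge_2_nat)
    then consider "{p. prime p \<and> p \<le> n} = {}" | "{p. prime p \<and> p \<le> n} = {2}"
      by (auto simp only: subset_singleton_iff)
    then show ?thesis
    proof cases
      case 2
      then have "(2::nat) \<in> {p. prime p \<and> p \<le> n}" by simp
      then have "(4::nat) ^ 1 \<le> 4 ^ n" by (intro power_increasing) auto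
      then show ?thesis unfolding 2 by simp
    qed (simp only: prod.empty one_le_power one_le_numeral)
  next
    case 2
    then have "\<not> prime n" using prime_odd_nat[of n] by auto
    then have "p \<le> n - 1" if "prime p" "p \<le> n" for p
      using that by (cases "p = n") auto
    then have "{p. prime p \<and> p \<le> n} = {p. prime p \<and> p \<le> n - 1}"
      by (auto intro: order_trans[OF _ diff_le_self])
    then have "(\<Prod>p | prime p \<and> p \<le> n. p) \<le> (4::nat) ^ (n - 1)"
      using less.IH[of "n - 1"] 2 by simp
    also have "\<dots> \<le> 4 ^ n" by (rule power_increasing) auto
    finally show ?thesis .
  next
    case 3
    let ?A = "{p. prime p \<and> p \<le> m + 1}" and ?B = "{p. prime p \<and> m + 1 < p \<and> p \<le> n}"
    have "\<Prod>(?A \<union> ?B) = \<Prod>?A * \<Prod>?B"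
      by (rule prod.union_disjoint) auto
    moreover have "?A \<union> ?B = {p. prime p \<and> p \<le> n}" using 3 by auto
    ultimately have split: "(\<Prod>p | prime p \<and> p \<le> n. p) = \<Prod>?A * \<Prod>?B"
      by (simp only:)
    have dvd: "\<Prod>?B dvd (n choose m)"
    proof (rule prod_primes_dvd)
      fix p assume p: "p \<in> ?B"
      have "p dvd fact n" using p by (simp add: prime_dvd_fact_iff)
      moreover have "fact n = fact m * fact (n - m) * (n choose m)"
        by (rule binomial_fact_lemma[symmetric]) (use 3 in simp)
      moreover have "\<not> m \<ge> p" "\<not> n - m \<ge> p" using p 3(1) by auto
      then have "\<not> p dvd fact m" "\<not> p dvd fact (n - m)"
        using p by (simp_all only: prime_dvd_fact_iff mem_Collect_eq not_False_eq_True)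
      ultimately show "p dvd (n choose m)"
        using p by (simp only: prime_dvd_mult_iff mem_Collect_eq) blast
    qed auto
    have "2 * (n choose m) = (n choose m) + (n choose Suc m)"
    proof -
      have "n choose m = n choose (n - m)" by (rule binomial_symmetric) (use 3 in simp)
      also have "n - m = Suc m" using 3 by simp
      finally show ?thesis by simp
    qed
    also have "\<dots> = (\<Sum>k\<in>{m, Suc m}. n choose k)" by simp
    also have "\<dots> \<le> (\<Sum>k\<le>n. n choose k)"
      by (rule sum_mono2) (use 3(1) in auto)
    finally have "2 * (n choose m) \<le> 2 ^ n" by (simp only: choose_row_sum)
    moreover have "(2::nat) ^ n = 2 * 4 ^ m"
      unfolding 3(1) power_add power_mult by (simp only: power_one_right mult.commute numeral_power_eq_of_nat_cancel_iff) simp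
    ultimately have "n choose m \<le> 4 ^ m" by linarith
    moreover have "n choose m > 0" using 3(1) by simp
    ultimately have "\<Prod>?B \<le> 4 ^ m" using dvd_imp_le[OF dvd] by linarith
    moreover have "\<Prod>?A \<le> 4 ^ (m + 1)" using less.IH[of "m + 1"] 3 by simp
    ultimately have "\<Prod>?A * \<Prod>?B \<le> 4 ^ (m + 1) * 4 ^ m" by (intro mult_le_mono)
    also have "\<dots> = 4 ^ (m + 1 + m)" by (rule power_add [symmetric])
    also have "m + 1 + m = n" using 3(1) by linarith
    finally show ?thesis unfolding split .
  qed
qed

lemma sum_ln_primes_le: "(\<Sum>p | prime p \<and> p \<le> (n::nat). ln (real p)) \<le> n * ln 4"
proof -
  have "(\<Sum>p | prime p \<and> p \<le> n. ln (real p)) = ln (real (\<Prod>p | prime p \<and> p \<le> n. p))"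
    by (subst of_nat_prod, subst ln_prod) (auto simp: prime_gt_0_nat)
  also have "\<dots> \<le> ln (real (4 ^ n))"
    using primorial_le[of n]
    by (subst ln_le_cancel_iff) (auto intro!: prod_pos simp: prime_gt_0_nat simp del: of_nat_prod of_nat_power)
  also have "\<dots> = n * ln 4" by (simp add: ln_realpow)
  finally show ?thesis .
qed

lemma card_multiples: "p > 0 \<Longrightarrow> card {m \<in> {1..n}. p dvd m} = n div (p::nat)"
proof -
  assume p: "p > 0"
  have "bij_betw (\<lambda>k. p * k) {1..n div p} {m \<in> {1..n}. p dvd m}"
    using p by (intro bij_betwI[where g = "\<lambda>m. m div p"])
      (auto simp: less_eq_div_iff_mult_less_eq mult.commute elim!: dvdE)
  from bij_betw_same_card[OF this] show ?thesis by simp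
qed

text \<open>Double counting of the pairs \<open>p dvd m\<close> with \<open>m \<le> n\<close>: for
  fixed \<open>m\<close> the sum of \<open>ln p\<close> over its prime divisors is at most
  \<open>ln m\<close>. Removing the floor from \<open>n div p\<close> costs one Chebyshev sum, the
  term \<open>ln 4\<close>.\<close>

lemma sum_ln_div_primes_le:
  fixes n :: nat
  assumes "n \<ge> 1"
  shows "(\<Sum>p | prime p \<and> p \<le> n. ln (real p) / p) \<le> ln n + ln 4"
proof -
  let ?P = "{p. prime p \<and> p \<le> n}"
  have "(\<Sum>p\<in>?P. ln (real p) * (n div p)) = (\<Sum>p\<in>?P. \<Sum>m\<in>{1..n}. if p dvd m then ln (real p) else 0)"
  proof (rule sum.cong[OF refl])
    fix p assume "p \<in> ?P"
    then have "card {m \<in> {1..n}. p dvd m} = n div p"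
      by (intro card_multiples) (auto simp: prime_gt_0_nat)
    then show "ln (real p) * (n div p) = (\<Sum>m\<in>{1..n}. if p dvd m then ln (real p) else 0)"
      by (subst sum.If_cases) (auto simp: Int_def conj_commute)
  qed
  also have "\<dots> = (\<Sum>m\<in>{1..n}. \<Sum>p\<in>?P. if p dvd m then ln (real p) else 0)"
    by (rule sum.swap)
  also have "\<dots> \<le> (\<Sum>m\<in>{1..n}. ln (real n))"
  proof (rule sum_mono)
    fix m assume m: "m \<in> {1..n}"
    let ?Q = "{p \<in> ?P. p dvd m}"
    have "(\<Sum>p\<in>?P. if p dvd m then ln (real p) else 0) = (\<Sum>p\<in>?Q. ln (real p))"
      by (subst sum.If_cases) (auto simp: Int_def)
    also have "\<dots> = ln (real (\<Prod>?Q))"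
      by (subst of_nat_prod, subst ln_prod) (auto simp: prime_gt_0_nat)
    also have "\<Prod>?Q \<le> m"
      by (rule dvd_imp_le[OF prod_primes_dvd]) (use m in auto)
    then have "ln (real (\<Prod>?Q)) \<le> ln (real n)"
      using m by (subst ln_le_cancel_iff) (auto intro!: prod_pos simp: prime_gt_0_nat simp del: of_nat_prod)
    finally show "(\<Sum>p\<in>?P. if p dvd m then ln (real p) else 0) \<le> ln (real n)" .
  qed
  finally have upper: "(\<Sum>p\<in>?P. ln (real p) * (n div p)) \<le> n * ln n" by simp
  have "n * (\<Sum>p\<in>?P. ln (real p) / p) - (\<Sum>p\<in>?P. ln (real p)) =
        (\<Sum>p\<in>?P. ln (real p) * (real n / real p - 1))"
    by (simp add: sum_distrib_left sum_subtractf algebra_simps)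
  also have "\<dots> \<le> (\<Sum>p\<in>?P. ln (real p) * (n div p))"
  proof (intro sum_mono mult_left_mono)
    fix p assume "p \<in> ?P"
    then have "p \<ge> 1" using prime_ge_1_nat by auto
    then show "ln (real p) \<ge> 0" by simp
    have "real n / real p \<le> real (n div p) + 1"
      using real_of_int_floor_add_one_ge[of "real n / real p"] by (simp add: floor_divide_of_nat_eq)
    then show "real n / real p - 1 \<le> real (n div p)" by simp
  qed
  finally have "n * (\<Sum>p\<in>?P. ln (real p) / p) \<le> n * ln n + n * ln 4"
    using upper sum_ln_primes_le[of n] by linarith
  then have "n * (\<Sum>p\<in>?P. ln (real p) / p) \<le> n * (ln n + ln 4)"
    by (simp add: algebra_simps)
  then show ?thesis using assms by simp
qed

lemma sum_inverse_squares_le: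
  fixes A :: "nat set"
  assumes "finite A" "\<And>n. n \<in> A \<Longrightarrow> n \<ge> z" "z \<ge> 2"
  shows "(\<Sum>n\<in>A. 1 / real n ^ 2) \<le> 1 / (real z - 1)"
proof -
  have "A \<subseteq> {z..<z + Suc (Max A)}"
    using assms(1,2) by (auto simp: less_Suc_eq_le intro!: trans_le_add2)
  then obtain b where b: "A \<subseteq> {z..<z + b}" by blast
  have "(\<Sum>n\<in>{z..<z + b}. 1 / real n ^ 2) \<le> 1 / (real z - 1) - 1 / (real (z + b) - 1)"
  proof (induction b)
    case (Suc b)
    have "1 / t ^ 2 \<le> 1 / (t - 1) - 1 / t" if "t > 1" for t :: real
      using that by (simp add: divide_simps power2_eq_square)
    from this[of "real (z + b)"] have "1 / real (z + b) ^ 2 \<le> 1 / (real (z + b) - 1) - 1 / real (z + b)"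
      using assms(3) by simp
    then show ?case using Suc by simp
  qed auto
  moreover have "(\<Sum>n\<in>A. 1 / real n ^ 2) \<le> (\<Sum>n\<in>{z..<z + b}. 1 / real n ^ 2)"
    using b by (intro sum_mono2) auto
  moreover have "1 / (real (z + b) - 1) \<ge> 0" using assms(3) by simp
  ultimately show ?thesis by linarith
qed

text \<open>Unique factorization. Finite sets of primes stand for squarefree numbers throughout, and
  this injectivity allows sums over such sets to be compared with sums over integers.\<close>

lemma inj_on_prod_primes:
  "inj_on (\<lambda>S. \<Prod>S) {S::nat set. finite S \<and> (\<forall>p\<in>S. prime p)}"
proof (rule inj_onI)
  have *: "S = {p. prime p \<and> p dvd \<Prod>S}" if S: "finite S" "\<forall>p\<in>S. prime p" for S :: "nat set"
  proof (intro equalityI subsetI)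
    fix p assume "p \<in> {p. prime p \<and> p dvd \<Prod>S}"
    then obtain r where "r \<in> S" "p dvd r" "prime p"
      using S by (auto simp: prime_dvd_prod_iff)
    then show "p \<in> S" using S primes_dvd_imp_eq[of p r] by auto
  qed (use S in \<open>auto intro: dvd_prodI\<close>)
  fix S T :: "nat set"
  assume "S \<in> {S. finite S \<and> (\<forall>p\<in>S. prime p)}" "T \<in> {S. finite S \<and> (\<forall>p\<in>S. prime p)}" "\<Prod>S = \<Prod>T"
  then show "S = T" using *[of S] *[of T] by auto
qed

text \<open>Comparison with the integral of \<open>x powr (-1 - s)\<close>. The induction carries
  the remaining tail \<open>real (Suc m) powr (-s) / s\<close>, so that each step is one application
  of the mean value theorem.\<close>

lemma sum_zeta_le:
  fixes s :: real
  assumes "s > 0"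
  shows "(\<Sum>n=1..K. real n powr (-1 - s)) \<le> 1 + 1 / s"
proof (cases K)
  case (Suc m)
  have "(\<Sum>n=1..Suc m. real n powr (-1 - s)) \<le> 1 + 1 / s - real (Suc m) powr (-s) / s" for m
  proof (induction m)
    case (Suc m)
    have "((\<lambda>x. - (x powr - s) / s) has_real_derivative x powr (- 1 - s)) (at x)"
      if "real (Suc m) \<le> x" for x
    proof -
      have "x > 0" using that by linarith
      then have "((\<lambda>x. - (x powr - s) / s) has_real_derivative - (- s * x powr (- s - 1)) / s) (at x)"
        by (intro DERIV_cdivide DERIV_minus has_real_derivative_powr)
      moreover have "- (- s * x powr (- s - 1)) / s = x powr (- 1 - s)"
      proof -
        have "- s - 1 = - 1 - s" by linarith
        then show ?thesis using assms by (simp only:) simp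
      qed
      ultimately show ?thesis by simp
    qed
    then have "\<exists>t>real (Suc m). t < real (Suc (Suc m)) \<and>
        (- (real (Suc (Suc m)) powr (-s)) / s) - (- (real (Suc m) powr (-s)) / s) =
        (real (Suc (Suc m)) - real (Suc m)) * (t powr (-1 - s))"
      by (intro MVT2) auto
    then obtain t where t: "t > real (Suc m)" "t < real (Suc (Suc m))"
        "(- (real (Suc (Suc m)) powr (-s)) / s) - (- (real (Suc m) powr (-s)) / s) =
        (real (Suc (Suc m)) - real (Suc m)) * (t powr (-1 - s))"
      by (elim exE conjE)
    have "real (Suc (Suc m)) - real (Suc m) = 1" by simp
    with t(3) have "real (Suc m) powr (-s) / s - real (Suc (Suc m)) powr (-s) / s = t powr (-1 - s)"
      by (simp only: mult_1_left minus_divide_left [symmetric])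
    moreover have "(\<Sum>n=1..Suc (Suc m). real n powr (-1 - s)) =
        (\<Sum>n=1..Suc m. real n powr (-1 - s)) + real (Suc (Suc m)) powr (-1 - s)"
      by simp
    moreover
    have "real (Suc (Suc m)) powr (-1 - s) \<le> t powr (-1 - s)"
      using t(1,2) assms by (intro powr_mono2') auto
    ultimately show ?case using Suc by linarith
  qed (use assms in auto)
  from this[of m] have "(\<Sum>n=1..K. real n powr (-1 - s)) \<le> 1 + 1 / s - real K powr (-s) / s"
    unfolding Suc .
  moreover have "real K powr (-s) / s \<ge> 0" using assms by simp
  ultimately show ?thesis by linarith
qed (use assms in auto)

lemma ln_one_plus_ge:
  fixes u :: real
  assumes "u \<ge> 0"
  shows "ln (1 + u) \<ge> u - u ^ 2"
proof -
  have "ln (1 + u) \<ge> u / (1 + u)"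
    using ln_le_minus_one[of "1 / (1 + u)"] assms by (simp add: ln_div field_simps)
  moreover have "(u - u ^ 2) * (1 + u) \<le> u"
    using assms by (simp add: algebra_simps power2_eq_square)
  then have "u - u ^ 2 \<le> u / (1 + u)"
    using assms by (simp add: le_divide_eq)
  ultimately show ?thesis by linarith
qed

text \<open>Rankin's trick: replacing \<open>1 / p\<close> by \<open>p powr (-1 - s)\<close> with \<open>s = 1 / ln n\<close> costs only
  \<open>s * (\<Sum>p\<le>n. ln p / p)\<close>, which is bounded, and the new sum is controlled by the zeta function
  at \<open>1 + s\<close>.\<close>

lemma sum_inverse_primes_le:
  fixes n :: nat
  assumes "n \<ge> 3"
  shows "(\<Sum>p | prime p \<and> p \<le> n. 1 / real p) \<le> ln (ln n) + 5"
proof -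
  define P where "P = {p. prime p \<and> p \<le> n}"
  have fin: "finite P" unfolding P_def by simp
  have pP: "prime p" "p \<ge> 2" if "p \<in> P" for p
    using that prime_ge_2_nat by (auto simp: P_def)
  have "exp (1::real) < real n" using e_less_272 assms by simp
  then have "ln (exp (1::real)) < ln (real n)" using assms by (subst ln_less_cancel_iff) auto
  then have lnn: "ln (real n) > 1" by simp
  define s where "s = 1 / ln (real n)"
  have s: "s > 0" "s \<le> 1" "s * ln (real n) = 1" "1 / s = ln (real n)"
    using lnn by (auto simp: s_def)
  define u where "u p = real p powr (-1 - s)" for p :: nat
  \<comment> \<open>Any common bound for the products of subsets of \<open>P\<close> would serve
    here: the zeta bound does not depend on it.\<close>
  define K where "K = Max ((\<lambda>S. \<Prod>S) ` Pow P)"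
  have "(\<Prod>p\<in>P. 1 + u p) = (\<Sum>S\<in>Pow P. \<Prod>p\<in>S. u p)"
    using prod_add[OF fin, of u "\<lambda>_. 1"] by (simp add: add.commute)
  also have "\<dots> = (\<Sum>S\<in>Pow P. u (\<Prod>S))"
    unfolding u_def by (intro sum.cong refl) (simp add: prod_powr_distrib)
  also have "\<dots> = (\<Sum>m\<in>(\<lambda>S. \<Prod>S) ` Pow P. u m)"
    by (subst sum.reindex)
       (auto intro!: inj_on_subset[OF inj_on_prod_primes] intro: finite_subset[OF _ fin] dest: pP)
  also have "\<dots> \<le> (\<Sum>m=1..K. u m)"
  proof (rule sum_mono2)
    show "(\<lambda>S. \<Prod>S) ` Pow P \<subseteq> {1..K}"
    proof
      fix m assume m: "m \<in> (\<lambda>S. \<Prod>S) ` Pow P"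
      then have "m \<le> K" unfolding K_def using fin by (intro Max_ge) auto
      moreover have "\<Prod>S \<ge> 1" if "S \<subseteq> P" for S
        using that pP(2) by (intro prod_ge_1) (fastforce dest: pP(2))
      then have "m \<ge> 1" using m by auto
      ultimately show "m \<in> {1..K}" by simp
    qed
  qed (auto simp: u_def)
  also have "\<dots> \<le> 1 + 1 / s" unfolding u_def by (rule sum_zeta_le) (rule s)
  finally have euler: "(\<Prod>p\<in>P. 1 + u p) \<le> 1 + 1 / s" .
  have u_pos: "u p > 0" "u p \<le> 1 / p" if "p \<in> P" for p
  proof -
    have "u p \<le> real p powr (-1)" unfolding u_def using pP[OF that] s by (intro powr_mono) auto
    then show "u p \<le> 1 / p" using pP[OF that] by (simp add: powr_minus divide_simps)
  qed (use pP[OF that] in \<open>simp add: u_def\<close>)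
  have "(\<Sum>p\<in>P. u p) - (\<Sum>p\<in>P. 1 / real p ^ 2) \<le> (\<Sum>p\<in>P. ln (1 + u p))"
    unfolding sum_subtractf [symmetric]
  proof (rule sum_mono)
    fix p assume p: "p \<in> P"
    have "u p ^ 2 \<le> (1 / real p) ^ 2"
      using u_pos[OF p] by (intro power_mono) auto
    then show "u p - 1 / real p ^ 2 \<le> ln (1 + u p)"
      using ln_one_plus_ge[of "u p"] u_pos[OF p] by (simp add: power_divide)
  qed
  also have "\<dots> = ln (\<Prod>p\<in>P. 1 + u p)"
    using fin u_pos(1) by (intro ln_prod [symmetric]) (auto simp: add_pos_pos less_imp_neq[symmetric])
  also have "\<dots> \<le> ln (1 + ln n)"
    using euler u_pos s lnn by (subst ln_le_cancel_iff) (auto intro!: prod_pos add_pos_pos)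
  also have "\<dots> \<le> ln (2 * ln n)" using lnn by (subst ln_le_cancel_iff) auto
  also have "\<dots> = ln 2 + ln (ln n)" using lnn by (simp add: ln_mult)
  finally have 1: "(\<Sum>p\<in>P. u p) \<le> ln 2 + ln (ln n) + (\<Sum>p\<in>P. 1 / real p ^ 2)" by simp
  have 2: "(\<Sum>p\<in>P. 1 / real p ^ 2) \<le> 1"
    using sum_inverse_squares_le[of P 2] fin pP by simp
  have "(\<Sum>p\<in>P. 1 / real p) - (\<Sum>p\<in>P. u p) \<le> (\<Sum>p\<in>P. s * (ln p / p))"
    unfolding sum_subtractf [symmetric]
  proof (rule sum_mono)
    fix p assume p: "p \<in> P"
    have "u p = exp (- (s * ln p)) / p"
    proof -
      have "u p = real p powr (- s) * real p powr (-1)"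
        unfolding u_def powr_add [symmetric] by (simp add: algebra_simps)
      then show ?thesis using pP[OF p] by (simp add: powr_minus_divide) (simp add: powr_def exp_minus divide_simps)
    qed
    also have "\<dots> \<ge> (1 - s * ln p) / p"
      using exp_ge_add_one_self[of "- (s * ln p)"] by (intro divide_right_mono) auto
    finally show "1 / real p - u p \<le> s * (ln p / p)" by (simp add: diff_divide_distrib)
  qed
  also have "\<dots> \<le> s * (ln n + ln 4)"
    unfolding sum_distrib_left [symmetric] P_def
    using sum_ln_div_primes_le[of n] assms s by (intro mult_left_mono) auto
  also have "\<dots> \<le> 1 + ln 4" using s by (simp add: distrib_left)
  finally have 3: "(\<Sum>p\<in>P. 1 / real p) \<le> (\<Sum>p\<in>P. u p) + 1 + ln 4" by simp
  \<comment> \<open>The errors collected are \<open>ln 2\<close> and \<open>ln 4\<close> from the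
    logarithms, 1 from the squares and 1 from the change of exponent; their total
    \<open>2 + 3 * ln 2\<close> is at most 5.\<close>
  have "ln 2 \<le> (1::real)" using ln_le_minus_one[of "2::real"] by simp
  moreover have "ln (4::real) = 2 * ln 2" using ln_realpow[of 2 2] by simp
  ultimately show ?thesis using 1 2 3 unfolding P_def by linarith
qed

lemma inverse_one_minus_le_exp:
  fixes p :: real
  assumes "p \<ge> 2"
  shows "1 / (1 - 1 / p) \<le> exp (1 / p + 2 / p ^ 2)"
proof -
  have "(1 + (1 / p + 2 / p ^ 2)) * (1 - 1 / p) \<ge> 1"
    using assms by (simp add: field_simps power2_eq_square)
  then have "1 / (1 - 1 / p) \<le> 1 + (1 / p + 2 / p ^ 2)"
    using assms by (simp add: pos_divide_le_eq)
  then show ?thesis using exp_ge_add_one_self[of "1 / p + 2 / p ^ 2"] by linarith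
qed

text \<open>The 7 in the constant is the 5 from the sum of \<open>1 / p\<close> plus twice the bound
  1 for the sum of \<open>1 / p ^ 2\<close>.\<close>

lemma mertens_prod_le:
  fixes n :: nat
  assumes "n \<ge> 3"
  shows "(\<Prod>p | prime p \<and> p \<le> n. 1 / (1 - 1 / real p)) \<le> exp 7 * ln n"
proof -
  define P where "P = {p. prime p \<and> p \<le> n}"
  have fin: "finite P" unfolding P_def by simp
  have pP: "prime p" "p \<ge> 2" if "p \<in> P" for p
    using that prime_ge_2_nat by (auto simp: P_def)
  have lnn: "ln (real n) > 0" using assms by simp
  have "(\<Prod>p\<in>P. 1 / (1 - 1 / real p)) \<le> (\<Prod>p\<in>P. exp (1 / real p + 2 / real p ^ 2))"
  proof (rule prod_mono, intro conjI)
    fix p assume "p \<in> P"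
    then have "real p \<ge> 2" using pP[of p] by simp
    then show "0 \<le> 1 / (1 - 1 / real p)" "1 / (1 - 1 / real p) \<le> exp (1 / real p + 2 / real p ^ 2)"
      using inverse_one_minus_le_exp by auto
  qed
  also have "\<dots> = exp ((\<Sum>p\<in>P. 1 / real p) + 2 * (\<Sum>p\<in>P. 1 / real p ^ 2))"
    using fin by (subst exp_sum [symmetric]) (auto simp: sum.distrib sum_distrib_left)
  also have "\<dots> \<le> exp (ln (ln n) + 7)"
  proof -
    have "(\<Sum>p\<in>P. 1 / real p ^ 2) \<le> 1"
      using sum_inverse_squares_le[of P 2] fin pP(2) by simp
    then show ?thesis
      using sum_inverse_primes_le[OF assms] by (simp flip: P_def)
  qed
  also have "\<dots> = exp 7 * ln n" using lnn by (simp add: exp_add)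
  finally show ?thesis unfolding P_def .
qed

lemma totient_prod:
  "q > 0 \<Longrightarrow> real (totient q) / real q = (\<Prod>p\<in>prime_factors q. 1 - 1 / real p)"
  using totient_formula2[of q] by simp

text \<open>If \<open>r\<close> prime factors of \<open>q\<close> are at least \<open>z\<close>,
  then \<open>2 ^ r \<le> q\<close>, so \<open>r \<le> 2 * z\<close> because
  \<open>ln q \<le> z\<close>. Each of them contributes at most \<open>exp (2 / z)\<close>, all
  together at most \<open>exp 4\<close>. Only the prime factors below \<open>z\<close> can make
  \<open>q / totient q\<close> large.\<close>

lemma totient_ratio_le:
  fixes q :: nat and z :: real
  assumes "q > 0" "z \<ge> 2" "ln q \<le> z"
  shows "real q / real (totient q) \<le>
    exp 4 * (\<Prod>p | p \<in> prime_factors q \<and> real p < z. 1 / (1 - 1 / real p))"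
proof -
  let ?S = "{p \<in> prime_factors q. real p < z}" and ?B = "{p \<in> prime_factors q. real p \<ge> z}"
  have pr: "p \<ge> 2" if "p \<in> prime_factors q" for p
    using that prime_ge_2_nat by auto
  have "2 ^ card ?B \<le> (\<Prod>p\<in>?B. p)"
    using prod_mono[of ?B "\<lambda>_. 2" "\<lambda>p. p"] pr by auto
  also have "\<dots> \<le> q"
    using assms(1) by (intro dvd_imp_le prod_primes_dvd) auto
  finally have "2 ^ card ?B \<le> real q" by (metis of_nat_le_iff of_nat_numeral of_nat_power)
  then have "card ?B * ln 2 \<le> ln q"
    using assms(1) by (subst ln_realpow [symmetric]) (auto simp: ln_le_cancel_iff)
  then have "card ?B * ln 2 \<le> z" using assms by linarith
  moreover have "ln (2::real) \<ge> 1 / 2" using ln_one_plus_ge[of "1::real"] ln2_ge_two_thirds by simp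
  then have "card ?B * (1 / 2) \<le> card ?B * ln 2" by (intro mult_left_mono) auto
  ultimately have cardB: "real (card ?B) \<le> 2 * z" by linarith
  have "(\<Prod>p\<in>?B. 1 / (1 - 1 / real p)) \<le> (\<Prod>p\<in>?B. exp (2 / z))"
  proof (rule prod_mono, intro conjI)
    fix p assume p: "p \<in> ?B"
    then have p2: "real p \<ge> 2" using pr by auto
    show "0 \<le> 1 / (1 - 1 / real p)" using p2 by simp
    have "1 / (1 - 1 / real p) \<le> 1 + 2 / p"
      using p2 by (simp add: field_simps)
    also have "\<dots> \<le> 1 + 2 / z" using p assms p2 by (simp add: frac_le)
    also have "\<dots> \<le> exp (2 / z)" by (rule exp_ge_add_one_self)
    finally show "1 / (1 - 1 / real p) \<le> exp (2 / z)" .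
  qed
  also have "\<dots> = exp (card ?B * (2 / z))" by (simp only: prod_constant exp_of_nat_mult)
  also have "\<dots> \<le> exp 4"
    using cardB assms by (simp add: divide_simps)
  finally have B: "(\<Prod>p\<in>?B. 1 / (1 - 1 / real p)) \<le> exp 4" .
  have "real q / real (totient q) = inverse (real (totient q) / real q)" by simp
  also have "\<dots> = (\<Prod>p\<in>prime_factors q. 1 / (1 - 1 / real p))"
    unfolding totient_prod[OF assms(1)] by (simp add: prod_inversef [symmetric] divide_inverse o_def)
  also have "prime_factors q = ?S \<union> ?B" by auto
  also have "(\<Prod>p\<in>?S \<union> ?B. 1 / (1 - 1 / real p)) =
      (\<Prod>p\<in>?S. 1 / (1 - 1 / real p)) * (\<Prod>p\<in>?B. 1 / (1 - 1 / real p))"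
    by (rule prod.union_disjoint) auto
  also have "\<dots> \<le> (\<Prod>p\<in>?S. 1 / (1 - 1 / real p)) * exp 4"
    using pr by (intro mult_left_mono B prod_nonneg) (fastforce simp: field_simps)
  finally show ?thesis by (simp add: mult.commute)
qed

section \<open>Random sieving of an interval\<close>

definition residue_choices :: "nat set \<Rightarrow> (nat \<Rightarrow> nat) set" where
  "residue_choices P = (\<Pi>\<^sub>E p\<in>P. {..<p})"

definition sifted :: "nat set \<Rightarrow> nat \<Rightarrow> (nat \<Rightarrow> nat) \<Rightarrow> nat set" where
  "sifted P M c = {i. i < M \<and> (\<forall>p\<in>P. i mod p \<noteq> c p)}"

text \<open>Expectation for independent, uniformly distributed residue classes, one for each
  \<open>p \<in> P\<close>: there are \<open>\<Prod>P\<close> choices in all.\<close>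

definition residue_mean :: "nat set \<Rightarrow> ((nat \<Rightarrow> nat) \<Rightarrow> real) \<Rightarrow> real" where
  "residue_mean P f = (\<Sum>c\<in>residue_choices P. f c) / real (\<Prod>P)"

definition sieve_density :: "nat set \<Rightarrow> nat set \<Rightarrow> real" where
  "sieve_density P I = (\<Prod>p\<in>P. 1 - real (card ((\<lambda>i. i mod p) ` I)) / real p)"

lemma finite_residue_choices: "finite P \<Longrightarrow> finite (residue_choices P)"
  unfolding residue_choices_def by (intro finite_PiE) auto

lemma finite_sifted [simp]: "finite (sifted P M c)"
  unfolding sifted_def by simp

lemma sifted_subset: "sifted P M c \<subseteq> {..<M}"
  unfolding sifted_def by auto

lemma residue_mean_mono:
  "(\<And>c. c \<in> residue_choices P \<Longrightarrow> f c \<le> g c) \<Longrightarrow> residue_mean P f \<le> residue_mean P g"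
  unfolding residue_mean_def by (intro divide_right_mono sum_mono of_nat_0_le_iff)

lemma residue_mean_add: "residue_mean P (\<lambda>c. f c + g c) = residue_mean P f + residue_mean P g"
  unfolding residue_mean_def by (simp add: sum.distrib add_divide_distrib)

lemma residue_mean_diff: "residue_mean P (\<lambda>c. f c - g c) = residue_mean P f - residue_mean P g"
  unfolding residue_mean_def by (simp add: sum_subtractf diff_divide_distrib)

lemma residue_mean_cmult: "residue_mean P (\<lambda>c. a * f c) = a * residue_mean P f"
  unfolding residue_mean_def by (simp add: sum_distrib_left)

lemma residue_mean_const:
  assumes "finite P" "\<And>p. p \<in> P \<Longrightarrow> prime p"
  shows "residue_mean P (\<lambda>c. a) = a"
proof -
  have "card (residue_choices P) = \<Prod>P"
    unfolding residue_choices_def using assms by (subst card_PiE) auto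
  moreover have "\<Prod>P > 0" using assms by (intro prod_pos) (auto dest: prime_gt_0_nat)
  ultimately show ?thesis unfolding residue_mean_def by (simp del: of_nat_prod)
qed

lemma residue_mean_sum: "residue_mean P (\<lambda>c. \<Sum>x\<in>A. f x c) = (\<Sum>x\<in>A. residue_mean P (f x))"
  unfolding residue_mean_def by (subst sum.swap) (simp add: sum_divide_distrib)

lemma residue_mean_cong:
  "(\<And>c. c \<in> residue_choices P \<Longrightarrow> f c = g c) \<Longrightarrow> residue_mean P f = residue_mean P g"
  unfolding residue_mean_def by simp

text \<open>This is independence: the choices that spare \<open>I\<close> form a product set, with
  the complement of the image of \<open>I\<close> modulo \<open>p\<close> as the factor at
  \<open>p\<close>.\<close>

lemma residue_mean_subset_sifted:
  assumes "finite P" "\<And>p. p \<in> P \<Longrightarrow> prime p" "I \<subseteq> {..<M}"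
  shows "residue_mean P (\<lambda>c. of_bool (I \<subseteq> sifted P M c)) = sieve_density P I"
proof -
  have finI: "finite I" using assms(3) by (rule finite_subset) simp
  have eq: "{c \<in> residue_choices P. I \<subseteq> sifted P M c} = (\<Pi>\<^sub>E p\<in>P. {..<p} - (\<lambda>i. i mod p) ` I)"
  proof (intro equalityI subsetI)
    fix c assume "c \<in> {c \<in> residue_choices P. I \<subseteq> sifted P M c}"
    then have c: "c \<in> (\<Pi>\<^sub>E p\<in>P. {..<p})" "\<And>i p. i \<in> I \<Longrightarrow> p \<in> P \<Longrightarrow> i mod p \<noteq> c p"
      unfolding residue_choices_def sifted_def by auto
    show "c \<in> (\<Pi>\<^sub>E p\<in>P. {..<p} - (\<lambda>i. i mod p) ` I)"
    proof (rule PiE_I)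
      fix p assume p: "p \<in> P"
      show "c p \<in> {..<p} - (\<lambda>i. i mod p) ` I"
      proof
        show "c p \<in> {..<p}" using c(1) p by (rule PiE_mem)
        show "c p \<notin> (\<lambda>i. i mod p) ` I"
        proof
          assume "c p \<in> (\<lambda>i. i mod p) ` I"
          then obtain i where "c p = i mod p" "i \<in> I" by (rule imageE)
          with c(2)[OF _ p] show False by metis
        qed
      qed
    qed (use PiE_arb[OF c(1)] in simp)
  next
    fix c assume c: "c \<in> (\<Pi>\<^sub>E p\<in>P. {..<p} - (\<lambda>i. i mod p) ` I)"
    have m: "c p < p" "c p \<notin> (\<lambda>i. i mod p) ` I" if "p \<in> P" for p
      using PiE_mem[OF c that] by blast+
    have "c \<in> residue_choices P" unfolding residue_choices_def
      by (rule PiE_I) (use m(1) PiE_arb[OF c] in \<open>simp_all only: lessThan_iff\<close>)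
    moreover have "i \<in> sifted P M c" if "i \<in> I" for i
    proof -
      have "i mod p \<noteq> c p" if "p \<in> P" for p
        using m(2)[OF that] imageI[OF \<open>i \<in> I\<close>, of "\<lambda>i. i mod p"] by metis
      moreover have "i < M" using assms(3) that by blast
      ultimately show ?thesis by (simp add: sifted_def)
    qed
    ultimately show "c \<in> {c \<in> residue_choices P. I \<subseteq> sifted P M c}" by blast
  qed
  have "real (card {c \<in> residue_choices P. I \<subseteq> sifted P M c}) =
      (\<Prod>p\<in>P. real (card ({..<p} - (\<lambda>i. i mod p) ` I)))"
    unfolding eq using assms(1) by (simp add: card_PiE)
  also have "\<dots> = (\<Prod>p\<in>P. real p * (1 - real (card ((\<lambda>i. i mod p) ` I)) / real p))"
  proof (rule prod.cong[OF refl])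
    fix p assume "p \<in> P"
    then have p: "p > 0" using assms(2) prime_gt_0_nat by blast
    have sub: "(\<lambda>i. i mod p) ` I \<subseteq> {..<p}" using p by auto
    have "card ({..<p} - (\<lambda>i. i mod p) ` I) = p - card ((\<lambda>i. i mod p) ` I)"
      using card_Diff_subset[OF finite_imageI[OF finI] sub] by simp
    moreover have "card ((\<lambda>i. i mod p) ` I) \<le> p" using card_mono[OF _ sub] by simp
    ultimately show "real (card ({..<p} - (\<lambda>i. i mod p) ` I)) =
        real p * (1 - real (card ((\<lambda>i. i mod p) ` I)) / real p)"
      using p by (simp add: of_nat_diff right_diff_distrib)
  qed
  also have "\<dots> = real (\<Prod>P) * sieve_density P I"
    by (simp add: prod.distrib sieve_density_def)
  finally have "real (card {c \<in> residue_choices P. I \<subseteq> sifted P M c}) = real (\<Prod>P) * sieve_density P I" .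
  moreover have "\<Prod>P > 0" using assms by (intro prod_pos) (auto dest: prime_gt_0_nat)
  moreover have "(\<Sum>c\<in>residue_choices P. of_bool (I \<subseteq> sifted P M c)) =
      real (card {c \<in> residue_choices P. I \<subseteq> sifted P M c})"
    using finite_residue_choices[OF assms(1)] by (simp add: of_bool_def sum.If_cases Int_def)
  ultimately show ?thesis unfolding residue_mean_def by (simp del: of_nat_prod)
qed

text \<open>The binomial coefficient counts the \<open>j\<close>-subsets of the sifted set. The
  identity is the bridge from sums of singular series to moments of a single random
  variable.\<close>

lemma residue_mean_choose:
  assumes "finite P" "\<And>p. p \<in> P \<Longrightarrow> prime p"
  shows "residue_mean P (\<lambda>c. real (card (sifted P M c) choose j)) =
    (\<Sum>I | I \<subseteq> {..<M} \<and> card I = j. sieve_density P I)"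
proof -
  let ?F = "{I. I \<subseteq> {..<M} \<and> card I = j}"
  have finF: "finite ?F" by (rule finite_subset[of _ "Pow {..<M}"]) auto
  have "real (card (sifted P M c) choose j) = (\<Sum>I\<in>?F. of_bool (I \<subseteq> sifted P M c))" for c
  proof -
    have "(card (sifted P M c) choose j) = card {I. I \<subseteq> sifted P M c \<and> card I = j}"
      by (simp add: n_subsets)
    also have "{I. I \<subseteq> sifted P M c \<and> card I = j} = {I \<in> ?F. I \<subseteq> sifted P M c}"
      using sifted_subset[of P M c] by blast
    finally show ?thesis using finF by (simp add: of_bool_def sum.If_cases Int_def)
  qed
  then have "residue_mean P (\<lambda>c. real (card (sifted P M c) choose j)) =
      (\<Sum>I\<in>?F. residue_mean P (\<lambda>c. of_bool (I \<subseteq> sifted P M c)))"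
    by (simp only: residue_mean_sum)
  also have "\<dots> = (\<Sum>I\<in>?F. sieve_density P I)"
    using assms by (intro sum.cong refl residue_mean_subset_sifted) auto
  finally show ?thesis .
qed

lemma residue_mean_card:
  assumes "finite P" "\<And>p. p \<in> P \<Longrightarrow> prime p"
  shows "residue_mean P (\<lambda>c. real (card (sifted P M c))) = M * (\<Prod>p\<in>P. 1 - 1 / real p)"
proof -
  have "real (card (sifted P M c)) = (\<Sum>i<M. of_bool ({i} \<subseteq> sifted P M c))" for c
    using sifted_subset[of P M c] by (simp add: of_bool_def sum.If_cases Int_absorb1)
  then have "residue_mean P (\<lambda>c. real (card (sifted P M c))) =
      (\<Sum>i<M. residue_mean P (\<lambda>c. of_bool ({i} \<subseteq> sifted P M c)))"
    by (simp only: residue_mean_sum)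
  also have "\<dots> = (\<Sum>i<M. sieve_density P {i})"
    using assms by (intro sum.cong refl residue_mean_subset_sifted) auto
  finally show ?thesis by (simp add: sieve_density_def)
qed

lemma card_residue_class_mult:
  assumes "r < D"
  shows "card {i. i < n * D \<and> i mod D = r} = (n::nat)"
proof (induction n)
  case (Suc n)
  have "{i. i < Suc n * D \<and> i mod D = r} = insert (n * D + r) {i. i < n * D \<and> i mod D = r}"
  proof (intro equalityI subsetI)
    fix i assume i: "i \<in> {i. i < Suc n * D \<and> i mod D = r}"
    show "i \<in> insert (n * D + r) {i. i < n * D \<and> i mod D = r}"
    proof (cases "i < n * D")
      case False
      then have "i div D = n" using i by (intro div_nat_eqI) (auto simp: mult.commute)
      then have "i = n * D + r" using div_mult_mod_eq[of i D] i by simp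
      then show ?thesis by simp
    qed (use i in auto)
  qed (use assms in auto)
  then show ?case using Suc assms by simp
qed auto

lemma card_residue_class:
  assumes "r < D"
  shows "\<bar>real (card {i. i < M \<and> i mod D = r}) - real M / real D\<bar> \<le> 1"
proof -
  define n where "n = M div D"
  have D: "D > 0" using assms by simp
  have n: "n * D \<le> M" "M < Suc n * D"
    unfolding n_def using D by (auto simp: dividend_less_div_times)
  have "card {i. i < n * D \<and> i mod D = r} \<le> card {i. i < M \<and> i mod D = r}"
    using n by (intro card_mono) auto
  moreover have "card {i. i < M \<and> i mod D = r} \<le> card {i. i < Suc n * D \<and> i mod D = r}"
    using n by (intro card_mono) auto
  ultimately have "n \<le> card {i. i < M \<and> i mod D = r}" "card {i. i < M \<and> i mod D = r} \<le> Suc n"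
    unfolding card_residue_class_mult[OF assms] by auto
  moreover have "real n * real D \<le> real M" "real M \<le> (real n + 1) * real D"
    using n by (simp_all flip: of_nat_mult of_nat_Suc add: add.commute)
  then have "real n \<le> real M / real D" "real M / real D \<le> real n + 1"
    using D by (auto simp: field_simps)
  ultimately show ?thesis by simp
qed

text \<open>The Chinese remainder theorem merges the conditions into one class modulo
  \<open>\<Prod>T\<close>; the rounding error is therefore 1, however many primes \<open>T\<close>
  contains.\<close>

lemma card_simultaneous_residues:
  assumes "finite T" "\<And>p. p \<in> T \<Longrightarrow> prime p"
  shows "\<bar>real (card {i. i < M \<and> (\<forall>p\<in>T. i mod p = c p mod p)}) - real M / real (\<Prod>T)\<bar> \<le> 1"
proof -
  have cop: "\<forall>p\<in>T. \<forall>r\<in>T. p \<noteq> r \<longrightarrow> coprime p r"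
    using assms(2) by (auto intro: primes_coprime)
  obtain x where x: "\<forall>p\<in>T. [x = c p] (mod p)"
    using chinese_remainder_nat[OF assms(1) cop] by blast
  have D: "\<Prod>T > 0" using assms by (intro prod_pos) (auto dest: prime_gt_0_nat)
  have "(\<forall>p\<in>T. i mod p = c p mod p) \<longleftrightarrow> i mod \<Prod>T = x mod \<Prod>T" for i
  proof -
    have "(\<forall>p\<in>T. i mod p = c p mod p) \<longleftrightarrow> (\<forall>p\<in>T. [i = x] (mod p))"
      using x unfolding cong_def by (intro ball_cong refl) simp
    also have "\<dots> \<longleftrightarrow> [i = x] (mod \<Prod>T)"
    proof
      assume "\<forall>p\<in>T. [i = x] (mod p)"
      then show "[i = x] (mod \<Prod>T)"
        using cop coprime_cong_prod_nat[of T "\<lambda>p. p" i x] by blast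
    next
      assume "[i = x] (mod \<Prod>T)"
      then show "\<forall>p\<in>T. [i = x] (mod p)"
        using dvd_prodI[OF assms(1), of _ "\<lambda>p. p"] cong_dvd_modulus_nat by blast
    qed
    finally show ?thesis unfolding cong_def .
  qed
  then show ?thesis using card_residue_class[of "x mod \<Prod>T" "\<Prod>T" M] D by simp
qed

text \<open>The summand \<open>1 - v / p\<close> with \<open>v \<in> {1, 2}\<close> is \<open>1 - 2 / p\<close> plus \<open>1 / p\<close> when \<open>i\<close> and \<open>i'\<close> agree
  modulo \<open>p\<close>. All coefficients in the expanded product are nonnegative, so the trivial count of pairs
  in a common residue class already gives the variance bound.\<close>

lemma residue_mean_card_square_le:
  fixes P :: "nat set" and M :: nat
  assumes "finite P" "\<And>p. p \<in> P \<Longrightarrow> prime p"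
  defines "l \<equiv> M * (\<Prod>p\<in>P. 1 - 1 / real p)"
  shows "residue_mean P (\<lambda>c. real (card (sifted P M c)) ^ 2) \<le> l ^ 2 + l"
proof -
  let ?X = "\<lambda>c. card (sifted P M c)"
  let ?w = "\<lambda>T. (\<Prod>p\<in>T. 1 / real p) * (\<Prod>p\<in>P - T. 1 - 2 / real p)"
  have p2: "p \<ge> 2" if "p \<in> P" for p using assms(2)[OF that] by (rule prime_ge_2_nat)
  have X: "real (?X c) = (\<Sum>i<M. of_bool (i \<in> sifted P M c))" for c
    using sifted_subset[of P M c] by (simp add: of_bool_def sum.If_cases Int_absorb1)
  have "real (?X c) ^ 2 = (\<Sum>i<M. \<Sum>i'<M. of_bool ({i, i'} \<subseteq> sifted P M c))" for c
    unfolding X power2_eq_square sum_product by (simp add: of_bool_conj)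
  then have "residue_mean P (\<lambda>c. real (?X c) ^ 2) =
      (\<Sum>i<M. \<Sum>i'<M. residue_mean P (\<lambda>c. of_bool ({i, i'} \<subseteq> sifted P M c)))"
    by (simp only: residue_mean_sum)
  also have "\<dots> = (\<Sum>i<M. \<Sum>i'<M. sieve_density P {i, i'})"
    using assms by (intro sum.cong refl residue_mean_subset_sifted) auto
  also have "\<dots> = (\<Sum>i<M. \<Sum>i'<M. \<Sum>T\<in>Pow P. ?w T *
      of_bool (\<forall>p\<in>T. i' mod p = i mod p))"
  proof (intro sum.cong refl)
    fix i i'
    have "sieve_density P {i, i'} =
        (\<Prod>p\<in>P. of_bool (i' mod p = i mod p) * (1 / real p) + (1 - 2 / real p))"
      unfolding sieve_density_def by (intro prod.cong refl) (auto simp: card_insert_if)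
    also have "\<dots> = (\<Sum>T\<in>Pow P. (\<Prod>p\<in>T. of_bool (i' mod p = i mod p) * (1 / real p)) *
        (\<Prod>p\<in>P - T. 1 - 2 / real p))"
      by (rule prod_add) fact
    also have "\<dots> = (\<Sum>T\<in>Pow P. ?w T *
      of_bool (\<forall>p\<in>T. i' mod p = i mod p))"
    proof (intro sum.cong refl)
      fix T assume "T \<in> Pow P"
      then have "finite T" using assms(1) finite_subset by auto
      then have "(\<Prod>p\<in>T. of_bool (i' mod p = i mod p) :: real) = of_bool (\<forall>p\<in>T. i' mod p = i mod p)"
        by (induction T rule: finite_induct) auto
      then show "(\<Prod>p\<in>T. of_bool (i' mod p = i mod p) * (1 / real p)) * (\<Prod>p\<in>P - T. 1 - 2 / real p) =
          ?w T * of_bool (\<forall>p\<in>T. i' mod p = i mod p)"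
        unfolding prod.distrib by (simp only:) (simp only: mult.assoc mult.commute mult.left_commute)
    qed
    finally show "sieve_density P {i, i'} = (\<Sum>T\<in>Pow P. ?w T *
      of_bool (\<forall>p\<in>T. i' mod p = i mod p))" .
  qed
  also have "\<dots> = (\<Sum>i<M. \<Sum>T\<in>Pow P. \<Sum>i'<M. ?w T *
      of_bool (\<forall>p\<in>T. i' mod p = i mod p))"
    by (intro sum.cong refl sum.swap)
  also have "\<dots> \<le> (\<Sum>i<M. \<Sum>T\<in>Pow P. ?w T *
      (M * (\<Prod>p\<in>T. 1 / real p) + 1))"
  proof (intro sum_mono)
    fix i T assume "T \<in> Pow P"
    then have T: "T \<subseteq> P" "finite T" using assms(1) finite_subset by auto
    have "(\<Sum>i'<M. of_bool (\<forall>p\<in>T. i' mod p = i mod p)) =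
        real (card {i'. i' < M \<and> (\<forall>p\<in>T. i' mod p = i mod p)})"
      by (simp add: of_bool_def sum.If_cases Int_def)
    also have "\<dots> \<le> M / real (\<Prod>T) + 1"
    proof -
      have "prime p" if "p \<in> T" for p using that T(1) assms(2) by blast
      from card_simultaneous_residues[OF T(2) this, of M "\<lambda>_. i"] show ?thesis by linarith
    qed
    also have "\<dots> = M * (\<Prod>p\<in>T. 1 / real p) + 1" by (simp add: prod_dividef)
    finally have count: "(\<Sum>i'<M. of_bool (\<forall>p\<in>T. i' mod p = i mod p)) \<le> M * (\<Prod>p\<in>T. 1 / real p) + 1" .
    have "0 \<le> (\<Prod>p\<in>P - T. 1 - 2 / real p)"
    proof (rule prod_nonneg)
      fix p assume "p \<in> P - T"
      then have "real p \<ge> 2" using p2[of p] by simp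
      then show "0 \<le> 1 - 2 / real p" by (simp add: divide_le_eq_1)
    qed
    then show "(\<Sum>i'<M. ?w T * of_bool (\<forall>p\<in>T. i' mod p = i mod p))
      \<le> ?w T * (M * (\<Prod>p\<in>T. 1 / real p) + 1)"
      unfolding sum_distrib_left [symmetric]
      by (intro mult_left_mono count mult_nonneg_nonneg[OF prod_nonneg]) simp_all
  qed
  also have "\<dots> = M * (M * (\<Sum>T\<in>Pow P. (\<Prod>p\<in>T. 1 / real p * (1 / real p)) * (\<Prod>p\<in>P - T. 1 - 2 / real p)) +
      (\<Sum>T\<in>Pow P. (\<Prod>p\<in>T. 1 / real p) * (\<Prod>p\<in>P - T. 1 - 2 / real p)))"
    unfolding prod.distrib by (simp add: sum.distrib [symmetric] sum_distrib_left algebra_simps)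
  \<comment> \<open>Both sums over \<open>T\<close> fold back into Euler products. The local factor
    \<open>1 / p ^ 2 + 1 - 2 / p = (1 - 1 / p) ^ 2\<close> yields the term \<open>l ^ 2\<close>, and
    \<open>1 / p + 1 - 2 / p = 1 - 1 / p\<close>, which comes from the rounding errors, yields the
    term \<open>l\<close>.\<close>
  also have "(\<Sum>T\<in>Pow P. (\<Prod>p\<in>T. 1 / real p * (1 / real p)) * (\<Prod>p\<in>P - T. 1 - 2 / real p)) =
      (\<Prod>p\<in>P. 1 / real p * (1 / real p) + (1 - 2 / real p))"
    by (rule prod_add [symmetric]) fact
  also have "(\<Prod>p\<in>P. 1 / real p * (1 / real p) + (1 - 2 / real p)) = (\<Prod>p\<in>P. 1 - 1 / real p) ^ 2"
    unfolding prod_power_distrib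
    by (intro prod.cong refl) (simp add: power2_eq_square algebra_simps)
  also have "(\<Sum>T\<in>Pow P. (\<Prod>p\<in>T. 1 / real p) * (\<Prod>p\<in>P - T. 1 - 2 / real p)) =
      (\<Prod>p\<in>P. 1 / real p + (1 - 2 / real p))"
    by (rule prod_add [symmetric]) fact
  also have "\<dots> = (\<Prod>p\<in>P. 1 - 1 / real p)" by simp
  finally show ?thesis unfolding l_def by (simp add: power2_eq_square algebra_simps)
qed

section \<open>An upper bound sieve from orthogonal weights\<close>

text \<open>Inclusion-exclusion read as a product over \<open>S\<close>: a point of \<open>F\<close>
  is forced into \<open>T\<close> and contributes 1, a point outside \<open>F\<close> may lie in
  \<open>T\<close> or not and contributes \<open>1 - 1 = 0\<close>.\<close>

lemma sum_alternating_supersets: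
  assumes "finite S" "F \<subseteq> S"
  shows "(\<Sum>T\<in>Pow S. of_bool (F \<subseteq> T) * (-1) ^ card (S - T)) = (of_bool (F = S) :: real)"
proof -
  have "(\<Sum>T\<in>Pow S. of_bool (F \<subseteq> T) * (-1) ^ card (S - T)) =
      (\<Sum>T\<in>Pow S. (\<Prod>p\<in>T. 1) * (\<Prod>p\<in>S - T. if p \<in> F then 0 else - 1 :: real))"
  proof (intro sum.cong refl)
    fix T assume "T \<in> Pow S"
    show "of_bool (F \<subseteq> T) * (-1) ^ card (S - T) =
        (\<Prod>p\<in>T. 1) * (\<Prod>p\<in>S - T. if p \<in> F then 0 else - 1 :: real)"
    proof (cases "F \<subseteq> T")
      case True
      then have "(\<Prod>p\<in>S - T. if p \<in> F then 0 else - 1 :: real) = (\<Prod>p\<in>S - T. - 1)"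
        by (intro prod.cong) auto
      then show ?thesis using True by simp
    next
      case False
      then obtain p where "p \<in> S - T" "p \<in> F" using assms(2) by auto
      then have "(\<Prod>p\<in>S - T. if p \<in> F then 0 else - 1 :: real) = 0"
        using assms(1) by (intro prod_zero) auto
      then show ?thesis using False by simp
    qed
  qed
  also have "\<dots> = (\<Prod>p\<in>S. 1 + (if p \<in> F then 0 else - 1))"
    by (rule prod_add [symmetric]) fact
  also have "\<dots> = (\<Prod>p\<in>S. of_bool (p \<in> F))"
    by (intro prod.cong refl) auto
  also have "\<dots> = of_bool (\<forall>p\<in>S. p \<in> F)"
    using assms(1) by (induction S rule: finite_induct) auto
  also have "(\<forall>p\<in>S. p \<in> F) \<longleftrightarrow> F = S" using assms(2) by auto
  finally show ?thesis .
qed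

text \<open>Orthogonality of the sieve weights: with \<open>\<Prod>(T \<inter> T')\<close> written as the sum of
  \<open>\<Prod>p\<in>F. p - 1\<close> over \<open>F \<subseteq> T \<inter> T'\<close>, both alternating sums collapse to \<open>F = S\<close> and \<open>F = S'\<close>.\<close>

lemma sum_alternating_prod_Int:
  fixes S S' :: "nat set"
  assumes "finite S" "finite S'"
  shows "(\<Sum>T\<in>Pow S. \<Sum>T'\<in>Pow S'. (-1) ^ card (S - T) * (-1) ^ card (S' - T') * real (\<Prod>(T \<inter> T'))) =
    (if S = S' then \<Prod>p\<in>S. real p - 1 else 0)"
proof -
  let ?K = "Pow (S \<inter> S')" and ?f = "\<lambda>F::nat set. \<Prod>p\<in>F. real p - 1"
  have finK: "finite ?K" using assms by simp
  have expand: "real (\<Prod>(T \<inter> T')) = (\<Sum>F\<in>?K. ?f F * of_bool (F \<subseteq> T) * of_bool (F \<subseteq> T'))"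
    if "T \<in> Pow S" "T' \<in> Pow S'" for T T'
  proof -
    have fin: "finite (T \<inter> T')" using that assms by (auto intro: finite_subset)
    have "real (\<Prod>(T \<inter> T')) = (\<Prod>p\<in>T \<inter> T'. (real p - 1) + 1)" by simp
    also have "\<dots> = (\<Sum>F\<in>Pow (T \<inter> T'). ?f F * (\<Prod>p\<in>T \<inter> T' - F. 1))"
      by (rule prod_add) fact
    also have "\<dots> = (\<Sum>F\<in>Pow (T \<inter> T'). ?f F * of_bool (F \<subseteq> T) * of_bool (F \<subseteq> T'))"
      by (intro sum.cong refl) auto
    also have "\<dots> = (\<Sum>F\<in>?K. ?f F * of_bool (F \<subseteq> T) * of_bool (F \<subseteq> T'))"
      using that finK by (intro sum.mono_neutral_left) auto
    finally show ?thesis .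
  qed
  let ?a = "\<lambda>F T. of_bool (F \<subseteq> T) * (-1) ^ card (S - T) :: real"
  let ?a' = "\<lambda>F T'. of_bool (F \<subseteq> T') * (-1) ^ card (S' - T') :: real"
  have "(\<Sum>T\<in>Pow S. \<Sum>T'\<in>Pow S'. (-1) ^ card (S - T) * (-1) ^ card (S' - T') * real (\<Prod>(T \<inter> T'))) =
      (\<Sum>T\<in>Pow S. \<Sum>T'\<in>Pow S'. \<Sum>F\<in>?K. ?f F * (?a F T) *
        (?a' F T'))"
    by (intro sum.cong refl) (simp only: expand sum_distrib_left mult_ac)
  also have "\<dots> = (\<Sum>T\<in>Pow S. \<Sum>F\<in>?K. \<Sum>T'\<in>Pow S'. ?f F * (?a F T) *
        (?a' F T'))"
    by (intro sum.cong refl sum.swap)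
  also have "\<dots> = (\<Sum>F\<in>?K. \<Sum>T\<in>Pow S. \<Sum>T'\<in>Pow S'. ?f F * (?a F T) *
        (?a' F T'))"
    by (rule sum.swap)
  also have "\<dots> = (\<Sum>F\<in>?K. ?f F * (\<Sum>T\<in>Pow S. ?a F T) *
        (\<Sum>T'\<in>Pow S'. ?a' F T'))"
    by (simp only: sum_distrib_left [symmetric] sum_distrib_right [symmetric])
  also have "\<dots> = (\<Sum>F\<in>?K. ?f F * of_bool (F = S) * of_bool (F = S'))"
  proof (intro sum.cong refl)
    fix F assume "F \<in> ?K"
    then have "F \<subseteq> S" "F \<subseteq> S'" by auto
    then show "?f F * (\<Sum>T\<in>Pow S. ?a F T) *
        (\<Sum>T'\<in>Pow S'. ?a' F T') =
        ?f F * of_bool (F = S) * of_bool (F = S')"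
      by (simp only: sum_alternating_supersets assms)
  qed
  also have "\<dots> = (\<Sum>F\<in>?K. if F = S then (if S = S' then ?f S else 0) else 0)"
    by (intro sum.cong refl) auto
  also have "\<dots> = (if S = S' then ?f S else 0)"
    using finK by (subst sum.delta) auto
  finally show ?thesis .
qed

definition sieve_support :: "nat set \<Rightarrow> nat \<Rightarrow> nat set set" where
  "sieve_support P R = {S. S \<subseteq> P \<and> \<Prod>S \<le> R}"

text \<open>For a set \<open>S\<close> of primes with product \<open>n\<close> the summand is
  \<open>1 / totient n\<close>, so this is the usual denominator of Selberg's sieve, restricted to
  squarefree \<open>n \<le> R\<close> composed of primes in \<open>P\<close>.\<close>

definition sieve_norm :: "nat set \<Rightarrow> nat \<Rightarrow> real" where
  "sieve_norm P R = (\<Sum>S\<in>sieve_support P R. \<Prod>p\<in>S. 1 / (real p - 1))"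

lemma finite_sieve_support: "finite P \<Longrightarrow> finite (sieve_support P R)"
  unfolding sieve_support_def by (rule finite_subset[of _ "Pow P"]) auto

lemma card_sieve_support_le:
  assumes "finite P" "\<And>p. p \<in> P \<Longrightarrow> prime p"
  shows "card (sieve_support P R) \<le> R"
proof -
  have "inj_on (\<lambda>S. \<Prod>S) (sieve_support P R)"
    using assms finite_subset
    by (intro inj_on_subset[OF inj_on_prod_primes]) (auto simp: sieve_support_def)
  moreover have "(\<lambda>S. \<Prod>S) ` sieve_support P R \<subseteq> {1..R}"
  proof
    fix m assume "m \<in> (\<lambda>S. \<Prod>S) ` sieve_support P R"
    then obtain S where S: "S \<subseteq> P" "m = \<Prod>S" "m \<le> R" by (auto simp: sieve_support_def)
    have "\<Prod>S > 0"
    proof (rule prod_pos)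
      fix p assume "p \<in> S"
      then have "prime p" using S assms(2) by auto
      then show "p > 0" by (rule prime_gt_0_nat)
    qed
    then show "m \<in> {1..R}" using S by simp
  qed
  ultimately have "card (sieve_support P R) \<le> card {1..R}"
    by (intro card_inj_on_le) auto
  then show ?thesis by simp
qed

text \<open>A large-sieve form of Selberg's sieve: the weight
  \<open>W i = (\<Sum>S. \<Prod>p\<in>S. (1 - p * [i mod p = c p]) / (p - 1))\<close> equals \<open>sieve_norm P R\<close> at every sifted \<open>i\<close>,
  and its mean square over \<open>i < M\<close> is \<open>M * sieve_norm P R\<close> up to a small error.\<close>

lemma card_sifted_mult_norm_le:
  assumes "finite P" "\<And>p. p \<in> P \<Longrightarrow> prime p" "c \<in> residue_choices P" "R ^ 6 \<le> M" "R \<ge> 1"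
  shows "real (card (sifted P M c)) * sieve_norm P R \<le> 2 * M"
proof -
  let ?A = "sieve_support P R" and ?G = "sieve_norm P R"
  define g where "g S = (\<Prod>p\<in>S. 1 / (real p - 1))" for S :: "nat set"
  define e :: "nat set \<Rightarrow> nat \<Rightarrow> real" where "e T i = of_bool (\<forall>p\<in>T. i mod p = c p)" for T i
  \<comment> \<open>The sign is opposite to that of the weight described above: the factor is
    \<open>p * [i mod p = c p] - 1\<close>, and the power of \<open>- 1\<close> in \<open>W\<close>
    restores it.\<close>
  define w where "w S i = (\<Prod>p\<in>S. real p * of_bool (i mod p = c p) + - 1)" for S and i :: nat
  define s :: "nat set \<Rightarrow> nat set \<Rightarrow> real" where "s S T = (- 1) ^ card (S - T)" for S T
  define W where "W i = (\<Sum>S\<in>?A. (- 1) ^ card S * g S * w S i)" for i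
  have finA: "finite ?A" by (rule finite_sieve_support) fact
  have A: "S \<subseteq> P" "finite S" if "S \<in> ?A" for S
    using that finite_subset[OF _ assms(1)] by (auto simp: sieve_support_def)
  have p2: "real p \<ge> 2" if "p \<in> P" for p
    using prime_ge_2_nat[OF assms(2)[OF that]] by simp
  have cmod: "c p = c p mod p" if "p \<in> P" for p
  proof -
    have "c p \<in> {..<p}" using assms(3) that unfolding residue_choices_def by (rule PiE_mem)
    then show ?thesis by simp
  qed
  have g0: "g S \<ge> 0" if "S \<subseteq> P" for S
    unfolding g_def using that p2 by (intro prod_nonneg) (fastforce simp: field_simps)
  have W_sifted: "W i = ?G" if "i \<in> sifted P M c" for i
  proof -
    have "w S i = (- 1) ^ card S" if "S \<in> ?A" for S
    proof -
      have "w S i = (\<Prod>p\<in>S. - 1)"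
        unfolding w_def using A(1)[OF that] \<open>i \<in> sifted P M c\<close>
        by (intro prod.cong refl) (auto simp: sifted_def)
      then show ?thesis by simp
    qed
    then show ?thesis unfolding W_def sieve_norm_def g_def
      by (intro sum.cong refl) (simp flip: power_mult_distrib)
  qed
  have w_expand: "w S i = (\<Sum>T\<in>Pow S. s S T * real (\<Prod>T) * e T i)" if "finite S" for S i
  proof -
    have "w S i = (\<Sum>T\<in>Pow S. (\<Prod>p\<in>T. real p * of_bool (i mod p = c p)) * (\<Prod>p\<in>S - T. - 1))"
      unfolding w_def by (rule prod_add) fact
    also have "\<dots> = (\<Sum>T\<in>Pow S. s S T * real (\<Prod>T) * e T i)"
    proof (intro sum.cong refl)
      fix T assume "T \<in> Pow S"
      then have "finite T" using \<open>finite S\<close> finite_subset by auto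
      then have "(\<Prod>p\<in>T. of_bool (i mod p = c p)) = e T i"
        unfolding e_def by (induction T rule: finite_induct) auto
      then show "(\<Prod>p\<in>T. real p * of_bool (i mod p = c p)) * (\<Prod>p\<in>S - T. - 1) =
          s S T * real (\<Prod>T) * e T i"
        by (simp add: prod.distrib s_def)
    qed
    finally show ?thesis .
  qed
  define rho where "rho T = (\<Sum>i<M. e T i) - M / real (\<Prod>T)" for T
  have rho: "\<bar>rho T\<bar> \<le> 1" if "T \<subseteq> P" for T
  proof -
    have "(\<Sum>i<M. e T i) = real (card {i. i < M \<and> (\<forall>p\<in>T. i mod p = c p)})"
      unfolding e_def by (simp add: of_bool_def sum.If_cases Int_def)
    also have "{i. i < M \<and> (\<forall>p\<in>T. i mod p = c p)} = {i. i < M \<and> (\<forall>p\<in>T. i mod p = c p mod p)}"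
      using cmod that by (intro Collect_cong conj_cong refl ball_cong) auto
    finally show ?thesis
      using card_simultaneous_residues[of T M c] finite_subset[OF that assms(1)] that assms(2)
      unfolding rho_def by auto
  qed
  define E where "E S = (\<Sum>T\<in>Pow S. real (\<Prod>T))" for S :: "nat set"
  have corr: "\<bar>(\<Sum>i<M. w S i * w S' i) - M * (if S = S' then \<Prod>p\<in>S. real p - 1 else 0)\<bar> \<le> E S * E S'"
    if "S \<subseteq> P" "S' \<subseteq> P" for S S'
  proof -
    have fin: "finite S" "finite S'" using that assms(1) finite_subset by auto
    let ?c = "\<lambda>T T'. s S T * s S' T' * (real (\<Prod>T) * real (\<Prod>T'))"
    have "(\<Sum>i<M. w S i * w S' i) = (\<Sum>i<M. \<Sum>T\<in>Pow S. \<Sum>T'\<in>Pow S'. ?c T T' * (e T i * e T' i))"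
      unfolding w_expand[OF fin(1)] w_expand[OF fin(2)] sum_product
      by (intro sum.cong refl) (simp only: mult_ac)
    also have "\<dots> = (\<Sum>T\<in>Pow S. \<Sum>i<M. \<Sum>T'\<in>Pow S'. ?c T T' * (e T i * e T' i))"
      by (rule sum.swap)
    also have "\<dots> = (\<Sum>T\<in>Pow S. \<Sum>T'\<in>Pow S'. \<Sum>i<M. ?c T T' * (e T i * e T' i))"
      by (intro sum.cong refl sum.swap)
    \<comment> \<open>The main part \<open>M / \<Prod>(T \<union> T')\<close> of the count combines
      with \<open>\<Prod>T * \<Prod>T'\<close> to \<open>M * \<Prod>(T \<inter> T')\<close>, the
      shape to which orthogonality applies; \<open>rho\<close> is the rounding error, at most 1 in
      absolute value.\<close>
    also have "\<dots> = (\<Sum>T\<in>Pow S. \<Sum>T'\<in>Pow S'. M * (s S T * s S' T' * real (\<Prod>(T \<inter> T'))) + ?c T T' * rho (T \<union> T'))"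
    proof (intro sum.cong refl)
      fix T T' assume T: "T \<in> Pow S" "T' \<in> Pow S'"
      have finT: "finite T" "finite T'" using T fin finite_subset by auto
      have "(\<Sum>i<M. ?c T T' * (e T i * e T' i)) = ?c T T' * (\<Sum>i<M. e (T \<union> T') i)"
        unfolding sum_distrib_left e_def by (intro sum.cong refl) auto
      also have "(\<Sum>i<M. e (T \<union> T') i) = M / real (\<Prod>(T \<union> T')) + rho (T \<union> T')"
        by (simp add: rho_def)
      also have "?c T T' * (M / real (\<Prod>(T \<union> T')) + rho (T \<union> T')) =
          M * (s S T * s S' T' * (real (\<Prod>T) * real (\<Prod>T') / real (\<Prod>(T \<union> T')))) + ?c T T' * rho (T \<union> T')"
        by (simp add: distrib_left)
      also have "real (\<Prod>T) * real (\<Prod>T') / real (\<Prod>(T \<union> T')) = real (\<Prod>(T \<inter> T'))"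
      proof -
        have "\<Prod>(T \<union> T') > 0"
        proof (rule prod_pos)
          fix p assume "p \<in> T \<union> T'"
          then have "p \<in> P" using T that by auto
          then show "p > 0" using p2[of p] by simp
        qed
        moreover have "real (\<Prod>T) * real (\<Prod>T') = real (\<Prod>(T \<union> T')) * real (\<Prod>(T \<inter> T'))"
          using prod.union_inter[OF finT, of "\<lambda>p. p"] by (simp only: of_nat_mult [symmetric])
        ultimately show ?thesis by (simp del: of_nat_prod)
      qed
      finally show "(\<Sum>i<M. ?c T T' * (e T i * e T' i)) =
          M * (s S T * s S' T' * real (\<Prod>(T \<inter> T'))) + ?c T T' * rho (T \<union> T')" .
    qed
    also have "\<dots> = M * (\<Sum>T\<in>Pow S. \<Sum>T'\<in>Pow S'. s S T * s S' T' * real (\<Prod>(T \<inter> T'))) +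
        (\<Sum>T\<in>Pow S. \<Sum>T'\<in>Pow S'. ?c T T' * rho (T \<union> T'))"
      unfolding sum_distrib_left by (simp only: sum.distrib)
    also have "(\<Sum>T\<in>Pow S. \<Sum>T'\<in>Pow S'. s S T * s S' T' * real (\<Prod>(T \<inter> T'))) =
        (if S = S' then \<Prod>p\<in>S. real p - 1 else 0)"
      unfolding s_def by (rule sum_alternating_prod_Int) fact+
    finally have eq: "(\<Sum>i<M. w S i * w S' i) = M * (if S = S' then \<Prod>p\<in>S. real p - 1 else 0) +
        (\<Sum>T\<in>Pow S. \<Sum>T'\<in>Pow S'. ?c T T' * rho (T \<union> T'))" .
    have "\<bar>\<Sum>T\<in>Pow S. \<Sum>T'\<in>Pow S'. ?c T T' * rho (T \<union> T')\<bar> \<le>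
        (\<Sum>T\<in>Pow S. \<Sum>T'\<in>Pow S'. real (\<Prod>T) * real (\<Prod>T'))"
    proof (intro order_trans[OF sum_abs] sum_mono)
      fix T T' assume T: "T \<in> Pow S" "T' \<in> Pow S'"
      have "\<bar>rho (T \<union> T')\<bar> \<le> 1" using T that by (intro rho) auto
      then have "real (\<Prod>T) * real (\<Prod>T') * \<bar>rho (T \<union> T')\<bar> \<le> real (\<Prod>T) * real (\<Prod>T')"
        by (intro mult_left_le) (simp_all del: of_nat_prod)
      then show "\<bar>?c T T' * rho (T \<union> T')\<bar> \<le> real (\<Prod>T) * real (\<Prod>T')"
        by (simp add: abs_mult s_def power_abs del: of_nat_prod)
    qed
    also have "\<dots> = E S * E S'" unfolding E_def sum_product ..
    finally show ?thesis unfolding eq by (simp only: add_diff_cancel_left')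
  qed
  define B where "B = (\<Sum>S\<in>?A. g S * E S)"
  have "(\<Sum>i<M. W i ^ 2) = (\<Sum>i<M. \<Sum>S\<in>?A. \<Sum>S'\<in>?A. ((- 1) ^ card S * (- 1) ^ card S' * (g S * g S')) * (w S i * w S' i))"
    unfolding W_def power2_eq_square sum_product by (intro sum.cong refl) (simp only: mult_ac)
  also have "\<dots> = (\<Sum>S\<in>?A. \<Sum>i<M. \<Sum>S'\<in>?A. ((- 1) ^ card S * (- 1) ^ card S' * (g S * g S')) * (w S i * w S' i))"
    by (rule sum.swap)
  also have "\<dots> = (\<Sum>S\<in>?A. \<Sum>S'\<in>?A. \<Sum>i<M. ((- 1) ^ card S * (- 1) ^ card S' * (g S * g S')) * (w S i * w S' i))"
    by (intro sum.cong refl sum.swap)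
  \<comment> \<open>On the diagonal \<open>g S ^ 2 * (\<Prod>p\<in>S. p - 1) = g S\<close>, so these
    terms add up to \<open>M * ?G\<close>. Off the diagonal only rounding errors survive, and they
    factor into \<open>B * B\<close>.\<close>
  also have "\<dots> \<le> (\<Sum>S\<in>?A. \<Sum>S'\<in>?A. (if S = S' then M * g S else 0) + (g S * E S) * (g S' * E S'))"
  proof (intro sum_mono)
    fix S S' assume S: "S \<in> ?A" "S' \<in> ?A"
    let ?s = "(- 1) ^ card S * (- 1) ^ card S' :: real" and ?d = "if S = S' then \<Prod>p\<in>S. real p - 1 else 0 :: real"
    define y where "y = (\<Sum>i<M. w S i * w S' i)"
    have y: "\<bar>y - M * ?d\<bar> \<le> E S * E S'"
      using corr[OF A(1)[OF S(1)] A(1)[OF S(2)]] unfolding y_def .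
    have "?s * y \<le> M * (?s * ?d) + E S * E S'"
    proof -
      have "?s * (y - M * ?d) \<le> \<bar>?s * (y - M * ?d)\<bar>" by simp
      also have "\<dots> = \<bar>y - M * ?d\<bar>" by (simp only: abs_mult power_abs abs_neg_one power_one mult_1_left)
      finally have "?s * (y - M * ?d) \<le> E S * E S'" using y by (rule order_trans)
      moreover have "?s * (y - M * ?d) = ?s * y - M * (?s * ?d)"
        unfolding right_diff_distrib by (simp only: mult_ac)
      ultimately show ?thesis by linarith
    qed
    then have "g S * g S' * (?s * y) \<le> g S * g S' * (M * (?s * ?d) + E S * E S')"
      by (intro mult_left_mono mult_nonneg_nonneg g0 A S)
    also have "g S * g S' * (M * (?s * ?d) + E S * E S') = (if S = S' then M * g S else 0) + (g S * E S) * (g S' * E S')"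
    proof (cases "S = S'")
      case True
      have "g S * (\<Prod>p\<in>S. real p - 1) = 1"
        unfolding g_def prod.distrib [symmetric]
      proof (intro prod.neutral ballI)
        fix p assume "p \<in> S"
        then have "real p \<ge> 2" using A(1)[OF S(1)] p2 by auto
        then show "1 / (real p - 1) * (real p - 1) = 1" by simp
      qed
      moreover have "?s = 1" using True by (simp flip: power_mult_distrib)
      ultimately show ?thesis using True by (simp add: algebra_simps)
    qed (simp add: algebra_simps)
    finally show "(\<Sum>i<M. ((- 1) ^ card S * (- 1) ^ card S' * (g S * g S')) * (w S i * w S' i)) \<le>
        (if S = S' then M * g S else 0) + (g S * E S) * (g S' * E S')"
      unfolding y_def sum_distrib_left [symmetric] by (simp only: mult_ac)
  qed
  also have "\<dots> = (\<Sum>S\<in>?A. \<Sum>S'\<in>?A. if S = S' then M * g S else 0) + B * B"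
    unfolding B_def sum_product by (simp only: sum.distrib)
  also have "(\<Sum>S\<in>?A. \<Sum>S'\<in>?A. if S = S' then M * g S else 0) = (\<Sum>S\<in>?A. M * g S)"
    using finA by (intro sum.cong refl) (simp add: sum.delta')
  also have "\<dots> = M * ?G" unfolding sieve_norm_def g_def by (simp only: sum_distrib_left)
  finally have W2: "(\<Sum>i<M. W i ^ 2) \<le> M * ?G + B * B" .
  \<comment> \<open>Only the sifted \<open>i\<close> are kept, by positivity of the square; there
    \<open>W\<close> is constant. Once \<open>B * B \<le> M * ?G\<close> is known, a factor
    \<open>?G\<close> can be cancelled.\<close>
  have "card (sifted P M c) * ?G ^ 2 = (\<Sum>i\<in>sifted P M c. W i ^ 2)"
    using W_sifted by simp
  also have "\<dots> \<le> (\<Sum>i<M. W i ^ 2)"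
    using sifted_subset by (intro sum_mono2) auto
  finally have main: "card (sifted P M c) * ?G ^ 2 \<le> M * ?G + B * B" using W2 by simp
  have G1: "?G \<ge> 1"
  proof -
    have "{} \<in> ?A" using assms(5) by (simp add: sieve_support_def)
    then have "g {} \<le> (\<Sum>S\<in>?A. g S)"
      using finA A g0 by (intro member_le_sum) auto
    then show ?thesis by (simp add: sieve_norm_def g_def)
  qed
  have B0: "B \<ge> 0" unfolding B_def E_def
    using g0 A by (intro sum_nonneg mult_nonneg_nonneg) (auto intro: prod_nonneg)
  \<comment> \<open>Here \<open>E S\<close> is the product of the \<open>p + 1\<close>, and
    \<open>(p + 1) / (p - 1) \<le> p ^ 2\<close>, so each of the at most \<open>R\<close> terms of
    \<open>B\<close> is at most \<open>R ^ 2\<close>. Thus \<open>B * B \<le> R ^ 6\<close>, which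
    explains the hypothesis \<open>R ^ 6 \<le> M\<close>.\<close>
  have "B \<le> (\<Sum>S\<in>?A. real R ^ 2)"
    unfolding B_def
  proof (rule sum_mono)
    fix S assume S: "S \<in> ?A"
    have "E S = (\<Prod>p\<in>S. real p + 1)"
      unfolding E_def using prod_add[OF A(2)[OF S], of real "\<lambda>_. 1"] by simp
    then have "g S * E S = (\<Prod>p\<in>S. 1 / (real p - 1) * (real p + 1))"
      unfolding g_def by (simp only: prod.distrib)
    also have "\<dots> \<le> (\<Prod>p\<in>S. real p ^ 2)"
    proof (rule prod_mono, intro conjI)
      fix p assume "p \<in> S"
      then have p: "real p \<ge> 2" using A(1)[OF S] p2 by auto
      then show "0 \<le> 1 / (real p - 1) * (real p + 1)" by simp
      have "1 / (real p - 1) * (real p + 1) \<le> 1 * (real p + 1)"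
        using p by (intro mult_right_mono) auto
      also have "real p + 1 \<le> real p * 2" using p by simp
      also have "\<dots> \<le> real p * real p" using p by (intro mult_left_mono) auto
      finally show "1 / (real p - 1) * (real p + 1) \<le> real p ^ 2" by (simp add: power2_eq_square)
    qed
    also have "\<dots> = real (\<Prod>S) ^ 2" by (simp add: prod_power_distrib)
    also have "\<dots> \<le> real R ^ 2"
      using S by (intro power_mono) (simp_all add: sieve_support_def del: of_nat_prod)
    finally show "g S * E S \<le> real R ^ 2" .
  qed
  also have "\<dots> = real (card ?A) * real R ^ 2" by simp
  also have "\<dots> \<le> real R * real R ^ 2"
    using card_sieve_support_le[OF assms(1,2), of R] by (intro mult_right_mono) auto
  finally have "B * B \<le> (real R * real R ^ 2) * (real R * real R ^ 2)"
    using B0 by (intro mult_mono) auto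
  also have "\<dots> = real (R ^ 6)" by (simp add: power2_eq_square eval_nat_numeral)
  also have "\<dots> \<le> real M" using assms(4) by (simp only: of_nat_le_iff)
  also have "\<dots> \<le> M * ?G" using mult_left_mono[OF G1, of "real M"] by simp
  finally have "card (sifted P M c) * ?G ^ 2 \<le> 2 * M * ?G" using main by simp
  then have "(card (sifted P M c) * ?G) * ?G \<le> (2 * M) * ?G"
    by (simp add: power2_eq_square mult_ac)
  then show ?thesis by (rule mult_right_le_imp_le) (use G1 in linarith)
qed

lemma prod_prime_factors_squarefree:
  fixes n :: nat
  assumes "squarefree n"
  shows "\<Prod>(prime_factors n) = n"
proof -
  have "n \<noteq> 0" using assms by (metis not_squarefree_0)
  have "multiplicity p n = 1" if "p \<in> prime_factors n" for p
    using assms that \<open>n \<noteq> 0\<close> squarefree_factorial_semiring''[of n]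
    by (auto simp: prime_factors_multiplicity le_Suc_eq)
  then have "\<Prod>(prime_factors n) = (\<Prod>p\<in>prime_factors n. p ^ multiplicity p n)"
    by (intro prod.cong refl) simp
  also have "\<dots> = n" using \<open>n \<noteq> 0\<close> by (simp add: prod_prime_factors)
  finally show ?thesis .
qed

text \<open>Each \<open>n \<le> R\<close> is a square times a squarefree number; the squarefree part is a product of distinct
  primes, which splits over \<open>P\<close> and \<open>Q\<close>.\<close>

lemma ln_le_sieve_norm:
  assumes "finite P" "finite Q" "\<And>p. p \<in> P \<union> Q \<Longrightarrow> prime p"
    and "\<And>p. prime p \<Longrightarrow> p \<le> R \<Longrightarrow> p \<in> P \<union> Q" and "P \<inter> Q = {}" and "R \<ge> 1"
  shows "ln (real R) \<le> 2 * sieve_norm P R * (\<Prod>p\<in>Q. 1 / (1 - 1 / real p))"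
proof -
  define B where "B = {S. S \<subseteq> P \<union> Q \<and> \<Prod>S \<le> R}"
  have p2: "real p \<ge> 2" if "p \<in> P \<union> Q" for p
    using prime_ge_2_nat[OF assms(3)[OF that]] by simp
  have finB: "finite B"
    unfolding B_def by (rule finite_subset[of _ "Pow (P \<union> Q)"]) (use assms in auto)
  define f :: "nat \<Rightarrow> nat set \<times> nat" where "f n = (prime_factors (squarefree_part n), square_part n)" for n
  have fB: "f n \<in> B \<times> {1..R} \<and> 1 / real n = (\<Prod>p\<in>fst (f n). 1 / real p) * (1 / real (snd (f n)) ^ 2)"
    if n: "n \<in> {1..R}" for n
  proof -
    define s where "s = squarefree_part n"
    define t where "t = square_part n"
    have dec: "n = s * t ^ 2" unfolding s_def t_def by (rule squarefree_decompose)
    have n0: "n > 0" "n \<le> R" using n by auto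
    have pos: "s > 0" "t > 0" using dec n0(1) by (auto intro: gr0I)
    have prd: "\<Prod>(prime_factors s) = s" unfolding s_def by (rule prod_prime_factors_squarefree) simp
    have "s dvd n" "t dvd n" unfolding dec by simp_all
    then have le: "s \<le> R" "t \<le> R" using n0 by (auto dest!: dvd_imp_le)
    have "p \<in> P \<union> Q" if p: "p \<in> prime_factors s" for p
    proof -
      have "p dvd s" "prime p" using p by auto
      then have "p \<le> R" using dvd_imp_le[of p s] pos(1) le(1) by linarith
      then show ?thesis using assms(4) \<open>prime p\<close> by simp
    qed
    then have B: "prime_factors s \<in> B" using prd le by (simp add: B_def subset_iff)
    have "1 / real n = 1 / real s * (1 / real t ^ 2)"
      unfolding dec by simp
    moreover have "1 / real s = (\<Prod>p\<in>prime_factors s. 1 / real p)"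
      by (subst prd [symmetric]) (simp add: prod_dividef)
    ultimately show ?thesis using pos le B unfolding f_def s_def[symmetric] t_def[symmetric] by simp
  qed
  have inj: "inj_on f {1..R}"
  proof (rule inj_onI)
    fix m n assume "f m = f n"
    then have eq: "prime_factors (squarefree_part m) = prime_factors (squarefree_part n)"
      "square_part m = square_part n" unfolding f_def by blast+
    have "squarefree_part m = \<Prod>(prime_factors (squarefree_part m))"
      by (rule prod_prime_factors_squarefree [symmetric]) (rule squarefree_squarefree_part)
    also have "\<dots> = squarefree_part n"
      unfolding eq(1) by (rule prod_prime_factors_squarefree) (rule squarefree_squarefree_part)
    finally have "squarefree_part m * square_part m ^ 2 = squarefree_part n * square_part n ^ 2"
      by (simp only: eq(2))
    then show "m = n" by (simp only: squarefree_decompose [symmetric])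
  qed
  have "ln (real R) \<le> ln (real R + 1)" using assms(6) by simp
  also have "\<dots> \<le> harm R" by (rule ln_le_harm)
  also have "\<dots> = (\<Sum>n\<in>{1..R}. 1 / real n)" by (simp add: harm_def inverse_eq_divide)
  also have "\<dots> = (\<Sum>n\<in>{1..R}. case f n of (S, t) \<Rightarrow> (\<Prod>p\<in>S. 1 / real p) * (1 / real t ^ 2))"
    using fB by (intro sum.cong refl) (auto simp: case_prod_beta)
  also have "\<dots> = (\<Sum>x\<in>f ` {1..R}. case x of (S, t) \<Rightarrow> (\<Prod>p\<in>S. 1 / real p) * (1 / real t ^ 2))"
    using inj by (simp add: sum.reindex)
  also have "\<dots> \<le> (\<Sum>x\<in>B \<times> {1..R}. case x of (S, t) \<Rightarrow> (\<Prod>p\<in>S. 1 / real p) * (1 / real t ^ 2))"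
  proof (rule sum_mono2)
    show "f ` {1..R} \<subseteq> B \<times> {1..R}" using fB by blast
    show "0 \<le> (case x of (S, t) \<Rightarrow> (\<Prod>p\<in>S. 1 / real p) * (1 / real t ^ 2))" for x
      by (cases x) (auto intro!: divide_nonneg_nonneg prod_nonneg)
  qed (use finB in simp)
  also have "\<dots> = (\<Sum>S\<in>B. \<Prod>p\<in>S. 1 / real p) * (\<Sum>t\<in>{1..R}. 1 / real t ^ 2)"
    by (simp add: sum_product sum.cartesian_product case_prod_unfold)
  also have "\<dots> \<le> (\<Sum>S\<in>B. \<Prod>p\<in>S. 1 / real p) * 2"
  proof (rule mult_left_mono)
    have "(\<Sum>t\<in>{1..R}. 1 / real t ^ 2) = 1 + (\<Sum>t\<in>{2..R}. 1 / real t ^ 2)"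
      using assms(6) by (simp add: sum.atLeast_Suc_atMost numeral_2_eq_2)
    moreover have "(\<Sum>t\<in>{2..R}. 1 / real t ^ 2) \<le> 1 / (real 2 - 1)"
      by (rule sum_inverse_squares_le) auto
    ultimately show "(\<Sum>t\<in>{1..R}. 1 / real t ^ 2) \<le> 2" by simp
  qed (intro sum_nonneg prod_nonneg, auto)
  \<comment> \<open>Of the condition \<open>\<Prod>S \<le> R\<close> only its consequence for
    \<open>S \<inter> P\<close> is kept. The part in \<open>Q\<close> becomes free, and its sum is
    bounded by the full Euler product over \<open>Q\<close>.\<close>
  also have "(\<Sum>S\<in>B. \<Prod>p\<in>S. 1 / real p) \<le>
      (\<Sum>x\<in>sieve_support P R \<times> Pow Q. case x of (S, T) \<Rightarrow> (\<Prod>p\<in>S. 1 / real p) * (\<Prod>p\<in>T. 1 / real p))"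
  proof -
    define h where "h S = (S \<inter> P, S \<inter> Q)" for S
    have "h S \<in> sieve_support P R \<times> Pow Q \<and>
        (\<Prod>p\<in>S. 1 / real p) = (\<Prod>p\<in>fst (h S). 1 / real p) * (\<Prod>p\<in>snd (h S). 1 / real p)" if "S \<in> B" for S
    proof
      have S: "S \<subseteq> P \<union> Q" "\<Prod>S \<le> R" using that by (auto simp: B_def)
      have fin: "finite S" by (rule finite_subset[OF S(1)]) (use assms in simp)
      have "\<Prod>S > 0"
      proof (rule prod_pos)
        fix p assume "p \<in> S" then show "p > 0" using p2[of p] S by auto
      qed
      moreover have "\<Prod>(S \<inter> P) dvd \<Prod>S" using fin by (intro prod_dvd_prod_subset) auto
      ultimately have "\<Prod>(S \<inter> P) \<le> R" using S by (meson dvd_imp_le order_trans)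
      then show "h S \<in> sieve_support P R \<times> Pow Q" by (simp add: h_def sieve_support_def)
      have "S = (S \<inter> P) \<union> (S \<inter> Q)" using S by auto
      then have "(\<Prod>p\<in>S. 1 / real p) = (\<Prod>p\<in>(S \<inter> P) \<union> (S \<inter> Q). 1 / real p)" by simp
      also have "\<dots> = (\<Prod>p\<in>S \<inter> P. 1 / real p) * (\<Prod>p\<in>S \<inter> Q. 1 / real p)"
        using fin assms(5) by (intro prod.union_disjoint) auto
      finally show "(\<Prod>p\<in>S. 1 / real p) = (\<Prod>p\<in>fst (h S). 1 / real p) * (\<Prod>p\<in>snd (h S). 1 / real p)"
        by (simp add: h_def)
    qed
    note hB = this
    have injh: "inj_on h B"
      by (rule inj_onI) (auto simp: h_def B_def)
    have "(\<Sum>S\<in>B. \<Prod>p\<in>S. 1 / real p) =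
        (\<Sum>S\<in>B. case h S of (S, T) \<Rightarrow> (\<Prod>p\<in>S. 1 / real p) * (\<Prod>p\<in>T. 1 / real p))"
      using hB by (intro sum.cong refl) (simp add: case_prod_beta)
    also have "\<dots> = (\<Sum>x\<in>h ` B. case x of (S, T) \<Rightarrow> (\<Prod>p\<in>S. 1 / real p) * (\<Prod>p\<in>T. 1 / real p))"
      using injh by (simp add: sum.reindex)
    also have "\<dots> \<le> (\<Sum>x\<in>sieve_support P R \<times> Pow Q. case x of (S, T) \<Rightarrow> (\<Prod>p\<in>S. 1 / real p) * (\<Prod>p\<in>T. 1 / real p))"
    proof (rule sum_mono2)
      show "h ` B \<subseteq> sieve_support P R \<times> Pow Q" using hB by blast
      show "0 \<le> (case x of (S, T) \<Rightarrow> (\<Prod>p\<in>S. 1 / real p) * (\<Prod>p\<in>T. 1 / real p))" for x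
        by (cases x) (auto intro!: mult_nonneg_nonneg prod_nonneg)
      show "finite (sieve_support P R \<times> Pow Q)"
        using finite_sieve_support[OF assms(1)] assms(2) by simp
    qed
    finally show ?thesis .
  qed
  also have "\<dots> = (\<Sum>S\<in>sieve_support P R. \<Prod>p\<in>S. 1 / real p) * (\<Sum>T\<in>Pow Q. \<Prod>p\<in>T. 1 / real p)"
    by (simp add: sum_product sum.cartesian_product case_prod_unfold)
  also have "\<dots> \<le> sieve_norm P R * (\<Prod>p\<in>Q. 1 / (1 - 1 / real p))"
  proof (rule mult_mono)
    show "(\<Sum>S\<in>sieve_support P R. \<Prod>p\<in>S. 1 / real p) \<le> sieve_norm P R"
      unfolding sieve_norm_def
    proof (intro sum_mono prod_mono conjI)
      fix S p assume "S \<in> sieve_support P R" "p \<in> S"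
      then have "real p \<ge> 2" using p2 by (auto simp: sieve_support_def)
      then show "0 \<le> 1 / real p" "1 / real p \<le> 1 / (real p - 1)" by (auto simp: frac_le)
    qed
    have "(\<Sum>T\<in>Pow Q. \<Prod>p\<in>T. 1 / real p) = (\<Prod>p\<in>Q. 1 / real p + 1)"
      using prod_add[OF assms(2), of "\<lambda>p. 1 / real p" "\<lambda>_. 1"] by simp
    also have "\<dots> \<le> (\<Prod>p\<in>Q. 1 / (1 - 1 / real p))"
    proof (intro prod_mono conjI)
      fix p assume "p \<in> Q"
      then have "real p \<ge> 2" using p2 by auto
      then show "0 \<le> 1 / real p + 1" "1 / real p + 1 \<le> 1 / (1 - 1 / real p)"
        by (auto simp: field_simps)
    qed
    finally show "(\<Sum>T\<in>Pow Q. \<Prod>p\<in>T. 1 / real p) \<le> (\<Prod>p\<in>Q. 1 / (1 - 1 / real p))" .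
    show "0 \<le> sieve_norm P R"
      unfolding sieve_norm_def
    proof (intro sum_nonneg prod_nonneg)
      fix S p assume "S \<in> sieve_support P R" "p \<in> S"
      then have "real p \<ge> 2" using p2 by (auto simp: sieve_support_def)
      then show "0 \<le> 1 / (real p - 1)" by simp
    qed
    show "0 \<le> (\<Sum>T\<in>Pow Q. \<Prod>p\<in>T. 1 / real p)" by (intro sum_nonneg prod_nonneg) auto
  qed
  finally show ?thesis by (simp add: mult_ac)
qed

section \<open>Prime factors of the modulus against sieving primes\<close>

text \<open>Mertens' bound for the primes below \<open>z\<close>, with the primes not dividing
  \<open>q\<close> moved to the other side. The more small primes divide \<open>q\<close>, the
  larger is the product over the remaining ones: this compensation makes all later estimates uniform
  in the smoothness of \<open>q\<close>.\<close>

lemma inverse_prod_dividing_le: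
  fixes z q :: nat
  assumes "z \<ge> 3"
  shows "(\<Prod>p | prime p \<and> p < z \<and> p dvd q. 1 / (1 - 1 / real p)) \<le>
    exp 7 * ln z * (\<Prod>p | prime p \<and> p < z \<and> \<not> p dvd q. 1 - 1 / real p)"
proof -
  define th where "th A = (\<Prod>p\<in>A. 1 - 1 / real p)" for A :: "nat set"
  let ?PQ = "{p. prime p \<and> p < z}"
  let ?P = "{p. prime p \<and> p < z \<and> \<not> p dvd q}" and ?Q = "{p. prime p \<and> p < z \<and> p dvd q}"
  have thpos: "th A > 0" if "A \<subseteq> ?PQ" for A
    unfolding th_def
  proof (rule prod_pos)
    fix p assume "p \<in> A"
    then have "real p \<ge> 2" using that prime_ge_2_nat[of p] by auto
    then show "0 < 1 - 1 / real p" by simp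
  qed
  have inv: "(\<Prod>p\<in>A. 1 / (1 - 1 / real p)) = 1 / th A" for A :: "nat set"
    unfolding th_def by (simp add: prod_dividef)
  have "1 / th ?PQ \<le> (\<Prod>p | prime p \<and> p \<le> z. 1 / (1 - 1 / real p))"
    unfolding inv [symmetric]
  proof (rule prod_mono2)
    fix p assume "p \<in> {p. prime p \<and> p \<le> z} - ?PQ"
    then have "real p \<ge> 2" using prime_ge_2_nat[of p] by auto
    then show "1 \<le> 1 / (1 - 1 / real p)" by simp
  next
    fix p assume "p \<in> ?PQ"
    then have "real p \<ge> 2" using prime_ge_2_nat[of p] by auto
    then show "0 \<le> 1 / (1 - 1 / real p)" by simp
  qed auto
  also have "\<dots> \<le> exp 7 * ln z" using assms by (rule mertens_prod_le)
  finally have "1 \<le> exp 7 * ln z * th ?PQ"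
    using thpos[of ?PQ] by (simp add: divide_le_eq)
  also have "?PQ = ?P \<union> ?Q" by auto
  also have "th (?P \<union> ?Q) = th ?P * th ?Q"
    unfolding th_def by (rule prod.union_disjoint) auto
  finally have le: "1 \<le> exp 7 * ln z * (th ?P * th ?Q)" .
  have "th ?Q > 0" by (rule thpos) auto
  then have "1 / th ?Q \<le> exp 7 * ln z * th ?P"
    using le by (simp add: divide_le_eq mult_ac)
  then show ?thesis unfolding inv unfolding th_def .
qed

text \<open>The sieve works at level \<open>R\<close>, whereas \<open>P\<close> extends to
  \<open>z\<close>; the price is the factor \<open>ln z / ln R\<close>. In the application
  \<open>R\<close> is about a fixed power of \<open>ln N\<close> and \<open>z\<close> a multiple of
  \<open>ln N\<close>, so this ratio stays bounded. The primes missing from \<open>P\<close> enter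
  through the product over \<open>Q\<close>, which is traded for the product over
  \<open>P\<close>.\<close>

lemma card_sifted_le:
  fixes z R M q :: nat
  assumes "R ^ 6 \<le> M" "R \<ge> 2" "R < z" "z \<ge> 3"
  defines "P \<equiv> {p. prime p \<and> p < z \<and> \<not> p dvd q}"
  assumes "c \<in> residue_choices P"
  shows "real (card (sifted P M c)) \<le> 4 * exp 7 * (ln z / ln R) * (M * (\<Prod>p\<in>P. 1 - 1 / real p))"
proof -
  define Q where "Q = {p. prime p \<and> p < z \<and> p dvd q}"
  define iQ where "iQ = (\<Prod>p\<in>Q. 1 / (1 - 1 / real p))"
  let ?th = "\<Prod>p\<in>P. 1 - 1 / real p"
  have fin: "finite P" "finite Q" by (auto simp: P_def Q_def)
  have disj: "P \<inter> Q = {}" and un: "P \<union> Q = {p. prime p \<and> p < z}" by (auto simp: P_def Q_def)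
  have pP: "prime p" if "p \<in> P" for p using that by (simp add: P_def)
  have lnR: "ln (real R) > 0" using assms by simp
  let ?X = "real (card (sifted P M c))"
  have iQ0: "0 \<le> iQ"
    unfolding iQ_def
  proof (rule prod_nonneg)
    fix p assume "p \<in> Q"
    then have "real p \<ge> 2" using prime_ge_2_nat[of p] by (simp add: Q_def)
    then show "0 \<le> 1 / (1 - 1 / real p)" by simp
  qed
  have mert: "iQ \<le> exp 7 * ln z * ?th"
    unfolding iQ_def P_def Q_def by (rule inverse_prod_dividing_le) fact
  have "ln (real R) \<le> 2 * sieve_norm P R * iQ"
    unfolding iQ_def
  proof (rule ln_le_sieve_norm)
    show "prime p" if "p \<in> P \<union> Q" for p using that unfolding un by simp
    show "p \<in> P \<union> Q" if "prime p" "p \<le> R" for p using that assms(3) unfolding un by simp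
    show "R \<ge> 1" using assms(2) by simp
  qed fact+
  then have "?X * ln R \<le> ?X * (2 * sieve_norm P R * iQ)"
    by (intro mult_left_mono) auto
  also have "\<dots> = (?X * sieve_norm P R) * (2 * iQ)" by simp
  also have "\<dots> \<le> (2 * M) * (2 * iQ)"
  proof (rule mult_right_mono)
    show "?X * sieve_norm P R \<le> 2 * M"
      by (rule card_sifted_mult_norm_le) (use assms(1,2,6) fin pP in simp_all)
  qed (use iQ0 in simp)
  also have "\<dots> \<le> (2 * M) * (2 * (exp 7 * ln z * ?th))"
    using mert by (intro mult_left_mono) auto
  finally have "?X \<le> (2 * M) * (2 * (exp 7 * ln z * ?th)) / ln R"
    using lnR by (simp add: le_divide_eq)
  also have "\<dots> = 4 * exp 7 * (ln z / ln R) * (M * ?th)" by simp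
  finally show ?thesis .
qed

text \<open>The source of the lower bound for the mean number of survivors: as \<open>M * q\<close>
  is about \<open>N\<close>, an upper bound for \<open>q\<close> that contains the product over
  \<open>P\<close> is a lower bound for \<open>M\<close> times this product. The exponent is
  \<open>11 = 4 + 7\<close>.\<close>

lemma modulus_le_sieve_product:
  fixes z q :: nat
  assumes "z \<ge> 3" "q \<ge> 1" "ln q \<le> z"
  shows "real q \<le> exp 11 * ln z * (\<Prod>p | prime p \<and> p < z \<and> \<not> p dvd q. 1 - 1 / real p) * real (totient q)"
proof -
  have "{p \<in> prime_factors q. real p < real z} = {p. prime p \<and> p < z \<and> p dvd q}"
    using assms(2) by (auto simp: in_prime_factors_iff)
  then have "real q / real (totient q) \<le> exp 4 * (\<Prod>p | prime p \<and> p < z \<and> p dvd q. 1 / (1 - 1 / real p))"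
    using totient_ratio_le[of q "real z"] assms by simp
  also have "\<dots> \<le> exp 4 * (exp 7 * ln z * (\<Prod>p | prime p \<and> p < z \<and> \<not> p dvd q. 1 - 1 / real p))"
    using inverse_prod_dividing_le[OF assms(1)] by (intro mult_left_mono) auto
  also have "\<dots> = exp 11 * ln z * (\<Prod>p | prime p \<and> p < z \<and> \<not> p dvd q. 1 - 1 / real p)"
    using exp_add[of 4 "7::real"] by simp
  finally show ?thesis using assms(2) by (simp add: divide_le_eq)
qed

text \<open>The previous bound for \<open>z\<close> just above \<open>ln q\<close>, with the product
  over the remaining primes estimated by 1.\<close>

lemma modulus_le_totient:
  fixes q :: nat
  assumes "q \<ge> 1"
  shows "real q \<le> exp 11 * ln (ln q + 5) * real (totient q)"
proof -
  define z where "z = nat \<lceil>ln q\<rceil> + 3"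
  have lnq: "ln (real q) \<ge> 0" using assms by simp
  have "real z = real_of_int \<lceil>ln (real q)\<rceil> + 3"
    using lnq by (simp add: z_def)
  then have z: "ln q \<le> z" "real z \<le> ln q + 5" "z \<ge> 3"
    using of_int_ceiling_le_add_one[of "ln (real q)"] le_of_int_ceiling[of "ln (real q)"]
    by (linarith, linarith, simp add: z_def)
  let ?th = "\<Prod>p | prime p \<and> p < z \<and> \<not> p dvd q. 1 - 1 / real p"
  have "?th \<le> 1"
  proof (rule prod_le_1)
    fix p assume "p \<in> {p. prime p \<and> p < z \<and> \<not> p dvd q}"
    then have "real p \<ge> 2" using prime_ge_2_nat[of p] by auto
    then show "0 \<le> 1 - 1 / real p \<and> 1 - 1 / real p \<le> 1" by simp
  qed
  moreover have "ln (real z) \<ge> 0" using z(3) by simp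
  ultimately have "exp 11 * ln z * ?th * real (totient q) \<le> exp 11 * ln z * 1 * real (totient q)"
    by (intro mult_right_mono mult_left_mono) auto
  also have "\<dots> \<le> exp 11 * ln (ln q + 5) * 1 * real (totient q)"
    using z by (intro mult_right_mono mult_left_mono) auto
  also have "\<dots> = exp 11 * ln (ln q + 5) * real (totient q)" by simp
  finally show ?thesis by (rule order_trans[OF modulus_le_sieve_product[OF z(3) assms z(1)]])
qed

section \<open>Factorial moments of the number of survivors\<close>

text \<open>The remainder \<open>r n\<close> of the tangent line of \<open>x ^ Suc n\<close> at
  \<open>l\<close> satisfies \<open>r (Suc n) = x * r n + Suc n * l ^ n * (x - l) ^ 2\<close>, from
  which both bounds follow by induction. The second is multiplied through by \<open>b\<close> to
  avoid the exponent \<open>n - 1\<close>.\<close>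

lemma power_taylor_bounds:
  fixes x l b :: real
  assumes "0 \<le> x" "x \<le> b" "0 \<le> l" "l \<le> b"
  shows "l ^ Suc n + Suc n * l ^ n * (x - l) \<le> x ^ Suc n"
    and "b * x ^ Suc n \<le> b * (l ^ Suc n + Suc n * l ^ n * (x - l)) + (Suc n) ^ 2 * b ^ n * (x - l) ^ 2"
proof -
  define r where "r n = x ^ Suc n - (l ^ Suc n + Suc n * l ^ n * (x - l))" for n
  have step: "r (Suc n) = x * r n + Suc n * l ^ n * (x - l) ^ 2" for n
    by (simp add: r_def algebra_simps power2_eq_square)
  have "0 \<le> r n \<and> b * r n \<le> (Suc n) ^ 2 * b ^ n * (x - l) ^ 2" for n
  proof (induction n)
    case 0 show ?case by (simp add: r_def)
  next
    case (Suc n)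
    have "0 \<le> r (Suc n)" unfolding step using Suc assms by (intro add_nonneg_nonneg mult_nonneg_nonneg) auto
    moreover have "b * r (Suc n) = x * (b * r n) + b * (Suc n * l ^ n * (x - l) ^ 2)"
      by (simp add: step algebra_simps)
    moreover have "x * (b * r n) \<le> b * ((Suc n) ^ 2 * b ^ n * (x - l) ^ 2)"
      by (rule mult_mono) (use Suc assms in auto)
    moreover have "b * (Suc n * l ^ n * (x - l) ^ 2) \<le> b * (Suc n * b ^ n * (x - l) ^ 2)"
      using assms by (intro mult_left_mono mult_right_mono power_mono) auto
    moreover have "b * ((Suc n) ^ 2 * b ^ n * (x - l) ^ 2) + b * (Suc n * b ^ n * (x - l) ^ 2) \<le>
        (Suc (Suc n)) ^ 2 * b ^ Suc n * (x - l) ^ 2"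
    proof -
      have "(real (Suc n) ^ 2 + real (Suc n)) * (b ^ Suc n * (x - l) ^ 2) \<le>
          real (Suc (Suc n)) ^ 2 * (b ^ Suc n * (x - l) ^ 2)"
      proof (rule mult_right_mono)
        show "real (Suc n) ^ 2 + real (Suc n) \<le> real (Suc (Suc n)) ^ 2"
          by (simp add: power2_eq_square algebra_simps)
        show "0 \<le> b ^ Suc n * (x - l) ^ 2"
          using assms by (intro mult_nonneg_nonneg zero_le_power zero_le_power2) simp
      qed
      then show ?thesis by (simp add: algebra_simps)
    qed
    ultimately show ?case by linarith
  qed
  from this[of n] show "l ^ Suc n + Suc n * l ^ n * (x - l) \<le> x ^ Suc n"
    "b * x ^ Suc n \<le> b * (l ^ Suc n + Suc n * l ^ n * (x - l)) + (Suc n) ^ 2 * b ^ n * (x - l) ^ 2"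
    by (auto simp: r_def right_diff_distrib)
qed

text \<open>\<open>fact j * (x choose j)\<close> is the falling factorial of length
  \<open>j\<close>. The real difference is harmless for \<open>j > x\<close>, where the binomial
  coefficients on both sides vanish.\<close>

lemma fact_mult_choose_Suc:
  "fact (Suc j) * real (x choose Suc j) = (real x - real j) * (fact j * real (x choose j))"
proof (cases "j \<le> x")
  case True
  have "Suc j * (x choose Suc j) = (x - j) * (x choose j)"
    by (metis binomial_absorb_comp binomial_absorption mult.commute)
  then have "real (Suc j) * real (x choose Suc j) = (real x - real j) * real (x choose j)"
    using True by (metis of_nat_diff of_nat_mult)
  then have "fact j * (real (Suc j) * real (x choose Suc j)) =
      fact j * ((real x - real j) * real (x choose j))" by (simp only:)
  then show ?thesis by (simp only: fact_Suc of_nat_mult mult_ac)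
qed (simp add: binomial_eq_0)

lemma fact_mult_choose_le: "fact j * real (x choose j) \<le> real x ^ j"
proof (induction j)
  case (Suc j)
  show ?case
  proof (cases "j \<le> x")
    case True
    then have "(real x - real j) * (fact j * real (x choose j)) \<le> real x * real x ^ j"
      using Suc by (intro mult_mono) auto
    then show ?thesis unfolding fact_mult_choose_Suc by simp
  qed (simp add: binomial_eq_0)
qed simp

lemma fact_mult_choose_ge:
  "fact (Suc j) * real (x choose Suc j) \<ge> real x ^ Suc j - (real (Suc j)) ^ 2 * real x ^ j"
proof (induction j)
  case (Suc j)
  define u where "u = real x ^ j"
  have u: "u \<ge> 0" by (simp add: u_def)
  show ?case
  proof (cases "Suc j \<le> x")
    case True
    have "(real x - real (Suc j)) * (real x * u - (real (Suc j)) ^ 2 * u) -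
      (real x * (real x * u) - (real (Suc (Suc j))) ^ 2 * (real x * u)) =
      real (Suc (Suc j)) * (real x * u) + real (Suc j) ^ 3 * u"
      by (simp add: algebra_simps power2_eq_square power3_eq_cube)
    moreover have "real (Suc (Suc j)) * (real x * u) + real (Suc j) ^ 3 * u \<ge> 0"
      using u by (intro add_nonneg_nonneg mult_nonneg_nonneg zero_le_power) auto
    ultimately have "real x ^ Suc (Suc j) - (real (Suc (Suc j))) ^ 2 * real x ^ Suc j \<le>
        (real x - real (Suc j)) * (real x ^ Suc j - (real (Suc j)) ^ 2 * real x ^ j)"
      unfolding power_Suc u_def[symmetric] by linarith
    also have "\<dots> \<le> (real x - real (Suc j)) * (fact (Suc j) * real (x choose Suc j))"
      using True by (intro mult_left_mono Suc) auto
    finally show ?thesis unfolding fact_mult_choose_Suc[of "Suc j"] .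
  next
    \<comment> \<open>For \<open>x \<le> j\<close> the falling factorial is 0 and the asserted lower
      bound is not positive.\<close>
    case False
    have "real x \<le> real (Suc (Suc j)) * 1" using False by simp
    also have "\<dots> \<le> real (Suc (Suc j)) * real (Suc (Suc j))"
      by (intro mult_left_mono) auto
    finally have "real x \<le> (real (Suc (Suc j))) ^ 2" unfolding power2_eq_square .
    then have "real x * real x ^ Suc j \<le> (real (Suc (Suc j))) ^ 2 * real x ^ Suc j"
      by (intro mult_right_mono) auto
    then show ?thesis using False by (simp add: binomial_eq_0)
  qed
qed simp

text \<open>Since \<open>X \<le> K * l\<close> pointwise, the second order Taylor remainder of \<open>X ^ j\<close> at the mean \<open>l\<close> is controlled by
  the variance alone; no higher central moment is needed.\<close>

lemma factorial_moment_sifted: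
  fixes P :: "nat set" and M :: nat and K :: real
  assumes "finite P" "\<And>p. p \<in> P \<Longrightarrow> prime p"
  defines "l \<equiv> M * (\<Prod>p\<in>P. 1 - 1 / real p)"
  assumes "l > 0" "K \<ge> 1" and X: "\<And>c. c \<in> residue_choices P \<Longrightarrow> real (card (sifted P M c)) \<le> K * l"
  shows "\<bar>fact (Suc j) * residue_mean P (\<lambda>c. real (card (sifted P M c) choose Suc j)) - l ^ Suc j\<bar>
    \<le> (Suc j) ^ 2 * K ^ j * l ^ j"
proof -
  let ?X = "\<lambda>c. real (card (sifted P M c))" and ?E = "residue_mean P"
  define b where "b = K * l"
  have b: "b > 0" "l \<le> b" unfolding b_def using assms(4,5) by auto
  have E1: "?E ?X = l" unfolding l_def by (rule residue_mean_card) (use assms in auto)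
  have const: "?E (\<lambda>c. a) = a" for a by (rule residue_mean_const) (use assms in auto)
  have var: "?E (\<lambda>c. (?X c - l) ^ 2) \<le> l"
  proof -
    have "?E (\<lambda>c. (?X c - l) ^ 2) = ?E (\<lambda>c. (?X c ^ 2 + (- 2 * l) * ?X c) + l ^ 2)"
      by (intro residue_mean_cong) (simp add: power2_eq_square algebra_simps)
    also have "\<dots> = ?E (\<lambda>c. ?X c ^ 2) + (- 2 * l) * l + l ^ 2"
      by (simp only: residue_mean_add residue_mean_cmult const E1)
    also have "\<dots> \<le> (l ^ 2 + l) + (- 2 * l) * l + l ^ 2"
      using residue_mean_card_square_le[OF assms(1,2), of M] unfolding l_def by (intro add_right_mono) auto
    finally show ?thesis by (simp add: power2_eq_square)
  qed
  have lin: "?E (\<lambda>c. l ^ Suc j + Suc j * l ^ j * (?X c - l)) = l ^ Suc j"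
    by (simp only: residue_mean_add residue_mean_diff residue_mean_cmult const E1) simp
  have lower: "l ^ Suc j \<le> ?E (\<lambda>c. ?X c ^ Suc j)"
    by (subst lin [symmetric], intro residue_mean_mono power_taylor_bounds(1)[of _ b])
       (use X b assms(4) in \<open>auto simp: b_def\<close>)
  have "b * ?E (\<lambda>c. ?X c ^ Suc j) = ?E (\<lambda>c. b * ?X c ^ Suc j)" by (simp only: residue_mean_cmult)
  also have "\<dots> \<le> ?E (\<lambda>c. b * (l ^ Suc j + Suc j * l ^ j * (?X c - l)) + (Suc j) ^ 2 * b ^ j * (?X c - l) ^ 2)"
    by (intro residue_mean_mono power_taylor_bounds(2)) (use X b assms(4) in \<open>auto simp: b_def\<close>)
  also have "\<dots> = b * l ^ Suc j + (Suc j) ^ 2 * b ^ j * ?E (\<lambda>c. (?X c - l) ^ 2)"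
    by (subst residue_mean_add) (simp only: residue_mean_cmult lin)
  also have "\<dots> \<le> b * l ^ Suc j + (Suc j) ^ 2 * b ^ j * l"
    using var b by (intro add_left_mono mult_left_mono) auto
  also have "(Suc j) ^ 2 * b ^ j * l \<le> (Suc j) ^ 2 * b ^ j * b"
    using b by (intro mult_left_mono) auto
  finally have "b * ?E (\<lambda>c. ?X c ^ Suc j) \<le> b * (l ^ Suc j + (Suc j) ^ 2 * b ^ j)"
    by (simp add: algebra_simps)
  then have upper: "?E (\<lambda>c. ?X c ^ Suc j) \<le> l ^ Suc j + (Suc j) ^ 2 * b ^ j"
    using b by (simp only: mult_le_cancel_left_pos)
  have "fact (Suc j) * ?E (\<lambda>c. real (card (sifted P M c) choose Suc j)) =
      ?E (\<lambda>c. fact (Suc j) * real (card (sifted P M c) choose Suc j))"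
    by (simp only: residue_mean_cmult)
  moreover have "\<dots> \<le> ?E (\<lambda>c. ?X c ^ Suc j)"
    by (intro residue_mean_mono fact_mult_choose_le)
  \<comment> \<open>The lower bound for the mean of \<open>?X c ^ Suc j\<close> was free of error.
    Hence on this side only the passage to falling factorials costs something, on the other side
    only the Taylor remainder, and one constant serves for both.\<close>
  moreover have "?E (\<lambda>c. ?X c ^ Suc j - (Suc j) ^ 2 * b ^ j) \<le>
      ?E (\<lambda>c. fact (Suc j) * real (card (sifted P M c) choose Suc j))"
  proof (rule residue_mean_mono)
    fix c assume c: "c \<in> residue_choices P"
    have "real (Suc j) ^ 2 * ?X c ^ j \<le> real (Suc j) ^ 2 * b ^ j"
      using X[OF c] by (intro mult_left_mono power_mono) (auto simp: b_def)
    then show "?X c ^ Suc j - (Suc j) ^ 2 * b ^ j \<le> fact (Suc j) * real (card (sifted P M c) choose Suc j)"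
      using fact_mult_choose_ge[of "card (sifted P M c)" j] unfolding of_nat_power by linarith
  qed
  then have "?E (\<lambda>c. ?X c ^ Suc j) - (Suc j) ^ 2 * b ^ j \<le>
      ?E (\<lambda>c. fact (Suc j) * real (card (sifted P M c) choose Suc j))"
    by (simp only: residue_mean_diff const)
  ultimately have "\<bar>fact (Suc j) * ?E (\<lambda>c. real (card (sifted P M c) choose Suc j)) - l ^ Suc j\<bar>
      \<le> (Suc j) ^ 2 * b ^ j"
    using lower upper by linarith
  then show ?thesis by (simp add: b_def power_mult_distrib mult_ac)
qed

section \<open>The singular series of a progression\<close>

text \<open>Shifts in the conjecture start at 1, so the tuple of the \<open>i * q\<close> is
  translated by 1; a translation changes no number of occupied classes.\<close>

abbreviation progression_series :: "nat \<Rightarrow> nat set \<Rightarrow> real" where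
  "progression_series q I \<equiv> singular_series (int ` (\<lambda>i. 1 + i * q) ` I) 1"

lemma card_image_eq_if_same_fibres:
  assumes "finite A" "\<And>x y. x \<in> A \<Longrightarrow> y \<in> A \<Longrightarrow> f x = f y \<longleftrightarrow> g x = g y"
  shows "card (f ` A) = card (g ` A)"
proof (rule bij_betw_same_card)
  define h where "h u = g (SOME x. x \<in> A \<and> f x = u)" for u
  have h: "h (f x) = g x" if "x \<in> A" for x
  proof -
    have "(SOME y. y \<in> A \<and> f y = f x) \<in> A \<and> f (SOME y. y \<in> A \<and> f y = f x) = f x"
      by (rule someI[of _ x]) (use that in simp)
    then show ?thesis unfolding h_def using assms(2) that by blast
  qed
  show "bij_betw h (f ` A) (g ` A)"
    unfolding bij_betw_def
  proof
    show "inj_on h (f ` A)"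
    proof (rule inj_onI)
      fix u v assume "u \<in> f ` A" "v \<in> f ` A" "h u = h v"
      then obtain x y where xy: "x \<in> A" "y \<in> A" "u = f x" "v = f y" by blast
      then have "g x = g y" using \<open>h u = h v\<close> h by simp
      then show "u = v" using assms(2)[OF xy(1,2)] xy by simp
    qed
    show "h ` f ` A = g ` A" unfolding image_image using h by (intro image_cong refl) simp
  qed
qed

text \<open>Modulo a prime factor of \<open>q\<close> the progression collapses to the class of 1.
  For every other prime \<open>i \<mapsto> 1 + i * q\<close> permutes the residue classes, so the
  indices may be counted instead.\<close>

lemma occupied_classes_progression:
  fixes q p :: nat
  assumes "prime p" "finite I" "I \<noteq> {}"
  shows "occupied_classes (int ` (\<lambda>i. 1 + i * q) ` I) p =
    (if p dvd q then 1 else card ((\<lambda>i. i mod p) ` I))"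
proof -
  have "occupied_classes (int ` (\<lambda>i. 1 + i * q) ` I) p = card (int ` (\<lambda>i. (1 + i * q) mod p) ` I)"
    unfolding occupied_classes_def image_image by (simp only: zmod_int)
  also have "\<dots> = card ((\<lambda>i. (1 + i * q) mod p) ` I)"
    by (rule card_image) (simp add: inj_on_def)
  also have "\<dots> = (if p dvd q then 1 else card ((\<lambda>i. i mod p) ` I))"
  proof (cases "p dvd q")
    case True
    then have "(1 + i * q) mod p = 1 mod p" for i
      by (metis add.right_neutral dvd_imp_mod_0 dvd_mult mod_add_right_eq)
    then have "(\<lambda>i. (1 + i * q) mod p) ` I = {1 mod p}" using assms(3) by auto
    then show ?thesis using True by simp
  next
    case False
    then have cop: "coprime q p" using assms(1) prime_imp_coprime coprime_commute by blast
    have "card ((\<lambda>i. (1 + i * q) mod p) ` I) = card ((\<lambda>i. i mod p) ` I)"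
    proof (rule card_image_eq_if_same_fibres)
      fix x y
      have "(1 + x * q) mod p = (1 + y * q) mod p \<longleftrightarrow> [x * q = y * q] (mod p)"
        unfolding cong_def[symmetric] by (rule cong_add_lcancel_nat)
      also have "\<dots> \<longleftrightarrow> [x = y] (mod p)" by (rule cong_mult_rcancel_nat) (use cop in simp)
      finally show "(1 + x * q) mod p = (1 + y * q) mod p \<longleftrightarrow> x mod p = y mod p"
        unfolding cong_def .
    qed fact
    then show ?thesis using False by simp
  qed
  finally show ?thesis .
qed

text \<open>Two applications of Bernoulli's inequality: \<open>(1 - t) ^ k \<ge> 1 - k * t\<close>,
  and \<open>(1 - t) ^ k\<close> has inverse at least \<open>(1 + t) ^ k \<ge> 1 + k * t\<close>.
  The deviation from 1 is quadratic in \<open>t\<close>, so the tail of the Euler product is close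
  to 1.\<close>

lemma local_factor_bounds:
  fixes t :: real
  assumes "0 \<le> t" "real k * t \<le> 1" "t \<le> 1 / 2"
  shows "inverse ((1 - t) ^ k) * (1 - k * t) \<le> 1"
    and "1 - (k * t) ^ 2 \<le> inverse ((1 - t) ^ k) * (1 - k * t)"
proof -
  have pos: "(1 - t) ^ k > 0" using assms(3) by (intro zero_less_power) auto
  have "1 + k * (- t) \<le> (1 + (- t)) ^ k"
    by (rule Bernoulli_inequality) (use assms in auto)
  then show "inverse ((1 - t) ^ k) * (1 - k * t) \<le> 1"
    using pos by (simp add: field_simps)
  have "1 + k * t \<le> (1 + t) ^ k"
    by (rule Bernoulli_inequality) (use assms in auto)
  also have "\<dots> \<le> (1 / (1 - t)) ^ k"
    using assms by (intro power_mono) (auto simp: field_simps)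
  also have "\<dots> = inverse ((1 - t) ^ k)" by (simp add: power_divide inverse_eq_divide)
  finally have "(1 + k * t) * (1 - k * t) \<le> inverse ((1 - t) ^ k) * (1 - k * t)"
    using assms by (intro mult_right_mono) auto
  then show "1 - (k * t) ^ 2 \<le> inverse ((1 - t) ^ k) * (1 - k * t)"
    by (simp add: algebra_simps power2_eq_square)
qed

text \<open>The primes fall into three groups. A prime factor of \<open>q\<close> contributes the
  power of \<open>1 - 1 / p\<close> with exponent \<open>-j\<close>, all together
  \<open>(q / totient q) ^ j\<close>. The primes in \<open>P\<close> give the quotient of
  \<open>sieve_density P I\<close> by the product in the denominator. For the other primes, all at
  least \<open>z\<close>, the elements of \<open>I\<close> are below \<open>M \<le> z\<close> and
  hence distinct modulo \<open>p\<close>; their factors lie between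
  \<open>1 - (Suc j) ^ 2 / p ^ 2\<close> and 1.\<close>

lemma singular_series_bounds:
  fixes q z M j :: nat
  assumes "q \<ge> 1" "I \<subseteq> {..<M}" "card I = Suc j" "M \<le> z" "2 * Suc j \<le> z"
  defines "P \<equiv> {p. prime p \<and> p < z \<and> \<not> p dvd q}"
  defines "V \<equiv> (real q / real (totient q)) ^ j * sieve_density P I / (\<Prod>p\<in>P. 1 - 1 / real p) ^ Suc j"
  shows "progression_series q I \<le> V"
    and "V * (1 - 2 * (Suc j) ^ 2 / z) \<le> progression_series q I"
    and "V \<ge> 0"
proof -
  define D where "D = int ` (\<lambda>i. 1 + i * q) ` I"
  have finI: "finite I" using assms(2) by (rule finite_subset) simp
  have I0: "I \<noteq> {}" using assms(3) by auto
  have cardD: "card D = Suc j"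
    unfolding D_def using assms(1,3) by (subst card_image) (auto simp: card_image inj_on_def)
  define a where "a p = (if prime p \<and> \<not> p dvd 1
      then inverse ((1 - 1 / real p) ^ Suc j) * (1 - real (occupied_classes D p) / real p) else 1)" for p :: nat
  have S: "singular_series D 1 = prodinf a"
    unfolding singular_series_def cardD a_def by simp
  have p2: "real p \<ge> 2" if "prime p" for p using prime_ge_2_nat[OF that] by simp
  have a_nonprime: "a p = 1" if "\<not> prime p" for p using that by (simp add: a_def)
  have a_dvd: "a p = inverse ((1 - 1 / real p) ^ j)" if "prime p" "p dvd q" for p
  proof -
    have "1 - 1 / real p > 0" using p2[OF that(1)] by simp
    moreover have "occupied_classes D p = 1"
      unfolding D_def using occupied_classes_progression[OF that(1) finI I0] that(2) by simp
    ultimately show ?thesis using that not_prime_unit[of p] by (auto simp: a_def field_simps)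
  qed
  have a_ndvd: "a p = inverse ((1 - 1 / real p) ^ Suc j) * (1 - real (card ((\<lambda>i. i mod p) ` I)) / real p)"
    if "prime p" "\<not> p dvd q" for p
    unfolding a_def D_def using occupied_classes_progression[OF that(1) finI I0] that not_prime_unit[of p]
    by (auto simp del: One_nat_def)
  have card_mod: "card ((\<lambda>i. i mod p) ` I) = Suc j" if "p \<ge> z" for p
  proof -
    have "i mod p = i" if "i \<in> I" for i using that assms(2,4) \<open>p \<ge> z\<close> by (intro mod_less) force
    then have "(\<lambda>i. i mod p) ` I = (\<lambda>i. i) ` I" by (intro image_cong refl) simp
    then show ?thesis using assms(3) by simp
  qed
  have a_large: "a p \<le> 1" "1 - real (Suc j) ^ 2 / real p ^ 2 \<le> a p" "0 \<le> 1 - real (Suc j) ^ 2 / real p ^ 2"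
    "0 \<le> a p"
    if "prime p" "\<not> p dvd q" "p \<ge> z" for p
  proof -
    have "real (2 * Suc j) \<le> real p" using assms(5) that(3) by (simp only: of_nat_le_iff)
    then have le: "real (Suc j) * (1 / real p) \<le> 1" using p2[OF that(1)] by (simp add: field_simps)
    have t: "0 \<le> 1 / real p" "1 / real p \<le> 1 / 2" using p2[OF that(1)] by (auto simp: field_simps)
    have eq: "a p = inverse ((1 - 1 / real p) ^ Suc j) * (1 - real (Suc j) * (1 / real p))"
      unfolding a_ndvd[OF that(1,2)] card_mod[OF that(3)] by simp
    show "a p \<le> 1" unfolding eq by (rule local_factor_bounds(1)[OF t(1) le t(2)])
    show l: "1 - real (Suc j) ^ 2 / real p ^ 2 \<le> a p"
      using local_factor_bounds(2)[OF t(1) le t(2)] unfolding eq power_mult_distrib power_divide by simp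
    have "(real (Suc j) * (1 / real p)) ^ 2 \<le> 1" using le t by (intro power_le_one mult_nonneg_nonneg) auto
    then show "0 \<le> 1 - real (Suc j) ^ 2 / real p ^ 2" by (simp add: power_divide)
    with l show "0 \<le> a p" by linarith
  qed
  \<comment> \<open>Convergence identifies the infinite product with the limit of its partial
    products, to which the bounds are then transferred. Beyond \<open>max z q\<close> every factor
    differs from 1 by at most a constant over \<open>p ^ 2\<close>.\<close>
  have conv: "convergent_prod a"
  proof (intro abs_convergent_prod_imp_convergent_prod summable_imp_abs_convergent_prod)
    show "summable (\<lambda>p. norm (a p - 1))"
    proof (rule summable_comparison_test_ev)
      show "\<forall>\<^sub>F p in sequentially. norm (norm (a p - 1)) \<le> real (Suc j) ^ 2 * inverse (real p ^ 2)"
        using eventually_gt_at_top[of "max z q"]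
      proof eventually_elim
        case (elim p)
        show ?case
        proof (cases "prime p")
          case True
          have "\<not> p dvd q" using elim assms(1) by (auto dest: dvd_imp_le)
          then have "a p \<le> 1" "1 - real (Suc j) ^ 2 / real p ^ 2 \<le> a p"
            using a_large(1,2)[OF True] elim by auto
          then show ?thesis by (simp add: divide_inverse)
        qed (simp add: a_nonprime)
      qed
      show "summable (\<lambda>p. real (Suc j) ^ 2 * inverse (real p ^ 2))"
        by (intro summable_mult inverse_power_summable) simp
    qed
  qed
  have lim: "(\<lambda>n. \<Prod>p\<le>n. a p) \<longlonglongrightarrow> singular_series D 1"
    unfolding S by (rule convergent_prod_LIMSEQ) fact
  have V: "(\<Prod>p\<in>prime_factors q. a p) * (\<Prod>p\<in>P. a p) = V"
  proof -
    have "(\<Prod>p\<in>prime_factors q. a p) = (\<Prod>p\<in>prime_factors q. inverse ((1 - 1 / real p) ^ j))"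
      by (intro prod.cong refl a_dvd) auto
    also have "\<dots> = inverse ((\<Prod>p\<in>prime_factors q. 1 - 1 / real p) ^ j)"
      by (simp add: prod_inversef [symmetric] prod_power_distrib o_def)
    also have "\<dots> = (real q / real (totient q)) ^ j"
      unfolding totient_prod[symmetric, OF order_less_le_trans[OF zero_less_one assms(1)]]
      by (simp add: power_inverse [symmetric])
    finally have 1: "(\<Prod>p\<in>prime_factors q. a p) = (real q / real (totient q)) ^ j" .
    have "(\<Prod>p\<in>P. a p) = (\<Prod>p\<in>P. inverse ((1 - 1 / real p) ^ Suc j) * (1 - real (card ((\<lambda>i. i mod p) ` I)) / real p))"
      by (intro prod.cong refl a_ndvd) (auto simp: P_def)
    also have "\<dots> = (\<Prod>p\<in>P. inverse ((1 - 1 / real p) ^ Suc j)) * sieve_density P I"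
      unfolding sieve_density_def by (rule prod.distrib)
    also have "(\<Prod>p\<in>P. inverse ((1 - 1 / real p) ^ Suc j)) = inverse ((\<Prod>p\<in>P. 1 - 1 / real p) ^ Suc j)"
      unfolding prod_power_distrib by (rule prod_inversef[unfolded o_def])
    finally have 2: "(\<Prod>p\<in>P. a p) = inverse ((\<Prod>p\<in>P. 1 - 1 / real p) ^ Suc j) * sieve_density P I" .
    show ?thesis unfolding 1 2 V_def by (simp only: divide_inverse mult_ac)
  qed
  have density: "0 \<le> sieve_density P I"
    unfolding sieve_density_def
  proof (rule prod_nonneg)
    fix p assume "p \<in> P"
    then have p: "p > 0" by (auto simp: P_def prime_gt_0_nat)
    have "card ((\<lambda>i. i mod p) ` I) \<le> card {..<p}" by (rule card_mono) (use p in auto)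
    then show "0 \<le> 1 - real (card ((\<lambda>i. i mod p) ` I)) / real p" using p by simp
  qed
  have thP: "0 \<le> (\<Prod>p\<in>P. 1 - 1 / real p)"
  proof (rule prod_nonneg)
    fix p assume "p \<in> P"
    then have "real p \<ge> 2" using p2 by (simp add: P_def)
    then show "0 \<le> 1 - 1 / real p" by simp
  qed
  show V0: "V \<ge> 0" unfolding V_def
    using density thP by (intro divide_nonneg_nonneg mult_nonneg_nonneg zero_le_power) auto
  have partial: "(\<Prod>p\<le>n. a p) \<le> V \<and> V * (1 - 2 * (Suc j) ^ 2 / z) \<le> (\<Prod>p\<le>n. a p)"
    if n: "n \<ge> max z q" for n
  proof -
    define T where "T = {p. prime p \<and> p \<le> n \<and> z \<le> p \<and> \<not> p dvd q}"
    have "(\<Prod>p\<le>n. a p) = (\<Prod>p\<in>prime_factors q \<union> (P \<union> T). a p)"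
    proof (rule prod.mono_neutral_right)
      show "prime_factors q \<union> (P \<union> T) \<subseteq> {..n}"
      proof
        fix p assume "p \<in> prime_factors q \<union> (P \<union> T)"
        then consider "p dvd q" | "p < z" | "p \<le> n" by (auto simp: P_def T_def)
        then show "p \<in> {..n}" using n assms(1) by cases (auto dest!: dvd_imp_le)
      qed
      show "\<forall>p\<in>{..n} - (prime_factors q \<union> (P \<union> T)). a p = 1"
      proof
        fix p assume p: "p \<in> {..n} - (prime_factors q \<union> (P \<union> T))"
        have "\<not> prime p"
        proof
          assume "prime p"
          then show False using p assms(1) by (cases "p < z"; cases "p dvd q")
            (auto simp: P_def T_def in_prime_factors_iff)
        qed
        then show "a p = 1" by (rule a_nonprime)
      qed
    qed simp
    also have "\<dots> = (\<Prod>p\<in>prime_factors q. a p) * (\<Prod>p\<in>P \<union> T. a p)"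
      by (rule prod.union_disjoint) (auto simp: P_def T_def)
    also have "(\<Prod>p\<in>P \<union> T. a p) = (\<Prod>p\<in>P. a p) * (\<Prod>p\<in>T. a p)"
      by (rule prod.union_disjoint) (auto simp: P_def T_def)
    finally have eq: "(\<Prod>p\<le>n. a p) = V * (\<Prod>p\<in>T. a p)"
      unfolding V [symmetric] by (simp only: mult.assoc)
    have T: "prime p" "\<not> p dvd q" "p \<ge> z" if "p \<in> T" for p using that by (auto simp: T_def)
    have up: "(\<Prod>p\<in>T. a p) \<le> 1"
      using a_large T by (intro prod_le_1) blast
    have z2: "real z \<ge> 2" using assms(5) by simp
    have "(\<Sum>p\<in>T. 1 / real p ^ 2) \<le> 1 / (real z - 1)"
      using assms(5) T(3) by (intro sum_inverse_squares_le) (auto simp: T_def)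
    also have "\<dots> \<le> 2 / real z" using z2 by (simp add: field_simps)
    finally have "(\<Sum>p\<in>T. real (Suc j) ^ 2 / real p ^ 2) \<le> real (Suc j) ^ 2 * (2 / real z)"
      unfolding divide_inverse[of "real (Suc j) ^ 2"] sum_distrib_left [symmetric]
      by (intro mult_left_mono) (simp_all add: inverse_eq_divide)
    moreover have "a * (2 / real z) = 2 * a / real z" for a by simp
    ultimately have "1 - 2 * real (Suc j) ^ 2 / real z \<le> 1 - (\<Sum>p\<in>T. real (Suc j) ^ 2 / real p ^ 2)"
      by (metis diff_left_mono)
    also have "\<dots> \<le> (\<Prod>p\<in>T. 1 - real (Suc j) ^ 2 / real p ^ 2)"
      using a_large(3)[OF T] by (intro Weierstrass_prod_ineq) simp
    also have "\<dots> \<le> (\<Prod>p\<in>T. a p)"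
      using a_large(2,3)[OF T] by (intro prod_mono) blast
    finally have low: "1 - 2 * real (Suc j) ^ 2 / real z \<le> (\<Prod>p\<in>T. a p)" .
    show ?thesis unfolding eq using mult_left_mono[OF up V0] mult_left_mono[OF low V0] by simp
  qed
  show "progression_series q I \<le> V"
    using lim partial unfolding D_def by (intro LIMSEQ_le_const2[OF lim[unfolded D_def]]) blast
  show "V * (1 - 2 * (Suc j) ^ 2 / z) \<le> progression_series q I"
    using lim partial unfolding D_def by (intro LIMSEQ_le_const[OF lim[unfolded D_def]]) blast
qed

section \<open>Prime tuples in progressions\<close>

definition prime_totatives :: "nat \<Rightarrow> nat set \<Rightarrow> nat set" where
  "prime_totatives q I = {a \<in> totatives q. \<forall>i\<in>I. prime (a + i * q)}"

text \<open>The sum starts at 2 because \<open>a = n + 1\<close> with \<open>n \<ge> 1\<close>, the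
  1 being the offset of the shifts. No coprimality to \<open>q\<close> is imposed, as the conjecture
  is applied with modulus 1; the \<open>a\<close> that share a factor with \<open>q\<close> are
  accounted for as exceptional.\<close>

definition mangoldt_correlation :: "nat \<Rightarrow> nat set \<Rightarrow> real" where
  "mangoldt_correlation q I = (\<Sum>a\<in>{2..q}. \<Prod>i\<in>I. mangoldt (a + i * q))"

lemma finite_prime_totatives: "finite (prime_totatives q I)"
  unfolding prime_totatives_def by simp

text \<open>The constant is made a function of \<open>card I\<close> alone, so that it can be taken
  out of sums over all \<open>I\<close> of a given size.\<close>

lemma hardy_littlewood_progression:
  assumes "uniform_hardy_littlewood"
  obtains \<delta> :: real and C :: "nat \<Rightarrow> real" where "0 < \<delta>" "\<delta> < 1 / 2"
    "\<And>q M N I. q \<ge> 2 \<Longrightarrow> N \<ge> 2 \<Longrightarrow> M * q + 1 \<le> N \<Longrightarrow> I \<subseteq> {..<M} \<Longrightarrow> I \<noteq> {} \<Longrightarrow>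
      \<bar>mangoldt_correlation q I - progression_series q I * real (q - 1)\<bar>
        \<le> C (card I) * real N powr (1 - \<delta>)"
proof -
  define R where "R \<delta> k C \<longleftrightarrow> (\<forall>(q::nat) (D::nat) (N::nat) (\<D>::nat set) (x::real).
            q \<ge> 1 \<longrightarrow> D \<ge> 1 \<longrightarrow> N \<ge> 1 \<longrightarrow>
            real (totient q) \<le> real N / ln (real N) \<longrightarrow> D \<le> N \<longrightarrow>
            \<D> \<subseteq> {1..D} \<longrightarrow> card \<D> = k \<longrightarrow> (\<forall>d\<in>\<D>. q dvd d) \<longrightarrow>
            1 \<le> x \<longrightarrow> x \<le> real N \<longrightarrow>
            \<bar>(\<Sum>n | 1 \<le> n \<and> real n \<le> x \<and> coprime n q. \<Prod>d\<in>\<D>. mangoldt (n + d))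
              - singular_series (int ` \<D>) q
                * real (card {n::nat. 1 \<le> n \<and> real n \<le> x \<and> coprime n q})\<bar>
            \<le> C * real N powr (1 - \<delta>))" for \<delta> :: real and k :: nat and C :: real
  obtain \<delta> :: real where d: "0 < \<delta>" "\<delta> < 1 / 2" and ex: "\<forall>k\<ge>1. \<exists>C. R \<delta> k C"
    using assms unfolding uniform_hardy_littlewood_def R_def by (elim exE conjE)
  define C where "C k = (SOME C. R \<delta> k C)" for k
  have C: "R \<delta> k (C k)" if "k \<ge> 1" for k
    unfolding C_def by (rule someI_ex) (use ex that in simp)
  show ?thesis
  proof (rule that[OF d])
    fix q M N :: nat and I :: "nat set"
    assume q: "q \<ge> 2" and N: "N \<ge> 2" "M * q + 1 \<le> N" and I: "I \<subseteq> {..<M}" "I \<noteq> {}"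
    have finI: "finite I" using I(1) by (rule finite_subset) simp
    let ?D = "(\<lambda>i. 1 + i * q) ` I"
    have inj: "inj_on (\<lambda>i. 1 + i * q) I" using q by (auto simp: inj_on_def)
    have Mq: "i * q + q \<le> M * q" if "i \<in> I" for i
    proof -
      have "Suc i * q \<le> M * q" using I(1) that by (intro mult_le_mono1) auto
      then show ?thesis by simp
    qed
    have "?D \<subseteq> {1..N}"
    proof (rule image_subsetI)
      fix i assume "i \<in> I"
      from Mq[OF this] N(2) show "1 + i * q \<in> {1..N}" unfolding atLeastAtMost_iff by linarith
    qed
    have "ln (real N) \<le> real N" "ln (real N) > 0"
      using N ln_le_minus_one[of "real N"] by auto
    then have tot: "real (totient 1) \<le> real N / ln (real N)" by (simp add: le_divide_eq)
    obtain i where "i \<in> I" using I(2) by blast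
    then have qN: "q \<le> N" using Mq[of i] N by linarith
    have set_eq: "{n. 1 \<le> n \<and> real n \<le> real (q - 1) \<and> coprime n 1} = {1..q - 1}"
      by auto
    have "(\<Sum>n | 1 \<le> n \<and> real n \<le> real (q - 1) \<and> coprime n 1. \<Prod>d\<in>?D. mangoldt (n + d)) =
        (\<Sum>n\<in>{1..q - 1}. \<Prod>i\<in>I. mangoldt (Suc n + i * q) :: real)"
      unfolding set_eq prod.reindex[OF inj] by simp
    also have "\<dots> = (\<Sum>a\<in>Suc ` {1..q - 1}. \<Prod>i\<in>I. mangoldt (a + i * q))"
      by (subst sum.reindex) auto
    also have "Suc ` {1..q - 1} = {2..q}"
      unfolding image_Suc_atLeastAtMost using q by (simp add: numeral_2_eq_2)
    finally have corr: "(\<Sum>n | 1 \<le> n \<and> real n \<le> real (q - 1) \<and> coprime n 1. \<Prod>d\<in>?D. mangoldt (n + d)) =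
        mangoldt_correlation q I" unfolding mangoldt_correlation_def .
    have "card I \<ge> 1" using finI I(2) by (simp add: Suc_le_eq card_gt_0_iff)
    \<comment> \<open>The modulus is 1, both \<open>D\<close> and the bound are \<open>N\<close>,
      and \<open>x = q - 1\<close>, so that \<open>n + 1\<close> runs up to \<open>q\<close>. The
      condition \<open>1 \<le> x\<close> holds because \<open>q \<ge> 2\<close>.\<close>
    then have "\<bar>(\<Sum>n | 1 \<le> n \<and> real n \<le> real (q - 1) \<and> coprime n 1. \<Prod>d\<in>?D. mangoldt (n + d)) -
        singular_series (int ` ?D) 1 * real (card {n. 1 \<le> n \<and> real n \<le> real (q - 1) \<and> coprime n 1})\<bar>
        \<le> C (card I) * real N powr (1 - \<delta>)"
      using C[of "card I", unfolded R_def, rule_format, of 1 N N ?D "real (q - 1)"]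
        card_image[OF inj] q N qN tot \<open>?D \<subseteq> {1..N}\<close> by simp
    then show "\<bar>mangoldt_correlation q I - singular_series (int ` ?D) 1 * real (q - 1)\<bar>
        \<le> C (card I) * real N powr (1 - \<delta>)"
      unfolding corr unfolding set_eq by simp
  qed
qed

text \<open>At most \<open>y\<close> of the \<open>a\<close> are discarded; for each remaining one
  every weight is at least \<open>ln y\<close>. Since \<open>y \<ge> 1\<close>, the \<open>a\<close>
  that are kept exceed 1 and lie in the range of the correlation.\<close>

lemma card_prime_totatives_le:
  fixes y :: real
  assumes "y \<ge> 1" "finite I"
  shows "(real (card (prime_totatives q I)) - y) * ln y ^ card I \<le> mangoldt_correlation q I"
proof -
  define A where "A = {a \<in> prime_totatives q I. real a > y}"
  have finA: "finite A" unfolding A_def using finite_prime_totatives by simp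
  have "prime_totatives q I \<subseteq> A \<union> {1..nat \<lfloor>y\<rfloor>}"
  proof
    fix a assume a: "a \<in> prime_totatives q I"
    then have "a \<ge> 1" by (auto simp: prime_totatives_def totatives_def)
    moreover have "a \<le> nat \<lfloor>y\<rfloor>" if "\<not> y < real a"
    proof -
      have "int a \<le> \<lfloor>y\<rfloor>" using that by (simp add: le_floor_iff)
      then show ?thesis by linarith
    qed
    ultimately show "a \<in> A \<union> {1..nat \<lfloor>y\<rfloor>}" using a by (auto simp: A_def)
  qed
  then have "card (prime_totatives q I) \<le> card (A \<union> {1..nat \<lfloor>y\<rfloor>})"
    using finA by (intro card_mono) auto
  also have "\<dots> \<le> card A + nat \<lfloor>y\<rfloor>" by (rule order_trans[OF card_Un_le]) simp
  finally have "real (card (prime_totatives q I)) \<le> real (card A) + real (nat \<lfloor>y\<rfloor>)"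
    by (simp only: of_nat_add [symmetric] of_nat_le_iff)
  also have "real (nat \<lfloor>y\<rfloor>) \<le> y" using assms(1) by (simp add: of_nat_nat)
  finally have "real (card (prime_totatives q I)) - y \<le> card A" by simp
  then have "(real (card (prime_totatives q I)) - y) * ln y ^ card I \<le> card A * ln y ^ card I"
    using assms(1) by (intro mult_right_mono) auto
  also have "\<dots> = (\<Sum>a\<in>A. \<Prod>i\<in>I. ln y)" by simp
  also have "\<dots> \<le> (\<Sum>a\<in>A. \<Prod>i\<in>I. mangoldt (a + i * q))"
  proof (intro sum_mono prod_mono conjI)
    fix a i assume a: "a \<in> A" "i \<in> I"
    then have "prime (a + i * q)" by (auto simp: A_def prime_totatives_def)
    then have "mangoldt (a + i * q) = ln (real (a + i * q))" by simp
    moreover have "y \<le> real a" "real a \<le> real (a + i * q)" using a by (simp_all add: A_def)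
    then have "y \<le> real (a + i * q)" by linarith
    ultimately show "ln y \<le> mangoldt (a + i * q)" using assms(1) by simp
    show "0 \<le> ln y" using assms(1) by simp
  qed
  also have "\<dots> \<le> mangoldt_correlation q I"
    unfolding mangoldt_correlation_def
  proof (rule sum_mono2)
    show "A \<subseteq> {2..q}"
    proof
      fix a assume a: "a \<in> A"
      then have "a > 1" "a \<le> q" using assms(1) by (auto simp: A_def prime_totatives_def totatives_def)
      then show "a \<in> {2..q}" by simp
    qed
  qed (auto intro: prod_nonneg mangoldt_nonneg)
  finally show ?thesis .
qed

section \<open>From von Mangoldt weights to primes\<close>

text \<open>The numbers up to \<open>H\<close> where the von Mangoldt function is nonzero without
  indicating a prime coprime to \<open>q\<close>.\<close>

definition exceptional_numbers :: "nat \<Rightarrow> nat \<Rightarrow> nat set" where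
  "exceptional_numbers q H = {m. m \<le> H \<and> (prime m \<and> m dvd q \<or> primepow m \<and> \<not> prime m)}"

text \<open>A proper prime power \<open>r ^ e \<le> H\<close> has \<open>r \<le> sqrt H\<close> and
  \<open>e \<le> log 2 H\<close>, and \<open>q \<le> H\<close> has at most \<open>log 2 H\<close>
  prime factors.\<close>

lemma card_exceptional_numbers_le:
  assumes "1 \<le> q" "q \<le> H"
  shows "real (card (exceptional_numbers q H)) \<le> (sqrt H + 1) * (log 2 H + 1)"
proof -
  have H: "real H \<ge> 1" using assms by simp
  have "2 ^ card (prime_factors q) \<le> (\<Prod>p\<in>prime_factors q. p)"
    using prod_mono[of "prime_factors q" "\<lambda>_. 2" "\<lambda>p. p"] prime_ge_2_nat by auto
  also have "\<dots> \<le> q"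
    using assms(1) by (intro dvd_imp_le prod_primes_dvd) auto
  finally have "2 ^ card (prime_factors q) \<le> H" using assms(2) by linarith
  then have pf: "real (card (prime_factors q)) \<le> log 2 H"
    using H by (simp add: le_log_iff powr_realpow)
  define E where "E = {1..nat \<lfloor>sqrt H\<rfloor>} \<times> {..nat \<lfloor>log 2 H\<rfloor>}"
  have "exceptional_numbers q H \<subseteq> prime_factors q \<union> (\<lambda>(r, e). r ^ e) ` E"
  proof
    fix m assume m: "m \<in> exceptional_numbers q H"
    show "m \<in> prime_factors q \<union> (\<lambda>(r, e). r ^ e) ` E"
    proof (cases "prime m")
      case True
      then show ?thesis using m assms(1) by (auto simp: exceptional_numbers_def in_prime_factors_iff)
    next
      case False
      then have "primepow m" "m \<le> H" using m by (auto simp: exceptional_numbers_def)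
      then obtain r e where re: "prime r" "m = r ^ e" "e > 0" by (auto simp: primepow_def)
      then have "e \<noteq> 1" using False by auto
      then have e2: "e \<ge> 2" using re(3) by linarith
      have r2: "r \<ge> 2" using re(1) by (rule prime_ge_2_nat)
      have "r ^ 2 \<le> r ^ e" using e2 r2 by (intro power_increasing) auto
      then have "real r ^ 2 \<le> real H" using re(2) \<open>m \<le> H\<close> by (metis of_nat_le_iff of_nat_power order_trans)
      then have "real r \<le> sqrt H" by (rule real_le_rsqrt)
      then have 1: "r \<in> {1..nat \<lfloor>sqrt H\<rfloor>}" using r2 by (simp add: le_nat_iff le_floor_iff)
      have "2 ^ e \<le> r ^ e" using r2 by (intro power_mono) auto
      then have "2 ^ e \<le> H" using re(2) \<open>m \<le> H\<close> by linarith
      then have "real e \<le> log 2 H"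
        using H by (simp add: le_log_iff powr_realpow)
      then have "e \<in> {..nat \<lfloor>log 2 H\<rfloor>}" by (simp add: le_nat_iff le_floor_iff)
      with 1 show ?thesis unfolding re(2) E_def by force
    qed
  qed
  then have "card (exceptional_numbers q H) \<le> card (prime_factors q \<union> (\<lambda>(r, e). r ^ e) ` E)"
    by (intro card_mono) (auto simp: E_def)
  also have "\<dots> \<le> card (prime_factors q) + card E"
    by (rule order_trans[OF card_Un_le]) (intro add_left_mono card_image_le, simp add: E_def)
  also have "card E = nat \<lfloor>sqrt H\<rfloor> * Suc (nat \<lfloor>log 2 H\<rfloor>)" by (simp add: E_def)
  finally have "real (card (exceptional_numbers q H)) \<le>
      real (card (prime_factors q)) + real (nat \<lfloor>sqrt H\<rfloor>) * (real (nat \<lfloor>log 2 H\<rfloor>) + 1)"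
  proof -
    assume "card (exceptional_numbers q H) \<le> card (prime_factors q) + nat \<lfloor>sqrt H\<rfloor> * Suc (nat \<lfloor>log 2 H\<rfloor>)"
    then have "real (card (exceptional_numbers q H)) \<le>
        real (card (prime_factors q) + nat \<lfloor>sqrt H\<rfloor> * Suc (nat \<lfloor>log 2 H\<rfloor>))"
      by (simp only: of_nat_le_iff)
    then show ?thesis by (simp only: of_nat_add of_nat_mult of_nat_Suc add.commute)
  qed
  also have "\<dots> \<le> log 2 H + sqrt H * (log 2 H + 1)"
  proof -
    have "real (nat \<lfloor>sqrt H\<rfloor>) \<le> sqrt H" by (simp add: of_nat_nat)
    moreover have "log 2 H \<ge> 0" using H by simp
    then have "real (nat \<lfloor>log 2 H\<rfloor>) \<le> log 2 H" by (simp add: of_nat_nat)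
    ultimately show ?thesis using pf by (intro add_mono mult_mono) auto
  qed
  also have "\<dots> \<le> (sqrt H + 1) * (log 2 H + 1)" by (simp add: algebra_simps)
  finally show ?thesis .
qed

text \<open>If the product at \<open>a\<close> is nonzero and \<open>a\<close> is not counted in
  \<open>prime_totatives q I\<close>, then some \<open>a + i * q\<close> is exceptional. For each
  \<open>i\<close> this concerns at most as many \<open>a\<close> as there are exceptional
  numbers.\<close>

lemma mangoldt_correlation_le:
  assumes "q \<ge> 1" "M * q \<le> H" "I \<subseteq> {..<M}" "I \<noteq> {}" "H \<ge> 3"
  shows "mangoldt_correlation q I \<le>
    ln H ^ card I * (real (card (prime_totatives q I)) + real (card I) * real (card (exceptional_numbers q H)))"
proof -
  have finI: "finite I" using assms(3) by (rule finite_subset) simp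
  let ?B = "exceptional_numbers q H"
  have finB: "finite ?B" by (rule finite_subset[of _ "{..H}"]) (auto simp: exceptional_numbers_def)
  define E where "E = (\<Union>i\<in>I. {a. a + i * q \<in> ?B})"
  have lnH: "ln (real H) \<ge> 0" using assms(5) by simp
  have le: "a + i * q \<le> H" if "a \<le> q" "i \<in> I" for a i
  proof -
    have "Suc i * q \<le> M * q" using assms(3) that by (intro mult_le_mono1) auto
    then show ?thesis using that(1) assms(2) by simp
  qed
  have cardi: "finite {a. a + i * q \<in> ?B} \<and> card {a. a + i * q \<in> ?B} \<le> card ?B" for i
  proof -
    have "inj_on (\<lambda>a. a + i * q) {a. a + i * q \<in> ?B}" by (simp add: inj_on_def)
    moreover have "(\<lambda>a. a + i * q) ` {a. a + i * q \<in> ?B} \<subseteq> ?B" by auto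
    ultimately show ?thesis using finB inj_on_finite card_inj_on_le by blast
  qed
  have finE: "finite E" unfolding E_def using finI cardi by auto
  have "card E \<le> (\<Sum>i\<in>I. card {a. a + i * q \<in> ?B})" unfolding E_def using finI by (rule card_UN_le)
  also have "\<dots> \<le> (\<Sum>i\<in>I. card ?B)" using cardi by (intro sum_mono) blast
  finally have cardE: "card E \<le> card I * card ?B" by simp
  have zero: "(\<Prod>i\<in>I. mangoldt (a + i * q)) = (0::real)"
    if a: "a \<in> {2..q} - (prime_totatives q I \<union> E)" for a
  proof (rule ccontr)
    assume nz: "(\<Prod>i\<in>I. mangoldt (a + i * q)) \<noteq> (0::real)"
    have pp: "primepow (a + i * q)" if "i \<in> I" for i
    proof (rule ccontr)
      assume "\<not> primepow (a + i * q)"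
      then have "mangoldt (a + i * q) = (0::real)" by (simp add: mangoldt_def)
      then show False using nz finI that by (simp add: prod_zero_iff)
    qed
    have notB: "a + i * q \<notin> ?B" if "i \<in> I" for i
      using a that unfolding E_def by blast
    have pr: "prime (a + i * q)" if "i \<in> I" for i
    proof (rule ccontr)
      assume "\<not> prime (a + i * q)"
      moreover have "a + i * q \<le> H" using le[OF _ that] a by simp
      ultimately show False using pp[OF that] notB[OF that] unfolding exceptional_numbers_def by simp
    qed
    \<comment> \<open>At this point all \<open>a + i * q\<close> are primes. A prime dividing both
      \<open>a\<close> and \<open>q\<close> divides each of them, hence equals it, so a prime factor
      of \<open>q\<close> occurs among them, contrary to \<open>notB\<close>.\<close>
    have "\<not> coprime a q"
    proof
      assume "coprime a q"
      then have "a \<in> prime_totatives q I" using a pr by (auto simp: prime_totatives_def totatives_def)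
      then show False using a by blast
    qed
    then have "gcd a q \<noteq> 1" by (simp add: coprime_iff_gcd_eq_1)
    then obtain p where p: "prime p" "p dvd gcd a q" using prime_factor_nat by blast
    obtain i where i: "i \<in> I" using assms(4) by blast
    have "p dvd a + i * q" using p by (intro dvd_add dvd_mult) auto
    then have eq: "p = a + i * q" using p(1) pr[OF i] primes_dvd_imp_eq by blast
    have "p dvd q" using p(2) by simp
    moreover have "a + i * q \<le> H" using le[OF _ i] a by simp
    ultimately have "a + i * q \<in> ?B" using p(1) unfolding eq exceptional_numbers_def by simp
    then show False using notB[OF i] by contradiction
  qed
  have "mangoldt_correlation q I = (\<Sum>a\<in>{2..q} \<inter> (prime_totatives q I \<union> E). \<Prod>i\<in>I. mangoldt (a + i * q))"
    unfolding mangoldt_correlation_def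
    by (rule sum.mono_neutral_right) (use zero in auto)
  also have "\<dots> \<le> (\<Sum>a\<in>{2..q} \<inter> (prime_totatives q I \<union> E). \<Prod>i\<in>I. ln H)"
  proof (intro sum_mono prod_mono conjI)
    fix a i assume a: "a \<in> {2..q} \<inter> (prime_totatives q I \<union> E)" "i \<in> I"
    show "0 \<le> (mangoldt (a + i * q) :: real)" by (rule mangoldt_nonneg)
    have "mangoldt (a + i * q) \<le> ln (real (a + i * q))" using a by (intro mangoldt_le) auto
    also have "\<dots> \<le> ln (real H)"
    proof -
      have "a > 0" "a \<le> q" using a(1) by auto
      then have "real (a + i * q) > 0" "real (a + i * q) \<le> real H"
        using le[OF \<open>a \<le> q\<close> a(2)] by (simp_all only: of_nat_0_less_iff of_nat_le_iff)
      then show ?thesis by simp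
    qed
    finally show "mangoldt (a + i * q) \<le> ln (real H)" .
  qed
  also have "\<dots> = real (card ({2..q} \<inter> (prime_totatives q I \<union> E))) * ln H ^ card I" by simp
  also have "\<dots> \<le> (real (card (prime_totatives q I)) + real (card I) * real (card ?B)) * ln H ^ card I"
  proof (rule mult_right_mono)
    have "card ({2..q} \<inter> (prime_totatives q I \<union> E)) \<le> card (prime_totatives q I \<union> E)"
      using finE finite_prime_totatives by (intro card_mono) auto
    also have "\<dots> \<le> card (prime_totatives q I) + card E" by (rule card_Un_le)
    also have "\<dots> \<le> card (prime_totatives q I) + card I * card ?B" using cardE by simp
    finally show "real (card ({2..q} \<inter> (prime_totatives q I \<union> E))) \<le>
        real (card (prime_totatives q I)) + real (card I) * real (card ?B)"
      by (simp only: of_nat_mult [symmetric] of_nat_add [symmetric] of_nat_le_iff)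
  qed (use lnH in simp)
  finally show ?thesis by (simp only: mult.commute)
qed

section \<open>Counting primes in blocks of fixed length\<close>

text \<open>The number of \<open>i\<close> with \<open>a + i * q \<le> N\<close> depends on
  \<open>a\<close>. With a fixed block length all \<open>a\<close> share the index set
  \<open>{..<M}\<close>, and the sums over \<open>a\<close> and over \<open>I\<close> can be
  exchanged.\<close>

definition prime_count_block :: "nat \<Rightarrow> nat \<Rightarrow> nat \<Rightarrow> nat" where
  "prime_count_block q M a = card {i. i < M \<and> prime (a + i * q)}"

lemma sum_choose_prime_count_block:
  "(\<Sum>a\<in>totatives q. real (prime_count_block q M a choose j)) =
    (\<Sum>I | I \<subseteq> {..<M} \<and> card I = j. real (card (prime_totatives q I)))"
proof -
  let ?F = "{I. I \<subseteq> {..<M} \<and> card I = j}"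
  have finF: "finite ?F" by (rule finite_subset[of _ "Pow {..<M}"]) auto
  have "real (prime_count_block q M a choose j) = (\<Sum>I\<in>?F. of_bool (\<forall>i\<in>I. prime (a + i * q)))" for a
  proof -
    have "(prime_count_block q M a choose j) = card {I. I \<subseteq> {i. i < M \<and> prime (a + i * q)} \<and> card I = j}"
      unfolding prime_count_block_def by (rule n_subsets [symmetric]) simp
    also have "{I. I \<subseteq> {i. i < M \<and> prime (a + i * q)} \<and> card I = j} = {I \<in> ?F. \<forall>i\<in>I. prime (a + i * q)}"
      by auto
    finally show ?thesis using finF by (simp add: of_bool_def sum.If_cases Int_def)
  qed
  then have "(\<Sum>a\<in>totatives q. real (prime_count_block q M a choose j)) =
      (\<Sum>a\<in>totatives q. \<Sum>I\<in>?F. of_bool (\<forall>i\<in>I. prime (a + i * q)))" by (simp only:)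
  also have "\<dots> = (\<Sum>I\<in>?F. \<Sum>a\<in>totatives q. of_bool (\<forall>i\<in>I. prime (a + i * q)))" by (rule sum.swap)
  also have "\<dots> = (\<Sum>I\<in>?F. real (card (prime_totatives q I)))"
    by (intro sum.cong refl) (simp add: prime_totatives_def of_bool_def sum.If_cases Int_def)
  finally show ?thesis .
qed

text \<open>The representatives satisfy \<open>1 \<le> a \<le> q\<close>: for
  \<open>i < N div q\<close> the term \<open>a + i * q\<close> is at most
  \<open>(i + 1) * q \<le> N\<close>, and a prime \<open>a + i * q \<le> N\<close> forces
  \<open>i \<le> N div q\<close>.\<close>

lemma primes_in_class_bounds:
  assumes "a \<in> totatives q"
  shows "prime_count_block q (N div q) a \<le> primes_in_class N q a"
    and "primes_in_class N q a \<le> prime_count_block q (N div q + 1) a"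
proof -
  have a: "a \<ge> 1" "a \<le> q" using assms by (auto simp: totatives_def)
  then have q: "q > 0" by linarith
  let ?S = "{p. prime p \<and> p \<le> N \<and> [p = a] (mod q)}"
  have inj: "inj_on (\<lambda>i. a + i * q) A" for A using q by (simp add: inj_on_def)
  have finS: "finite ?S" by (rule finite_subset[of _ "{..N}"]) auto
  show "prime_count_block q (N div q) a \<le> primes_in_class N q a"
    unfolding prime_count_block_def primes_in_class_def
  proof (rule card_inj_on_le[OF inj _ finS], rule image_subsetI)
    fix i assume i: "i \<in> {i. i < N div q \<and> prime (a + i * q)}"
    then have "Suc i * q \<le> (N div q) * q" by (intro mult_le_mono1) auto
    also have "\<dots> \<le> N" by simp
    finally have "a + i * q \<le> N" using a(2) by simp
    moreover have "[a + i * q = a] (mod q)" by (simp add: cong_def)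
    ultimately show "a + i * q \<in> ?S" using i by blast
  qed
  have sub: "?S \<subseteq> (\<lambda>i. a + i * q) ` {i. i < N div q + 1 \<and> prime (a + i * q)}"
  proof
    fix p assume p: "p \<in> ?S"
    then have p2: "p \<ge> 2" using prime_ge_2_nat by blast
    have "a \<le> p"
    proof (rule ccontr)
      assume "\<not> a \<le> p"
      then have "q dvd a - p" using p cong_altdef_nat[of p a q] by (auto simp: cong_sym_eq cong_altdef_nat)
      then have "q \<le> a - p" using \<open>\<not> a \<le> p\<close> by (intro dvd_imp_le) auto
      then show False using a p2 \<open>\<not> a \<le> p\<close> by linarith
    qed
    then have "q dvd p - a" using p by (simp add: cong_altdef_nat)
    then obtain i where "p - a = q * i" by (rule dvdE)
    then have pe: "p = a + i * q" using \<open>a \<le> p\<close> by (simp add: mult.commute)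
    then have "i * q \<le> N" using p by simp
    then have "i \<le> N div q" using q by (simp add: less_eq_div_iff_mult_less_eq)
    then show "p \<in> (\<lambda>i. a + i * q) ` {i. i < N div q + 1 \<and> prime (a + i * q)}"
      using p pe by auto
  qed
  have "card ?S \<le> card ((\<lambda>i. a + i * q) ` {i. i < N div q + 1 \<and> prime (a + i * q)})"
    using sub by (intro card_mono) auto
  also have "\<dots> = card {i. i < N div q + 1 \<and> prime (a + i * q)}" by (rule card_image[OF inj])
  finally show "primes_in_class N q a \<le> prime_count_block q (N div q + 1) a"
    unfolding prime_count_block_def primes_in_class_def .
qed

text \<open>Induction on \<open>k\<close> with \<open>x * f j = f (Suc j) + j * f j\<close> for the
  falling factorials \<open>f\<close>; collecting coefficients reproduces the recurrence of the
  Stirling numbers. The term for \<open>j = 0\<close> vanishes as \<open>k \<ge> 1\<close>.\<close>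

lemma power_eq_sum_Stirling:
  assumes "k \<ge> 1"
  shows "real x ^ k = (\<Sum>j=1..k. real (Stirling k j) * (fact j * real (x choose j)))"
proof -
  define f where "f j = fact j * real (x choose j)" for j
  have f_Suc: "real x * f j = f (Suc j) + real j * f j" for j
    using fact_mult_choose_Suc[of j x] by (simp add: f_def algebra_simps)
  have "real x ^ k = (\<Sum>j\<le>k. real (Stirling k j) * f j)" for k
  proof (induction k)
    case (Suc k)
    have "real x ^ Suc k = (\<Sum>j\<le>k. real (Stirling k j) * (real x * f j))"
      unfolding power_Suc Suc sum_distrib_left by (intro sum.cong refl) (simp only: mult_ac)
    also have "\<dots> = (\<Sum>j\<le>k. real (Stirling k j) * f (Suc j)) + (\<Sum>j\<le>k. real (j * Stirling k j) * f j)"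
      unfolding f_Suc by (simp add: distrib_left sum.distrib mult_ac)
    also have "(\<Sum>j\<le>k. real (j * Stirling k j) * f j) = (\<Sum>j\<le>Suc k. real (j * Stirling k j) * f j)"
      by simp
    also have "\<dots> = (\<Sum>j\<le>k. real (Suc j * Stirling k (Suc j)) * f (Suc j))"
      by (subst sum.atMost_Suc_shift) simp
    also have "(\<Sum>j\<le>k. real (Stirling k j) * f (Suc j)) + (\<Sum>j\<le>k. real (Suc j * Stirling k (Suc j)) * f (Suc j)) =
        (\<Sum>j\<le>k. real (Stirling (Suc k) (Suc j)) * f (Suc j))"
      unfolding sum.distrib [symmetric] by (intro sum.cong refl) (simp add: algebra_simps)
    also have "\<dots> = (\<Sum>j\<le>Suc k. real (Stirling (Suc k) j) * f j)"
      by (subst sum.atMost_Suc_shift) simp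
    finally show ?case .
  qed (simp add: f_def)
  moreover have "(\<Sum>j\<le>k. real (Stirling k j) * f j) = (\<Sum>j=1..k. real (Stirling k j) * f j)"
  proof (rule sum.mono_neutral_right)
    show "\<forall>j\<in>{..k} - {1..k}. real (Stirling k j) * f j = 0"
    proof
      fix j assume "j \<in> {..k} - {1..k}"
      then have "j = 0" by auto
      then show "real (Stirling k j) * f j = 0" using assms by (cases k) auto
    qed
  qed auto
  ultimately show ?thesis unfolding f_def by simp
qed

section \<open>Asymptotics uniform in the modulus\<close>

text \<open>For bounded \<open>e\<close> and bounded target functions,
  \<open>f - f' \<in> O(e)\<close> behaves like a congruence: it is compatible with products, powers
  and squeezing. All later asymptotics are composed from these rules.\<close>

lemma bigo_one_cong_diff:
  fixes f f' e :: "'x \<Rightarrow> real"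
  assumes "(\<lambda>x. f x - f' x) \<in> O[F](e)" "e \<in> O[F](\<lambda>_. 1)" "f' \<in> O[F](\<lambda>_. 1)"
  shows "f \<in> O[F](\<lambda>_. 1)"
proof -
  have "(\<lambda>x. (f x - f' x) + f' x) \<in> O[F](\<lambda>_. 1)"
    by (intro sum_in_bigo landau_o.big_trans[OF assms(1,2)] assms(3))
  then show ?thesis by simp
qed

lemma bigo_diff_mult:
  fixes f f' g g' e :: "'x \<Rightarrow> real"
  assumes "(\<lambda>x. f x - f' x) \<in> O[F](e)" "(\<lambda>x. g x - g' x) \<in> O[F](e)" "e \<in> O[F](\<lambda>_. 1)"
    "f' \<in> O[F](\<lambda>_. 1)" "g' \<in> O[F](\<lambda>_. 1)"
  shows "(\<lambda>x. f x * g x - f' x * g' x) \<in> O[F](e)"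
proof -
  have "f \<in> O[F](\<lambda>_. 1)" by (rule bigo_one_cong_diff[OF assms(1,3,4)])
  from landau_o.big.mult[OF this assms(2)] landau_o.big.mult[OF assms(5,1)]
  have "(\<lambda>x. f x * (g x - g' x) + g' x * (f x - f' x)) \<in> O[F](e)"
    by (intro sum_in_bigo) simp_all
  then show ?thesis by (simp add: algebra_simps)
qed

lemma bigo_diff_power:
  fixes f f' e :: "'x \<Rightarrow> real"
  assumes "(\<lambda>x. f x - f' x) \<in> O[F](e)" "e \<in> O[F](\<lambda>_. 1)" "f' \<in> O[F](\<lambda>_. 1)"
  shows "(\<lambda>x. f x ^ n - f' x ^ n) \<in> O[F](e)"
proof (induction n)
  case (Suc n)
  have "(\<lambda>x. f' x ^ n) \<in> O[F](\<lambda>_. 1)"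
    using landau_o.big_power[OF assms(3), of n] by simp
  then show ?case using bigo_diff_mult[OF assms(1) Suc assms(2,3)] by simp
qed simp

lemma bigo_diff_squeeze:
  fixes a b f g e :: "'x \<Rightarrow> real"
  assumes "(\<lambda>x. a x - g x) \<in> O[F](e)" "(\<lambda>x. b x - g x) \<in> O[F](e)"
    "\<forall>\<^sub>F x in F. a x \<le> f x" "\<forall>\<^sub>F x in F. f x \<le> b x"
  shows "(\<lambda>x. f x - g x) \<in> O[F](e)"
proof -
  have "(\<lambda>x. \<bar>a x - g x\<bar> + \<bar>b x - g x\<bar>) \<in> O[F](e)"
    using assms(1,2) by (intro sum_in_bigo) simp_all
  moreover have "\<forall>\<^sub>F x in F. norm (f x - g x) \<le> norm (\<bar>a x - g x\<bar> + \<bar>b x - g x\<bar>)"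
    using assms(3,4) by eventually_elim (auto simp: abs_le_iff)
  then have "(\<lambda>x. f x - g x) \<in> O[F](\<lambda>x. \<bar>a x - g x\<bar> + \<bar>b x - g x\<bar>)"
    by (rule landau_o.big_mono)
  ultimately show ?thesis by (blast intro: landau_o.big_trans)
qed

lemma bigo_diff_add_small:
  fixes f g h e :: "'x \<Rightarrow> real"
  assumes "(\<lambda>x. f x - g x) \<in> O[F](e)" "h \<in> O[F](e)"
  shows "(\<lambda>x. (f x + h x) - g x) \<in> O[F](e)"
  using sum_in_bigo(1)[OF assms] by (simp only: diff_add_eq)

lemma bigo_mult_const:
  fixes f e :: "'x \<Rightarrow> real"
  shows "f \<in> O[F](e) \<Longrightarrow> (\<lambda>x. f x * c) \<in> O[F](e)"
  by (cases "c = 0") simp_all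

section \<open>Families of moduli with totient of order N / ln N\<close>

text \<open>An estimate uniform in \<open>q\<close> becomes a single Landau statement along a filter
  on an index type, later the type of pairs \<open>(N, q)\<close>. The last condition covers both
  block lengths \<open>N div q\<close> and \<open>N div q + 1\<close>.\<close>

locale modulus_family =
  fixes F :: "'x filter" and N q M :: "'x \<Rightarrow> nat" and c1 c2 :: real
  assumes N_at_top: "filterlim N at_top F"
    and c_pos: "c1 > 0" "c2 > 0"
    and q_pos: "\<forall>\<^sub>F x in F. q x \<ge> 1"
    and totient_lower: "\<forall>\<^sub>F x in F. c1 * (real (N x) / ln (real (N x))) \<le> real (totient (q x))"
    and totient_upper: "\<forall>\<^sub>F x in F. real (totient (q x)) \<le> c2 * (real (N x) / ln (real (N x)))"
    and block_length: "\<forall>\<^sub>F x in F. \<bar>real (M x * q x) - real (N x)\<bar> \<le> real (q x)"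
begin

abbreviation L :: "'x \<Rightarrow> real" where "L x \<equiv> ln (real (N x))"
abbreviation tot :: "'x \<Rightarrow> real" where "tot x \<equiv> real (totient (q x))"

definition err :: "'x \<Rightarrow> real" where "err x = ln (L x) / L x"

lemma eventually_N: "eventually P sequentially \<Longrightarrow> \<forall>\<^sub>F x in F. P (N x)"
  by (rule eventually_compose_filterlim[OF _ N_at_top])

lemma bigo_N: "f \<in> O(g) \<Longrightarrow> (\<lambda>x. f (N x)) \<in> O[F](\<lambda>x. g (N x))"
  using N_at_top by (rule landau_o.big.compose[rotated])

text \<open>The factor \<open>exp 11\<close> is the one in the bound for \<open>q\<close> by its
  totient; the 2 comes from estimating \<open>ln q + 5\<close> by the square of
  \<open>ln N\<close>.\<close>

definition K0 :: real where "K0 = 2 * exp 11"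

lemma K0_pos: "K0 > 0" unfolding K0_def by simp

text \<open>All elementary size relations at once. Only the totient of \<open>q\<close> is
  controlled by assumption, while the bound for \<open>q\<close> in terms of it involves
  \<open>ln (ln q)\<close>; a crude bound for \<open>q\<close> has to come before the sharp
  one.\<close>

lemma eventually_size:
  "\<forall>\<^sub>F x in F. N x \<ge> 3 \<and> L x \<ge> 1 \<and> ln (L x) \<ge> 1 \<and> q x \<ge> 1 \<and>
    c1 * (N x / L x) \<le> tot x \<and> tot x \<le> c2 * (N x / L x) \<and> real (q x) \<le> K0 * ln (L x) * tot x \<and>
    ln (q x) \<le> 2 * L x \<and> real (q x) \<le> N x / 2 \<and> real (N x) / 2 \<le> real (M x) * real (q x) \<and>
    real (M x) * real (q x) \<le> 2 * N x \<and>
    real (M x) \<le> 2 / c1 * L x \<and> sqrt (L x) \<le> M x \<and> \<bar>real (M x * q x) - real (N x)\<bar> \<le> real (q x)"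
proof -
  have e1: "\<forall>\<^sub>F n in sequentially. 3 \<le> n"
    and e2: "\<forall>\<^sub>F n in sequentially. 1 \<le> ln (real n)"
    and e3: "\<forall>\<^sub>F n in sequentially. 1 \<le> ln (ln (real n))"
    and e5: "\<forall>\<^sub>F n in sequentially. 2 * ln (real n) + 5 \<le> ln (real n) ^ 2"
    by real_asymp+
  have e4: "\<forall>\<^sub>F n in sequentially. 4 * exp 11 * c2 \<le> ln (real n)"
    by real_asymp
  have "0 < K0 * c2" using K0_pos c_pos by simp
  have e6: "\<forall>\<^sub>F n in sequentially. 2 * (K0 * c2) * ln (ln (real n)) \<le> ln (real n)"
    using \<open>0 < K0 * c2\<close> by real_asymp
  have e7: "\<forall>\<^sub>F n in sequentially. 2 * (K0 * c2) * (ln (ln (real n)) * sqrt (ln (real n))) \<le> ln (real n)"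
    using \<open>0 < K0 * c2\<close> by real_asymp
  show ?thesis
    using eventually_N[OF e1] eventually_N[OF e2] eventually_N[OF e3] eventually_N[OF e4]
      eventually_N[OF e5] eventually_N[OF e6] eventually_N[OF e7] q_pos totient_lower totient_upper block_length
  proof eventually_elim
    case (elim x)
    define l where "l = L x"
    have l: "l \<ge> 1" "ln l \<ge> 1" "l > 0" using elim(2,3) by (auto simp: l_def)
    have N: "real (N x) > 0" using elim(1) by simp
    have q: "real (q x) \<ge> 1" using elim(8) by simp
    \<comment> \<open>Crude bound: as \<open>ln (ln q + 5) \<le> 4 * s\<close>, one factor
      \<open>s\<close> cancels from \<open>s * s \<le> exp 11 * (4 * s) * tot x\<close>, and
      \<open>s \<le> N\<close> follows. So \<open>ln q \<le> 2 * l\<close>, which then makes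
      \<open>ln (ln q + 5) \<le> 2 * ln l\<close>.\<close>
    define s where "s = sqrt (real (q x))"
    have s: "s \<ge> 1" "s * s = q x" using q by (auto simp: s_def)
    have "ln (s * s) = ln s + ln s" using s(1) by (simp add: ln_mult)
    then have lns: "ln (real (q x)) = 2 * ln s" unfolding s(2) by simp
    also have "\<dots> \<le> 2 * (s - 1)" using s ln_le_minus_one[of s] by simp
    finally have lnq: "ln (real (q x)) \<le> 2 * s - 2" by simp
    have "ln (ln (real (q x)) + 5) \<le> ln (real (q x)) + 5 - 1"
      using q by (intro ln_le_minus_one) (simp add: add_nonneg_pos)
    then have "ln (ln (real (q x)) + 5) \<le> 4 * s" using lnq s by simp
    then have "exp 11 * ln (ln (real (q x)) + 5) * tot x \<le> exp 11 * (4 * s) * tot x"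
      by (intro mult_right_mono mult_left_mono) auto
    then have "s * s \<le> exp 11 * (4 * s) * tot x"
      using modulus_le_totient[OF elim(8)] s(2) by linarith
    also have "exp 11 * (4 * s) * tot x = (4 * exp 11 * tot x) * s" by simp
    finally have "s \<le> 4 * exp 11 * tot x" by (rule mult_right_le_imp_le) (use s in simp)
    also have "\<dots> \<le> 4 * exp 11 * (c2 * (N x / l))"
      using elim(10) unfolding l_def by (intro mult_left_mono) auto
    also have "\<dots> = (4 * exp 11 * c2) * (N x / l)" by simp
    also have "\<dots> \<le> l * (N x / l)"
      using elim(4) l unfolding l_def by (intro mult_right_mono) auto
    finally have "s \<le> N x" using l by simp
    then have "2 * ln s \<le> 2 * l" using s unfolding l_def by simp
    then have lnq2: "ln (real (q x)) \<le> 2 * l" using lns by simp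
    have lnq0: "0 \<le> ln (real (q x))" using q by simp
    have "ln (ln (real (q x)) + 5) \<le> ln (l ^ 2)"
      using lnq2 lnq0 elim(5) unfolding l_def [symmetric] by (subst ln_le_cancel_iff) auto
    also have "\<dots> = 2 * ln l" using l by (simp add: ln_realpow)
    finally have "exp 11 * ln (ln (real (q x)) + 5) * tot x \<le> exp 11 * (2 * ln l) * tot x"
      by (intro mult_right_mono mult_left_mono) auto
    then have qK: "real (q x) \<le> K0 * ln l * tot x"
      using modulus_le_totient[OF elim(8)] by (simp add: K0_def mult_ac)
    also have "\<dots> \<le> K0 * ln l * (c2 * (N x / l))"
      using elim(10) K0_pos l unfolding l_def by (intro mult_left_mono mult_nonneg_nonneg) auto
    finally have qN: "real (q x) \<le> (K0 * c2) * ln l * N x / l" by (simp add: mult_ac)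
    have "2 * ((K0 * c2) * ln l * N x / l) = (2 * (K0 * c2) * ln l) * (N x / l)" by simp
    also have "\<dots> \<le> l * (N x / l)"
      using elim(6) l unfolding l_def by (intro mult_right_mono) auto
    finally have half: "real (q x) \<le> N x / 2" using qN l by simp
    have Mq: "real (N x) / 2 \<le> real (M x) * real (q x)" "real (M x) * real (q x) \<le> 2 * N x"
      using elim(11) half unfolding of_nat_mult by linarith+
    have "c1 * (N x / l) \<le> real (q x)"
      using elim(9) totient_le[of "q x"] unfolding l_def by linarith
    then have "real (M x) * (c1 * (N x / l)) \<le> real (M x) * real (q x)"
      by (intro mult_left_mono) auto
    then have "real (M x) * (c1 * (N x / l)) \<le> 2 * N x" using Mq by linarith
    then have "(real (M x) * c1 / l) * real (N x) \<le> 2 * real (N x)" by simp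
    then have "real (M x) * c1 / l \<le> 2" using N by (rule mult_right_le_imp_le)
    then have M: "real (M x) \<le> 2 / c1 * l" using c_pos l by (simp add: field_simps)
    \<comment> \<open>The block length is at least of order \<open>l / ln l\<close>; the weaker
      \<open>sqrt l\<close> is all that the sieve level below requires.\<close>
    have "sqrt l * real (q x) \<le> sqrt l * ((K0 * c2) * ln l * N x / l)"
      using qN l by (intro mult_left_mono) auto
    also have "\<dots> = (2 * (K0 * c2) * (ln l * sqrt l)) * (N x / l) / 2" by simp
    also have "\<dots> \<le> l * (N x / l) / 2"
      using elim(7) l unfolding l_def by (intro divide_right_mono mult_right_mono) auto
    also have "\<dots> = N x / 2" using l by simp
    finally have "sqrt l * real (q x) \<le> real (M x) * real (q x)" using Mq by linarith
    then have "sqrt l \<le> M x" using q by simp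
    then show ?case
      using elim qK lnq2 half Mq M unfolding l_def by blast
  qed
qed

text \<open>The summand \<open>2 / c1\<close> ensures \<open>M x \<le> z x\<close>, so that indices
  are distinct modulo primes from \<open>z x\<close> on. The summand 3 ensures
  \<open>ln q \<le> 2 * L x \<le> z x\<close> and \<open>z x \<ge> 3\<close>.\<close>

definition z :: "'x \<Rightarrow> nat" where "z x = nat \<lceil>(2 / c1 + 3) * L x\<rceil>"
definition sieve_primes :: "'x \<Rightarrow> nat set" where
  "sieve_primes x = {p. prime p \<and> p < z x \<and> \<not> p dvd q x}"
definition theta :: "'x \<Rightarrow> real" where "theta x = (\<Prod>p\<in>sieve_primes x. 1 - 1 / real p)"
definition lam :: "'x \<Rightarrow> real" where "lam x = M x * theta x"

lemma finite_sieve_primes: "finite (sieve_primes x)"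
  and prime_sieve_primes: "p \<in> sieve_primes x \<Longrightarrow> prime p"
  unfolding sieve_primes_def by auto

text \<open>The constant 192 is \<open>4 * 48\<close>, where 4 belongs to the sieve bound and 48 is
  the bound for \<open>ln (z x) / ln R\<close>. The number \<open>j\<close> enters only through the
  lower bound on \<open>z x\<close>.\<close>

lemma eventually_sieve:
  "\<forall>\<^sub>F x in F. M x \<le> z x \<and> 2 * Suc j \<le> z x \<and> theta x > 0 \<and> lam x > 0 \<and>
    1 / lam x \<le> 4 * exp 11 * c2 * err x \<and> 1 / real (z x) \<le> err x \<and>
    (\<forall>c\<in>residue_choices (sieve_primes x). real (card (sifted (sieve_primes x) (M x) c)) \<le> 192 * exp 7 * lam x)"
proof -
  define A where "A = 2 / c1 + 3"
  have A: "A > 0" "A \<ge> 3" using c_pos by (auto simp: A_def add_pos_pos)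
  have e1: "\<forall>\<^sub>F n in sequentially. 2 \<le> ln (real n) powr (1 / 12) - 1"
    and e2: "\<forall>\<^sub>F n in sequentially. ln (ln (real n)) / 24 \<le> ln (ln (real n) powr (1 / 12) - 1)"
    and e4: "\<forall>\<^sub>F n in sequentially. real (2 * Suc j) \<le> ln (real n)"
    and e5: "\<forall>\<^sub>F n in sequentially. ln (real n) powr (1 / 12) \<le> ln (real n)"
    by real_asymp+
  have e3: "\<forall>\<^sub>F n in sequentially. ln (A * ln (real n) + 1) \<le> 2 * ln (ln (real n))"
    using A(1) by real_asymp
  show ?thesis
    using eventually_N[OF e1] eventually_N[OF e2] eventually_N[OF e3] eventually_N[OF e4] eventually_N[OF e5] eventually_size
  proof eventually_elim
    case (elim x)
    define l where "l = L x"
    note size = elim(6)[folded l_def]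
    have l: "l \<ge> 1" "ln l \<ge> 1" using size by auto
    have Al: "A * l \<ge> 3 * l" using A l by (intro mult_right_mono) auto
    have "real (z x) = real_of_int \<lceil>A * l\<rceil>"
      unfolding z_def A_def [symmetric] l_def [symmetric] using Al l by simp
    then have zx: "A * l \<le> z x" "z x \<le> A * l + 1"
      using of_int_ceiling_le_add_one[of "A * l"] le_of_int_ceiling[of "A * l"] by linarith+
    have "2 / c1 * l \<le> A * l" using l unfolding A_def by (intro mult_right_mono) auto
    then have Mz: "M x \<le> z x" using size zx by linarith
    have z3: "z x \<ge> 3" using Al l zx by linarith
    have lnqz: "ln (real (q x)) \<le> z x" using Al l zx size by linarith
    have jz: "2 * Suc j \<le> z x" using elim(4) Al l zx unfolding l_def [symmetric] by linarith
    have "ln (real (z x)) \<le> ln (A * l + 1)" using zx z3 by (subst ln_le_cancel_iff) auto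
    then have lnz: "ln (real (z x)) \<le> 2 * ln l" using elim(3) unfolding l_def by linarith
    have lnz0: "ln (real (z x)) > 0" using z3 by simp
    have th0: "theta x \<ge> 0"
      unfolding theta_def
    proof (rule prod_nonneg)
      fix p assume "p \<in> sieve_primes x"
      then have "real p \<ge> 2" using prime_ge_2_nat[OF prime_sieve_primes] by simp
      then show "0 \<le> 1 - 1 / real p" by simp
    qed
    have N: "real (N x) > 0" using size by simp
    \<comment> \<open>Multiplied by \<open>M x\<close>, and with
      \<open>M x * q x \<ge> N x / 2\<close>, this turns into a lower bound for \<open>lam x\<close>
      in which no information about the factorization of \<open>q x\<close> remains.\<close>
    have "real (q x) \<le> exp 11 * ln (z x) * theta x * tot x"
      using modulus_le_sieve_product[OF z3 _ lnqz] size unfolding theta_def sieve_primes_def by simp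
    also have "\<dots> \<le> exp 11 * (2 * ln l) * theta x * (c2 * (N x / l))"
      using lnz lnz0 th0 size l by (intro mult_mono mult_left_mono mult_nonneg_nonneg) auto
    finally have "real (M x) * real (q x) \<le> real (M x) * (exp 11 * (2 * ln l) * theta x * (c2 * (N x / l)))"
      by (intro mult_left_mono) auto
    then have "real (N x) / 2 \<le> real (M x) * (exp 11 * (2 * ln l) * theta x * (c2 * (N x / l)))"
      using size by linarith
    also have "\<dots> = (lam x * (2 * exp 11 * c2 * err x)) * N x"
      unfolding lam_def err_def l_def by simp
    finally have "1 / 2 * real (N x) \<le> (lam x * (2 * exp 11 * c2 * err x)) * N x" by simp
    then have half: "1 / 2 \<le> lam x * (2 * exp 11 * c2 * err x)"
      using N by (rule mult_right_le_imp_le)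
    have "lam x \<noteq> 0" using half by auto
    moreover have "lam x \<ge> 0" unfolding lam_def using th0 by simp
    ultimately have lam: "lam x > 0" by simp
    then have "theta x \<noteq> 0" by (auto simp: lam_def)
    then have th: "theta x > 0" using th0 by simp
    have lam_le: "1 / lam x \<le> 4 * exp 11 * c2 * err x"
      using half lam by (simp add: divide_le_eq mult_ac)
    have "l \<le> real (z x)" using Al l zx by linarith
    then have "1 / real (z x) \<le> 1 / l" using l by (intro divide_left_mono mult_pos_pos) auto
    also have "\<dots> \<le> ln l / l" using l by (intro divide_right_mono) auto
    finally have zerr: "1 / real (z x) \<le> err x" unfolding err_def l_def .
    \<comment> \<open>The exponent is chosen so that
      \<open>R ^ 6 \<le> sqrt l \<le> M x\<close>.\<close>
    define R where "R = nat \<lfloor>l powr (1 / 12)\<rfloor>"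
    have "real R = real_of_int \<lfloor>l powr (1 / 12)\<rfloor>" unfolding R_def by simp
    then have R: "real R \<le> l powr (1 / 12)" "l powr (1 / 12) - 1 \<le> real R" by linarith+
    have R2: "R \<ge> 2" using R elim(1) unfolding l_def [symmetric] by linarith
    have Rz: "R < z x" using R elim(5) Al l zx unfolding l_def [symmetric] by linarith
    have "real R ^ 6 \<le> (l powr (1 / 12)) ^ 6" using R by (intro power_mono) auto
    also have "\<dots> = sqrt l" using l by (simp add: powr_power powr_half_sqrt)
    also have "\<dots> \<le> M x" using size by simp
    finally have R6: "R ^ 6 \<le> M x" by (simp only: of_nat_power [symmetric] of_nat_le_iff)
    have "ln l / 24 \<le> ln (real R)"
    proof -
      have "ln (l powr (1 / 12) - 1) \<le> ln (real R)"
        using R elim(1) unfolding l_def [symmetric] by (subst ln_le_cancel_iff) auto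
      then show ?thesis using elim(2) unfolding l_def [symmetric] by linarith
    qed
    \<comment> \<open>Since \<open>ln (z x) \<le> 2 * ln l\<close> and
      \<open>ln R \<ge> ln l / 24\<close>; the exponent \<open>1 / 12\<close> has been halved to
      absorb the rounding in \<open>R\<close>.\<close>
    then have "ln (real (z x)) \<le> 48 * ln (real R)" using lnz by linarith
    then have ratio: "ln (real (z x)) / ln (real R) \<le> 48" using R2 by (simp add: divide_le_eq)
    have "real (card (sifted (sieve_primes x) (M x) c)) \<le> 192 * exp 7 * lam x"
      if "c \<in> residue_choices (sieve_primes x)" for c
    proof -
      have "real (card (sifted (sieve_primes x) (M x) c)) \<le> 4 * exp 7 * (ln (z x) / ln R) * lam x"
        unfolding lam_def theta_def sieve_primes_def
        by (rule card_sifted_le[OF R6 R2 Rz z3]) (use that in \<open>simp add: sieve_primes_def\<close>)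
      also have "\<dots> \<le> 4 * exp 7 * 48 * lam x"
        using ratio lam by (intro mult_right_mono mult_left_mono) auto
      finally show ?thesis by simp
    qed
    then show ?case using Mz jz th lam lam_le zerr by blast
  qed
qed

lemma inverse_lam_bigo: "(\<lambda>x. 1 / lam x) \<in> O[F](err)"
proof (rule bigoI[of _ "4 * exp 11 * c2"])
  show "\<forall>\<^sub>F x in F. norm (1 / lam x) \<le> 4 * exp 11 * c2 * norm (err x)"
    using eventually_sieve[of 0]
  proof eventually_elim
    case (elim x)
    then have "0 \<le> err x" by (auto intro: order_trans[of 0 "1 / real (z x)"])
    then show ?case using elim by simp
  qed
qed

lemma inverse_z_bigo: "(\<lambda>x. 1 / real (z x)) \<in> O[F](err)"
proof (rule bigoI[of _ 1])
  show "\<forall>\<^sub>F x in F. norm (1 / real (z x)) \<le> 1 * norm (err x)"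
    using eventually_sieve[of 0]
  proof eventually_elim
    case (elim x)
    then have "1 / real (z x) \<le> err x" by blast
    then show ?case by simp
  qed
qed

lemma err_bounded: "err \<in> O[F](\<lambda>_. 1)"
proof -
  have "(\<lambda>n. ln (ln (real n)) / ln (real n)) \<in> O(\<lambda>_. 1)" by real_asymp
  from bigo_N[OF this] show ?thesis unfolding err_def .
qed

lemma err_bigo_N: "f \<in> O(\<lambda>n. ln (ln (real n)) / ln (real n)) \<Longrightarrow> (\<lambda>x. f (N x)) \<in> O[F](err)"
  using bigo_N[of f "\<lambda>n. ln (ln (real n)) / ln (real n)"] unfolding err_def .

definition u :: "'x \<Rightarrow> real" where "u x = N x / (tot x * L x)"
text \<open>The counterpart of \<open>u\<close> for a block of length \<open>M x\<close>: the
  quantity whose powers the singular series sums produce directly.\<close>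

definition v :: "'x \<Rightarrow> real" where "v x = (real (M x) * real (q x)) / (tot x * L x)"

lemma u_bounded: "u \<in> O[F](\<lambda>_. 1)"
proof (rule bigoI[of _ "1 / c1"])
  show "\<forall>\<^sub>F x in F. norm (u x) \<le> 1 / c1 * norm (1 :: real)"
    using eventually_size
  proof eventually_elim
    case (elim x)
    then have pos: "tot x > 0" "L x > 0" by auto
    have "c1 * N x \<le> tot x * L x" using elim pos by (simp add: field_simps)
    then have "N x / (tot x * L x) \<le> 1 / c1" using pos c_pos by (simp add: field_simps)
    then show ?case using pos by (simp add: u_def)
  qed
qed

text \<open>Blocks of full periods miss \<open>N\<close> by at most \<open>q\<close>, and
  \<open>q / (totient q * L)\<close> is at most \<open>K0 * ln L / L\<close>. This is the second
  source of the error term, again due to \<open>q\<close> with many small prime factors.\<close>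

lemma v_diff_u: "(\<lambda>x. v x - u x) \<in> O[F](err)"
proof (rule bigoI[of _ K0])
  show "\<forall>\<^sub>F x in F. norm (v x - u x) \<le> K0 * norm (err x)"
    using eventually_size
  proof eventually_elim
    case (elim x)
    then have pos: "tot x > 0" "L x > 0" by auto
    have "0 \<le> err x" using elim unfolding err_def by (intro divide_nonneg_nonneg) linarith+
    have "norm (v x - u x) = \<bar>real (M x) * real (q x) - N x\<bar> / (tot x * L x)"
      using pos by (simp add: v_def u_def diff_divide_distrib [symmetric] abs_divide abs_mult)
    also have "\<dots> \<le> (K0 * ln (L x) * tot x) / (tot x * L x)"
      using elim pos by (intro divide_right_mono) auto
    also have "\<dots> = K0 * err x" using pos by (simp add: err_def)
    finally show ?case using \<open>0 \<le> err x\<close> by simp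
  qed
qed

lemma v_power_diff_u: "(\<lambda>x. v x ^ n - u x ^ n) \<in> O[F](err)"
  by (rule bigo_diff_power[OF v_diff_u err_bounded u_bounded])

lemma u_power_bounded: "(\<lambda>x. u x ^ n) \<in> O[F](\<lambda>_. 1)"
  using landau_o.big_power[OF u_bounded, of n] by simp

abbreviation blocks :: "nat \<Rightarrow> 'x \<Rightarrow> nat set set" where
  "blocks j x \<equiv> {I. I \<subseteq> {..<M x} \<and> card I = j}"

definition series_sum :: "nat \<Rightarrow> 'x \<Rightarrow> real" where
  "series_sum j x = (\<Sum>I\<in>blocks j x. progression_series (q x) I)"

text \<open>The unknown \<open>theta\<close> disappears:
  \<open>(q / totient q) ^ j / theta ^ Suc j\<close> times the main term
  \<open>(M * theta) ^ Suc j\<close> of the moment, normalized by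
  \<open>q / (totient q * L ^ Suc j)\<close>, is exactly \<open>v ^ Suc j\<close>. What remains are
  the relative errors \<open>B / lam\<close> from the moment and \<open>C / z\<close> from the large
  primes.\<close>

lemma series_sum_asymp:
  "(\<lambda>x. fact (Suc j) * real (q x) * series_sum (Suc j) x / (tot x * L x ^ Suc j) - u x ^ Suc j) \<in> O[F](err)"
proof -
  define B :: real where "B = (Suc j) ^ 2 * (192 * exp 7) ^ j"
  define C :: real where "C = 2 * (Suc j) ^ 2"
  let ?Y = "\<lambda>x. fact (Suc j) * real (q x) * series_sum (Suc j) x / (tot x * L x ^ Suc j)"
  have ev: "\<forall>\<^sub>F x in F. v x ^ Suc j * (1 - B * (1 / lam x)) * (1 - C * (1 / z x)) \<le> ?Y x \<and>
      ?Y x \<le> v x ^ Suc j * (1 + B * (1 / lam x))"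
    using eventually_size eventually_sieve[of j] eventually_sieve[of "Suc j ^ 2"]
  proof eventually_elim
    case (elim x)
    note size = elim(1) and sieve = elim(2)
    have pos: "tot x > 0" "L x > 0" "theta x > 0" "lam x > 0" using size sieve by auto
    define V where "V I = (q x / tot x) ^ j * sieve_density (sieve_primes x) I / theta x ^ Suc j" for I
    define w where "w = q x / (tot x * L x ^ Suc j)"
    have w: "w \<ge> 0" using pos by (simp add: w_def)
    have V: "V I \<ge> 0" "progression_series (q x) I \<le> V I"
      "V I * (1 - C * (1 / z x)) \<le> progression_series (q x) I" if "I \<in> blocks (Suc j) x" for I
      using singular_series_bounds[of "q x" I "M x" j "z x"] that size sieve
      unfolding V_def theta_def sieve_primes_def C_def by auto
    define E where "E = fact (Suc j) * residue_mean (sieve_primes x) (\<lambda>c. real (card (sifted (sieve_primes x) (M x) c) choose Suc j))"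
    have K1: "1 \<le> 192 * exp (7 :: real)" using exp_ge_add_one_self[of "7 :: real"] by linarith
    have "\<bar>E - lam x ^ Suc j\<bar> \<le> (Suc j) ^ 2 * (192 * exp 7) ^ j * lam x ^ j"
      unfolding E_def lam_def theta_def
      by (rule factorial_moment_sifted)
         (use finite_sieve_primes prime_sieve_primes pos sieve K1 in \<open>simp_all add: lam_def theta_def\<close>)
    then have E: "\<bar>E - lam x ^ Suc j\<bar> \<le> lam x ^ Suc j * (B * (1 / lam x))"
      using pos by (simp add: B_def mult_ac)
    have "(\<Sum>I\<in>blocks (Suc j) x. V I) =
        (q x / tot x) ^ j / theta x ^ Suc j * (\<Sum>I\<in>blocks (Suc j) x. sieve_density (sieve_primes x) I)"
      unfolding V_def sum_distrib_left by (intro sum.cong refl) simp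
    moreover have "E = fact (Suc j) * (\<Sum>I\<in>blocks (Suc j) x. sieve_density (sieve_primes x) I)"
      unfolding E_def by (subst residue_mean_choose) (use finite_sieve_primes prime_sieve_primes in auto)
    ultimately have sumV: "fact (Suc j) * (\<Sum>I\<in>blocks (Suc j) x. V I) = (q x / tot x) ^ j / theta x ^ Suc j * E"
      by (simp only: mult.left_commute)
    have scale: "w * ((q x / tot x) ^ j / theta x ^ Suc j) * lam x ^ Suc j = v x ^ Suc j"
      unfolding w_def v_def lam_def using pos by (simp add: power_mult_distrib power_divide mult_ac)
    have scale0: "w * ((q x / tot x) ^ j / theta x ^ Suc j) \<ge> 0" using w pos by simp
    have YV: "?Y x = w * (fact (Suc j) * series_sum (Suc j) x)"
      unfolding w_def by (simp only: times_divide_eq_left times_divide_eq_right mult_ac)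
    have up: "w * (fact (Suc j) * (\<Sum>I\<in>blocks (Suc j) x. V I)) \<le> v x ^ Suc j * (1 + B * (1 / lam x))"
    proof -
      have "w * ((q x / tot x) ^ j / theta x ^ Suc j) * E \<le>
          w * ((q x / tot x) ^ j / theta x ^ Suc j) * (lam x ^ Suc j * (1 + B * (1 / lam x)))"
        using E by (intro mult_left_mono scale0) (simp add: distrib_left abs_le_iff)
      then show ?thesis unfolding sumV scale [symmetric] by (simp only: mult.assoc)
    qed
    have low: "v x ^ Suc j * (1 - B * (1 / lam x)) \<le> w * (fact (Suc j) * (\<Sum>I\<in>blocks (Suc j) x. V I))"
    proof -
      have "w * ((q x / tot x) ^ j / theta x ^ Suc j) * (lam x ^ Suc j * (1 - B * (1 / lam x))) \<le>
          w * ((q x / tot x) ^ j / theta x ^ Suc j) * E"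
        using E by (intro mult_left_mono scale0) (simp add: right_diff_distrib abs_le_iff)
      then show ?thesis unfolding sumV scale [symmetric] by (simp only: mult.assoc)
    qed
    have "series_sum (Suc j) x \<le> (\<Sum>I\<in>blocks (Suc j) x. V I)"
      unfolding series_sum_def by (intro sum_mono V)
    then have 1: "?Y x \<le> w * (fact (Suc j) * (\<Sum>I\<in>blocks (Suc j) x. V I))"
      unfolding YV using w by (intro mult_left_mono) auto
    have "(\<Sum>I\<in>blocks (Suc j) x. V I) * (1 - C * (1 / z x)) \<le> series_sum (Suc j) x"
      unfolding series_sum_def sum_distrib_right by (intro sum_mono V)
    then have 2: "w * (fact (Suc j) * ((\<Sum>I\<in>blocks (Suc j) x. V I) * (1 - C * (1 / z x)))) \<le> ?Y x"
      unfolding YV using w by (intro mult_left_mono) auto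
    \<comment> \<open>The instance of \<open>eventually_sieve\<close> at \<open>Suc j ^ 2\<close>
      supplies \<open>C \<le> z x\<close>; the factor \<open>1 - C * (1 / z x)\<close> must be
      nonnegative for the lower bounds to be multiplied.\<close>
    have "real (2 * (Suc j) ^ 2) \<le> real (z x)" using elim(3) by (simp only: of_nat_le_iff) simp
    then have "C \<le> z x" by (simp add: C_def)
    moreover have "real (z x) > 0" using sieve by simp
    ultimately have "0 \<le> 1 - C * (1 / z x)" by simp
    then have 3: "v x ^ Suc j * (1 - B * (1 / lam x)) * (1 - C * (1 / z x)) \<le>
        w * (fact (Suc j) * (\<Sum>I\<in>blocks (Suc j) x. V I)) * (1 - C * (1 / z x))"
      by (intro mult_right_mono low)
    show ?case
    proof
      show "?Y x \<le> v x ^ Suc j * (1 + B * (1 / lam x))" using 1 up by (rule order_trans)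
      show "v x ^ Suc j * (1 - B * (1 / lam x)) * (1 - C * (1 / z x)) \<le> ?Y x"
        using 3 2 unfolding mult.assoc by (rule order_trans)
    qed
  qed
  have cmult: "(\<lambda>x. b * f x) \<in> O[F](err)" if "f \<in> O[F](err)" for b and f :: "'x \<Rightarrow> real"
    using that by (cases "b = 0") simp_all
  have lam: "(\<lambda>x. 1 + b * (1 / lam x) - 1) \<in> O[F](err)" for b
    using cmult[OF inverse_lam_bigo, of b] by (simp only: add_diff_cancel_left')
  have z: "(\<lambda>x. 1 - b * (1 / z x) - 1) \<in> O[F](err)" for b
    using cmult[OF inverse_z_bigo, of b] by simp
  have up: "(\<lambda>x. v x ^ Suc j * (1 + B * (1 / lam x)) - u x ^ Suc j * 1) \<in> O[F](err)"
    by (intro bigo_diff_mult v_power_diff_u lam err_bounded u_power_bounded) simp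
  have "(\<lambda>x. v x ^ Suc j * (1 + (- B) * (1 / lam x)) - u x ^ Suc j * 1) \<in> O[F](err)"
    by (intro bigo_diff_mult v_power_diff_u lam err_bounded u_power_bounded) simp
  from bigo_diff_mult[OF this z[of C] err_bounded]
  have low: "(\<lambda>x. v x ^ Suc j * (1 - B * (1 / lam x)) * (1 - C * (1 / z x)) - u x ^ Suc j) \<in> O[F](err)"
    using u_power_bounded[of "Suc j"] by simp
  show ?thesis
  proof (rule bigo_diff_squeeze[OF low])
    show "(\<lambda>x. v x ^ Suc j * (1 + B * (1 / lam x)) - u x ^ Suc j) \<in> O[F](err)"
      using up by (simp only: mult_1_right)
    show "\<forall>\<^sub>F x in F. v x ^ Suc j * (1 - B * (1 / lam x)) * (1 - C * (1 / z x)) \<le> ?Y x"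
      by (rule eventually_mono[OF ev]) (rule conjunct1)
    show "\<forall>\<^sub>F x in F. ?Y x \<le> v x ^ Suc j * (1 + B * (1 / lam x))"
      by (rule eventually_mono[OF ev]) (rule conjunct2)
  qed
qed

lemma card_blocks_le:
  "\<forall>\<^sub>F x in F. real (card (blocks j x)) \<le> (2 / c1) ^ j * L x ^ j"
  using eventually_size
proof eventually_elim
  case (elim x)
  have "real (card (blocks j x)) = real (M x choose j)" by (simp add: n_subsets)
  also have "\<dots> \<le> real (M x ^ j)"
  proof -
    have "(M x choose j) * 1 \<le> (M x choose j) * fact j" by (intro mult_le_mono2) simp
    also have "\<dots> \<le> M x ^ j" by (rule binomial_fact_pow)
    finally show ?thesis by (simp only: of_nat_le_iff)
  qed
  also have "\<dots> \<le> (2 / c1 * L x) ^ j" using elim by (simp add: power_mono)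
  finally show ?case by (simp only: power_mult_distrib)
qed

text \<open>An error \<open>g N\<close> made for each \<open>I\<close> is multiplied by at most a
  constant times \<open>L ^ j\<close> choices of \<open>I\<close> and divided by a totient of order
  \<open>N / L\<close>. All errors per tuple are disposed of by this criterion.\<close>

lemma blocks_error_bigo:
  fixes g :: "nat \<Rightarrow> real"
  assumes "(\<lambda>n. ln (real n) ^ Suc j / real n * g n) \<in> O(\<lambda>n. ln (ln (real n)) / ln (real n))"
  shows "(\<lambda>x. card (blocks j x) * g (N x) / tot x) \<in> O[F](err)"
proof -
  have "(\<lambda>x. card (blocks j x) * g (N x) / tot x) \<in> O[F](\<lambda>x. L x ^ Suc j / real (N x) * g (N x))"
  proof (rule bigoI[of _ "(2 / c1) ^ j / c1"])
    show "\<forall>\<^sub>F x in F. norm (card (blocks j x) * g (N x) / tot x) \<le>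
        (2 / c1) ^ j / c1 * norm (L x ^ Suc j / real (N x) * g (N x))"
      using card_blocks_le[of j] eventually_size
    proof eventually_elim
      case (elim x)
      then have pos: "tot x > 0" "L x > 0" "real (N x) > 0" by auto
      have "1 / tot x \<le> 1 / (c1 * (N x / L x))"
        using elim pos c_pos by (intro divide_left_mono mult_pos_pos divide_pos_pos) auto
      also have "\<dots> = 1 / c1 * (L x / N x)" by simp
      finally have "real (card (blocks j x)) * (1 / tot x) \<le> (2 / c1) ^ j * L x ^ j * (1 / c1 * (L x / N x))"
        using elim pos by (intro mult_mono) auto
      then have "real (card (blocks j x)) * (1 / tot x) * \<bar>g (N x)\<bar> \<le>
          (2 / c1) ^ j * L x ^ j * (1 / c1 * (L x / N x)) * \<bar>g (N x)\<bar>"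
        by (intro mult_right_mono) auto
      then show ?case using pos by (simp add: abs_mult mult_ac)
    qed
  qed
  also have "(\<lambda>x. L x ^ Suc j / real (N x) * g (N x)) \<in> O[F](err)"
    by (rule err_bigo_N) fact
  finally show ?thesis .
qed

definition correlation_sum :: "nat \<Rightarrow> 'x \<Rightarrow> real" where
  "correlation_sum j x = (\<Sum>I\<in>blocks j x. mangoldt_correlation (q x) I)"

lemma correlation_sum_asymp:
  fixes \<delta> C :: real
  assumes "0 < \<delta>" and HL: "\<And>q M N I. q \<ge> 2 \<Longrightarrow> N \<ge> 2 \<Longrightarrow> M * q + 1 \<le> N \<Longrightarrow> I \<subseteq> {..<M} \<Longrightarrow> card I = Suc j \<Longrightarrow>
      \<bar>mangoldt_correlation q I - progression_series q I * real (q - 1)\<bar>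
        \<le> C * real N powr (1 - \<delta>)"
  shows "(\<lambda>x. fact (Suc j) * correlation_sum (Suc j) x / (tot x * L x ^ Suc j) - u x ^ Suc j) \<in> O[F](err)"
proof -
  let ?Y = "\<lambda>x. fact (Suc j) * real (q x) * series_sum (Suc j) x / (tot x * L x ^ Suc j)"
  let ?W = "\<lambda>x. fact (Suc j) * correlation_sum (Suc j) x / (tot x * L x ^ Suc j)"
  define r where "r x = fact (Suc j) * (correlation_sum (Suc j) x - real (q x - 1) * series_sum (Suc j) x) /
    (tot x * L x ^ Suc j)" for x
  \<comment> \<open>The conjecture is used with \<open>2 * N + 1\<close> in place of
    \<open>N\<close>: \<open>M * q\<close> can exceed \<open>N\<close> but not \<open>2 * N\<close>,
    and the offset of the shifts adds 1.\<close>
  define g where "g n = real (2 * n + 1) powr (1 - \<delta>) / ln (real n) ^ Suc j" for n :: nat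
  have "(\<lambda>n. ln (real n) ^ Suc (Suc j) / real n * g n) \<in> O(\<lambda>n. ln (real n) * real (2 * n + 1) powr (1 - \<delta>) / real n)"
  proof (rule bigoI[of _ 1])
    have "\<forall>\<^sub>F n in sequentially. ln (real n) > 0" by real_asymp
    then show "\<forall>\<^sub>F n in sequentially. norm (ln (real n) ^ Suc (Suc j) / real n * g n) \<le>
        1 * norm (ln (real n) * real (2 * n + 1) powr (1 - \<delta>) / real n)"
      unfolding g_def by eventually_elim (simp add: abs_mult)
  qed
  also have "(\<lambda>n. ln (real n) * real (2 * n + 1) powr (1 - \<delta>) / real n) \<in> O(\<lambda>n. ln (ln (real n)) / ln (real n))"
    using assms(1) by real_asymp
  finally have small: "(\<lambda>x. card (blocks (Suc j) x) * g (N x) / tot x) \<in> O[F](err)"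
    by (rule blocks_error_bigo)
  have e1: "\<forall>\<^sub>F n in sequentially. 2 \<le> c1 * (real n / ln (real n))" using c_pos by real_asymp
  have "\<forall>\<^sub>F x in F. norm (r x) \<le> (fact (Suc j) * \<bar>C\<bar>) * norm (card (blocks (Suc j) x) * g (N x) / tot x)"
    using eventually_size eventually_N[OF e1]
  proof eventually_elim
    case (elim x)
    then have pos: "tot x > 0" "L x > 0" by auto
    have "2 \<le> tot x" using elim by linarith
    then have q2: "q x \<ge> 2" using totient_le[of "q x"] by linarith
    have "real (M x * q x) \<le> real (2 * N x)" using elim by simp
    then have "M x * q x \<le> 2 * N x" by (simp only: of_nat_le_iff)
    then have Mq: "M x * q x + 1 \<le> 2 * N x + 1" by simp
    have "\<bar>correlation_sum (Suc j) x - real (q x - 1) * series_sum (Suc j) x\<bar> =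
        \<bar>\<Sum>I\<in>blocks (Suc j) x. mangoldt_correlation (q x) I -
          progression_series (q x) I * real (q x - 1)\<bar>"
      unfolding correlation_sum_def series_sum_def sum_distrib_left sum_subtractf by (simp only: mult.commute)
    also have "\<dots> \<le> (\<Sum>I\<in>blocks (Suc j) x. C * real (2 * N x + 1) powr (1 - \<delta>))"
    proof (intro order_trans[OF sum_abs] sum_mono)
      fix I assume "I \<in> blocks (Suc j) x"
      then show "\<bar>mangoldt_correlation (q x) I -
          progression_series (q x) I * real (q x - 1)\<bar> \<le> C * real (2 * N x + 1) powr (1 - \<delta>)"
        using elim by (intro HL[OF q2 _ Mq]) auto
    qed
    also have "\<dots> \<le> real (card (blocks (Suc j) x)) * (\<bar>C\<bar> * real (2 * N x + 1) powr (1 - \<delta>))"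
      unfolding sum_constant by (intro mult_left_mono mult_right_mono) auto
    finally have "\<bar>correlation_sum (Suc j) x - real (q x - 1) * series_sum (Suc j) x\<bar> \<le>
        real (card (blocks (Suc j) x)) * (\<bar>C\<bar> * real (2 * N x + 1) powr (1 - \<delta>))" .
    then have "fact (Suc j) * \<bar>correlation_sum (Suc j) x - real (q x - 1) * series_sum (Suc j) x\<bar> / (tot x * L x ^ Suc j) \<le>
        fact (Suc j) * (real (card (blocks (Suc j) x)) * (\<bar>C\<bar> * real (2 * N x + 1) powr (1 - \<delta>))) / (tot x * L x ^ Suc j)"
      using pos by (intro divide_right_mono mult_left_mono) auto
    also have "\<dots> = (fact (Suc j) * \<bar>C\<bar>) * (card (blocks (Suc j) x) * g (N x) / tot x)"
      unfolding g_def by (simp only: times_divide_eq_left times_divide_eq_right divide_divide_eq_left mult_ac)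
    also have "\<dots> \<le> (fact (Suc j) * \<bar>C\<bar>) * norm (card (blocks (Suc j) x) * g (N x) / tot x)"
    proof (rule mult_left_mono)
      show "card (blocks (Suc j) x) * g (N x) / tot x \<le> norm (card (blocks (Suc j) x) * g (N x) / tot x)"
        by (simp only: real_norm_def abs_ge_self)
    qed simp
    finally show ?case
      unfolding r_def using pos
      by (simp del: fact_Suc power_Suc add: abs_mult abs_of_nonneg[OF fact_ge_zero])
  qed
  then have "r \<in> O[F](\<lambda>x. card (blocks (Suc j) x) * g (N x) / tot x)" by (rule bigoI)
  then have r: "r \<in> O[F](err)" using small by (rule landau_o.big_trans)
  \<comment> \<open>The conjecture counts \<open>q - 1\<close> values of \<open>n\<close>, while the
    singular series sum was normalized with \<open>q\<close>; the relative difference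
    \<open>1 / q\<close> is negligible.\<close>
  have "(\<lambda>x. 1 / real (q x)) \<in> O[F](\<lambda>x. L x / real (N x))"
  proof (rule bigoI[of _ "1 / c1"])
    show "\<forall>\<^sub>F x in F. norm (1 / real (q x)) \<le> 1 / c1 * norm (L x / real (N x))"
      using eventually_size
    proof eventually_elim
      case (elim x)
      then have pos: "tot x > 0" "L x > 0" "real (N x) > 0" by auto
      have "c1 * (N x / L x) \<le> real (q x)" using elim totient_le[of "q x"] by linarith
      then have "1 / real (q x) \<le> 1 / (c1 * (N x / L x))"
        using elim pos c_pos by (intro divide_left_mono mult_pos_pos divide_pos_pos) auto
      then show ?case using pos by simp
    qed
  qed
  also have "(\<lambda>x. L x / real (N x)) \<in> O[F](err)"
    by (rule err_bigo_N) real_asymp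
  finally have q: "(\<lambda>x. (1 - 1 / real (q x)) - 1) \<in> O[F](err)" by simp
  have "(\<lambda>x. ?Y x * (1 - 1 / real (q x)) - u x ^ Suc j * 1) \<in> O[F](err)"
    by (intro bigo_diff_mult series_sum_asymp q err_bounded u_power_bounded) simp
  from sum_in_bigo(1)[OF this r]
  have main: "(\<lambda>x. (?Y x * (1 - 1 / real (q x)) - u x ^ Suc j * 1) + r x) \<in> O[F](err)" .
  have "\<forall>\<^sub>F x in F. (?Y x * (1 - 1 / real (q x)) - u x ^ Suc j * 1) + r x = ?W x - u x ^ Suc j"
    using eventually_size
  proof eventually_elim
    case (elim x)
    then have q: "real (q x) > 0" "real (q x - 1) = real (q x) - 1" by (auto simp: of_nat_diff)
    have "?Y x * (1 - 1 / real (q x)) = fact (Suc j) * (real (q x) * (1 - 1 / real (q x)) * series_sum (Suc j) x) / (tot x * L x ^ Suc j)"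
      by (simp only: times_divide_eq_left times_divide_eq_right mult_ac)
    also have "real (q x) * (1 - 1 / real (q x)) = real (q x - 1)"
      using q by (simp add: right_diff_distrib)
    finally have Y: "?Y x * (1 - 1 / real (q x)) = fact (Suc j) * (real (q x - 1) * series_sum (Suc j) x) / (tot x * L x ^ Suc j)" .
    have "k * a / d - t * 1 + k * (w - a) / d = k * w / d - t" for k a d t w :: real
      by (simp add: right_diff_distrib diff_divide_distrib)
    then show ?case unfolding Y r_def .
  qed
  from landau_o.big.in_cong[OF this] main show ?thesis by simp
qed

text \<open>Mean number of ordered \<open>j\<close>-tuples of distinct primes in a block.\<close>

definition block_moment :: "nat \<Rightarrow> 'x \<Rightarrow> real" where
  "block_moment j x = fact j * (\<Sum>a\<in>totatives (q x). real (prime_count_block (q x) (M x) a choose j)) / tot x"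

text \<open>The primes below \<open>y = N / (ln N) ^ (j + 4)\<close> are negligible, and beyond \<open>y\<close> the weight \<open>ln p\<close> is
  \<open>ln N\<close> up to a factor \<open>1 + O(err)\<close>.\<close>

lemma block_moment_asymp:
  fixes \<delta> C :: real
  assumes "0 < \<delta>" and HL: "\<And>q M N I. q \<ge> 2 \<Longrightarrow> N \<ge> 2 \<Longrightarrow> M * q + 1 \<le> N \<Longrightarrow> I \<subseteq> {..<M} \<Longrightarrow> card I = Suc j \<Longrightarrow>
      \<bar>mangoldt_correlation q I - progression_series q I * real (q - 1)\<bar>
        \<le> C * real N powr (1 - \<delta>)"
  shows "(\<lambda>x. block_moment (Suc j) x - u x ^ Suc j) \<in> O[F](err)"
proof -
  let ?W = "\<lambda>x. fact (Suc j) * correlation_sum (Suc j) x / (tot x * L x ^ Suc j)"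
  have W: "(\<lambda>x. ?W x - u x ^ Suc j) \<in> O[F](err)"
    by (rule correlation_sum_asymp[OF assms])
  \<comment> \<open>With this exponent the loss \<open>ln N ^ (j + 2) / N * y N\<close> is
    \<open>1 / ln N ^ 2\<close>, well below the error term, while \<open>ln (y N)\<close>, called
    \<open>b N\<close> below, differs from \<open>ln N\<close> only by a multiple of
    \<open>ln (ln N)\<close>.\<close>
  define y where "y n = real n / ln (real n) ^ (j + 4)" for n :: nat
  define B where "B n = (sqrt (real (2 * n)) + 1) * (log 2 (real (2 * n)) + 1)" for n :: nat
  define T where "T x = (\<Sum>I\<in>blocks (Suc j) x. real (card (prime_totatives (q x) I)))" for x
  have T: "block_moment (Suc j) x = fact (Suc j) * T x / tot x" for x
    unfolding block_moment_def sum_choose_prime_count_block T_def ..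
  have "(\<lambda>n. ln (real n) ^ Suc (Suc j) / real n * y n) \<in> O(\<lambda>n. 1 / ln (real n) ^ 2)"
  proof (rule bigoI[of _ 1])
    have "\<forall>\<^sub>F n in sequentially. ln (real n) > 0" by real_asymp
    then show "\<forall>\<^sub>F n in sequentially. norm (ln (real n) ^ Suc (Suc j) / real n * y n) \<le> 1 * norm (1 / ln (real n) ^ 2)"
      unfolding y_def
    proof eventually_elim
      case (elim n)
      have "ln (real n) ^ (j + 4) = ln (real n) ^ Suc (Suc j) * ln (real n) ^ 2"
      proof -
        have "j + 4 = Suc (Suc j) + 2" by simp
        then show ?thesis by (simp only: power_add)
      qed
      then show ?case using elim by simp
    qed
  qed
  also have "(\<lambda>n. 1 / ln (real n) ^ 2) \<in> O(\<lambda>n. ln (ln (real n)) / ln (real n))" by real_asymp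
  finally have y_small: "(\<lambda>x. card (blocks (Suc j) x) * y (N x) / tot x) \<in> O[F](err)"
    by (rule blocks_error_bigo)
  have "(\<lambda>n. ln (real n) ^ Suc (Suc j) / real n * B n) \<in> O(\<lambda>n. ln (real n) powr (real (Suc (Suc j))) / real n * B n)"
  proof (rule bigoI[of _ 1])
    have "\<forall>\<^sub>F n in sequentially. ln (real n) > 0" by real_asymp
    then show "\<forall>\<^sub>F n in sequentially. norm (ln (real n) ^ Suc (Suc j) / real n * B n) \<le>
        1 * norm (ln (real n) powr (real (Suc (Suc j))) / real n * B n)"
    proof eventually_elim
      case (elim n)
      then have "ln (real n) powr (real (Suc (Suc j))) = ln (real n) ^ Suc (Suc j)" by (rule powr_realpow)
      then show ?case by (simp only: mult_1 order_refl)
    qed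
  qed
  also have "(\<lambda>n. ln (real n) powr (real (Suc (Suc j))) / real n * B n) \<in> O(\<lambda>n. ln (ln (real n)) / ln (real n))"
    unfolding B_def by real_asymp
  finally have B_small: "(\<lambda>x. card (blocks (Suc j) x) * B (N x) / tot x) \<in> O[F](err)"
    by (rule blocks_error_bigo)
  define b where "b n = ln (real n) - real (j + 4) * ln (ln (real n))" for n :: nat
  have "0 < real (j + 4)" by simp
  then have b_ratio: "(\<lambda>x. L x / b (N x) - 1) \<in> O[F](err)"
    unfolding b_def by (intro err_bigo_N) real_asymp
  \<comment> \<open>For the lower bound the weights are estimated by \<open>ln (2 * N)\<close>,
    because the terms \<open>a + i * q\<close> of a block reach at most
    \<open>M * q \<le> 2 * N\<close>.\<close>
  have h_ratio: "(\<lambda>x. L x / ln (real (2 * N x)) - 1) \<in> O[F](err)"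
    by (rule err_bigo_N) real_asymp
  have pow: "(\<lambda>x. f x ^ Suc j - 1) \<in> O[F](err)" if "(\<lambda>x. f x - 1) \<in> O[F](err)" for f
    using bigo_diff_power[OF that err_bounded, of "Suc j"] by simp
  have "(\<lambda>x. ?W x * (L x / b (N x)) ^ Suc j - u x ^ Suc j * 1) \<in> O[F](err)"
    by (intro bigo_diff_mult W pow b_ratio err_bounded u_power_bounded) simp
  then have upper: "(\<lambda>x. (?W x * (L x / b (N x)) ^ Suc j + card (blocks (Suc j) x) * y (N x) / tot x * fact (Suc j)) - u x ^ Suc j) \<in> O[F](err)"
    unfolding mult_1_right by (rule bigo_diff_add_small) (rule bigo_mult_const[OF y_small])
  have "(\<lambda>x. ?W x * (L x / ln (real (2 * N x))) ^ Suc j - u x ^ Suc j * 1) \<in> O[F](err)"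
    by (intro bigo_diff_mult W pow h_ratio err_bounded u_power_bounded) simp
  then have lower: "(\<lambda>x. (?W x * (L x / ln (real (2 * N x))) ^ Suc j + card (blocks (Suc j) x) * B (N x) / tot x * (- (fact (Suc j) * real (Suc j)))) - u x ^ Suc j) \<in> O[F](err)"
    unfolding mult_1_right by (rule bigo_diff_add_small) (rule bigo_mult_const[OF B_small])
  have scale: "fact (Suc j) * s / (tot x * L x ^ Suc j) * (L x / t) ^ Suc j = fact (Suc j) * (s / t ^ Suc j) / tot x"
    if "L x > 0" for s t x
    using that by (simp del: fact_Suc power_Suc add: power_divide)
  have "\<forall>\<^sub>F n in sequentially. 0 < b n" unfolding b_def using \<open>0 < real (j + 4)\<close> by real_asymp
  note ev_b = eventually_N[OF this]
  have up: "\<forall>\<^sub>F x in F. block_moment (Suc j) x \<le>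
      ?W x * (L x / b (N x)) ^ Suc j + card (blocks (Suc j) x) * y (N x) / tot x * fact (Suc j)"
    using eventually_size ev_b
  proof eventually_elim
    case (elim x)
    then have pos: "tot x > 0" "L x > 0" "real (N x) > 0" "b (N x) > 0" by auto
    have y0: "y (N x) > 0" unfolding y_def using pos by simp
    have lny: "ln (y (N x)) = b (N x)"
      unfolding y_def b_def using pos by (simp add: ln_div ln_realpow)
    then have "ln (y (N x)) > 0" using pos by simp
    then have y1: "y (N x) \<ge> 1" using y0 by (simp add: ln_gt_zero_iff)
    have "(T x - card (blocks (Suc j) x) * y (N x)) * b (N x) ^ Suc j =
        (\<Sum>I\<in>blocks (Suc j) x. (real (card (prime_totatives (q x) I)) - y (N x)) * ln (y (N x)) ^ Suc j)"
      unfolding T_def lny by (simp only: sum_distrib_right [symmetric] sum_subtractf sum_constant)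
    also have "\<dots> \<le> correlation_sum (Suc j) x"
      unfolding correlation_sum_def
    proof (rule sum_mono)
      fix I assume I: "I \<in> blocks (Suc j) x"
      then have "finite I" by (auto intro: finite_subset)
      from card_prime_totatives_le[OF y1 this, of "q x"] I
      show "(real (card (prime_totatives (q x) I)) - y (N x)) * ln (y (N x)) ^ Suc j \<le> mangoldt_correlation (q x) I"
        by simp
    qed
    finally have "T x - card (blocks (Suc j) x) * y (N x) \<le> correlation_sum (Suc j) x / b (N x) ^ Suc j"
      using pos by (subst pos_le_divide_eq) (simp_all del: power_Suc)
    then have "T x \<le> correlation_sum (Suc j) x / b (N x) ^ Suc j + card (blocks (Suc j) x) * y (N x)" by linarith
    then have "fact (Suc j) * T x / tot x \<le>
        fact (Suc j) * (correlation_sum (Suc j) x / b (N x) ^ Suc j + card (blocks (Suc j) x) * y (N x)) / tot x"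
      using pos by (intro divide_right_mono mult_left_mono) auto
    moreover have "k * (a + n * t) / d = k * a / d + n * t / d * k" for k a n t d :: real
      by (simp add: distrib_left add_divide_distrib)
    ultimately show ?case unfolding T scale[OF pos(2)] by (simp only:)
  qed
  have low: "\<forall>\<^sub>F x in F. ?W x * (L x / ln (real (2 * N x))) ^ Suc j +
      card (blocks (Suc j) x) * B (N x) / tot x * (- (fact (Suc j) * real (Suc j))) \<le> block_moment (Suc j) x"
    using eventually_size
  proof eventually_elim
    case (elim x)
    then have pos: "tot x > 0" "L x > 0" "real (N x) > 0" by auto
    let ?h = "ln (real (2 * N x))"
    have h: "?h > 0" using elim by simp
    have q: "1 \<le> q x" "q x \<le> 2 * N x" "3 \<le> 2 * N x" using elim by auto
    have "real (M x * q x) \<le> real (2 * N x)" using elim by simp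
    then have Mq: "M x * q x \<le> 2 * N x" by (simp only: of_nat_le_iff)
    have exc: "real (card (exceptional_numbers (q x) (2 * N x))) \<le> B (N x)"
      unfolding B_def by (rule card_exceptional_numbers_le) (use q in auto)
    have "correlation_sum (Suc j) x \<le>
        (\<Sum>I\<in>blocks (Suc j) x. ?h ^ Suc j * (real (card (prime_totatives (q x) I)) + real (Suc j) * B (N x)))"
      unfolding correlation_sum_def
    proof (rule sum_mono)
      fix I assume I: "I \<in> blocks (Suc j) x"
      then have I': "I \<subseteq> {..<M x}" "card I = Suc j" "I \<noteq> {}" by auto
      have "mangoldt_correlation (q x) I \<le> ?h ^ Suc j * (real (card (prime_totatives (q x) I)) +
          real (Suc j) * real (card (exceptional_numbers (q x) (2 * N x))))"
        using mangoldt_correlation_le[OF q(1) Mq I'(1,3) q(3)] unfolding I'(2) .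
      also have "\<dots> \<le> ?h ^ Suc j * (real (card (prime_totatives (q x) I)) + real (Suc j) * B (N x))"
        using h exc by (intro mult_left_mono add_left_mono zero_le_power) auto
      finally show "mangoldt_correlation (q x) I \<le>
          ?h ^ Suc j * (real (card (prime_totatives (q x) I)) + real (Suc j) * B (N x))" .
    qed
    also have "\<dots> = (T x + card (blocks (Suc j) x) * (real (Suc j) * B (N x))) * ?h ^ Suc j"
      unfolding sum_distrib_left [symmetric] T_def sum.distrib sum_constant by (simp only: mult_ac)
    finally have "correlation_sum (Suc j) x / ?h ^ Suc j \<le> T x + card (blocks (Suc j) x) * (real (Suc j) * B (N x))"
      using h by (subst pos_divide_le_eq) (simp_all del: power_Suc)
    then have "correlation_sum (Suc j) x / ?h ^ Suc j - card (blocks (Suc j) x) * (real (Suc j) * B (N x)) \<le> T x" by linarith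
    then have "fact (Suc j) * (correlation_sum (Suc j) x / ?h ^ Suc j - card (blocks (Suc j) x) * (real (Suc j) * B (N x))) / tot x \<le>
        fact (Suc j) * T x / tot x"
      using pos by (intro divide_right_mono mult_left_mono) auto
    moreover have "k * (a - n * (m * t)) / d = k * a / d + n * t / d * (- (k * m))" for k a n m t d :: real
      by (simp add: right_diff_distrib diff_divide_distrib)
    ultimately show ?case unfolding T scale[OF pos(2)] by (simp only:)
  qed
  show ?thesis by (rule bigo_diff_squeeze[OF lower upper low up])
qed

definition block_power_mean :: "nat \<Rightarrow> 'x \<Rightarrow> real" where
  "block_power_mean k x = (\<Sum>a\<in>totatives (q x). real (prime_count_block (q x) (M x) a) ^ k) / tot x"

lemma block_power_mean_asymp:
  assumes "uniform_hardy_littlewood" "k \<ge> 1"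
  shows "(\<lambda>x. block_power_mean k x - (\<Sum>j=1..k. real (Stirling k j) * u x ^ j)) \<in> O[F](err)"
proof -
  obtain \<delta> :: real and C :: "nat \<Rightarrow> real" where d: "0 < \<delta>" "\<delta> < 1 / 2" and
    HL: "\<And>q M N I. q \<ge> 2 \<Longrightarrow> N \<ge> 2 \<Longrightarrow> M * q + 1 \<le> N \<Longrightarrow> I \<subseteq> {..<M} \<Longrightarrow> I \<noteq> {} \<Longrightarrow>
      \<bar>mangoldt_correlation q I - progression_series q I * real (q - 1)\<bar>
        \<le> C (card I) * real N powr (1 - \<delta>)"
    using hardy_littlewood_progression[OF assms(1)] by metis
  have moment: "(\<lambda>x. block_moment j x - u x ^ j) \<in> O[F](err)" if jk: "j \<in> {1..k}" for j
  proof -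
    obtain i where i: "j = Suc i" using jk by (cases j) auto
    show ?thesis unfolding i
    proof (rule block_moment_asymp[OF d(1), of _ "C (Suc i)"])
      fix q M N :: nat and I :: "nat set"
      assume *: "q \<ge> 2" "N \<ge> 2" "M * q + 1 \<le> N" "I \<subseteq> {..<M}" "card I = Suc i"
      then have "I \<noteq> {}" by auto
      from HL[OF *(1-4) this] *(5)
      show "\<bar>mangoldt_correlation q I - progression_series q I * real (q - 1)\<bar>
        \<le> C (Suc i) * real N powr (1 - \<delta>)" by simp
    qed
  qed
  have mean: "block_power_mean k x = (\<Sum>j=1..k. real (Stirling k j) * block_moment j x)" for x
  proof -
    have "(\<Sum>a\<in>totatives (q x). real (prime_count_block (q x) (M x) a) ^ k) =
        (\<Sum>j=1..k. \<Sum>a\<in>totatives (q x). real (Stirling k j) * (fact j * real (prime_count_block (q x) (M x) a choose j)))"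
      unfolding power_eq_sum_Stirling[OF assms(2)] by (rule sum.swap)
    then show ?thesis
      unfolding block_power_mean_def block_moment_def
      by (simp only: sum_distrib_left [symmetric] sum_divide_distrib times_divide_eq_right)
  qed
  have "(\<lambda>x. block_power_mean k x - (\<Sum>j=1..k. real (Stirling k j) * u x ^ j)) =
      (\<lambda>x. \<Sum>j=1..k. (block_moment j x - u x ^ j) * real (Stirling k j))"
    unfolding mean sum_subtractf [symmetric] by (intro ext sum.cong refl) (simp add: algebra_simps)
  also have "\<dots> \<in> O[F](err)"
    by (intro big_sum_in_bigo bigo_mult_const moment)
  finally show ?thesis .
qed

end

text \<open>Here the filter statement is translated back: one constant and one threshold for
  \<open>N\<close> that serve all admissible \<open>q\<close>.\<close>

lemma moment_of_primes_in_classes: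
  fixes c\<^sub>1 c\<^sub>2 :: real
  assumes "uniform_hardy_littlewood" "k \<ge> 1" "0 < c\<^sub>1" "c\<^sub>1 \<le> c\<^sub>2"
    and M: "\<And>N q. q \<ge> 1 \<Longrightarrow> \<bar>real (M N q * q) - real N\<bar> \<le> real q"
  obtains C where "\<forall>\<^sub>F N in sequentially. \<forall>q\<ge>1.
     c\<^sub>1 * (real N / ln (real N)) \<le> real (totient q) \<longrightarrow> real (totient q) \<le> c\<^sub>2 * (real N / ln (real N)) \<longrightarrow>
     \<bar>(\<Sum>a\<in>totatives q. real (prime_count_block q (M N q) a) ^ k) / real (totient q) -
       (\<Sum>j=1..k. real (Stirling k j) * (real N / (real (totient q) * ln (real N))) ^ j)\<bar>
     \<le> C * (ln (ln (real N)) / ln (real N))"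
proof -
  define A where "A = {(N :: nat, q :: nat). q \<ge> 1 \<and> c\<^sub>1 * (real N / ln (real N)) \<le> real (totient q) \<and>
    real (totient q) \<le> c\<^sub>2 * (real N / ln (real N))}"
  \<comment> \<open>Along this filter \<open>N\<close> tends to infinity with no condition on
    \<open>q\<close> beyond \<open>(N, q) \<in> A\<close>, so an eventual property holds for all
    admissible \<open>q\<close> from some \<open>N\<close> on.\<close>
  define F where "F = inf (filtercomap fst sequentially) (principal A)"
  have evF: "eventually P F \<longleftrightarrow> (\<forall>\<^sub>F N in sequentially. \<forall>q. (N, q) \<in> A \<longrightarrow> P (N, q))" for P
    unfolding F_def eventually_inf_principal eventually_filtercomap
    by (auto elim!: eventually_mono)
  have evA: "\<forall>\<^sub>F x in F. x \<in> A" unfolding evF by simp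
  interpret modulus_family F fst snd "\<lambda>(N, q). M N q" c\<^sub>1 c\<^sub>2
  proof
    show "filterlim fst sequentially F"
      unfolding F_def by (rule filterlim_mono[OF filterlim_filtercomap]) auto
    show "\<forall>\<^sub>F x in F. 1 \<le> snd x"
      and "\<forall>\<^sub>F x in F. c\<^sub>1 * (real (fst x) / ln (real (fst x))) \<le> real (totient (snd x))"
      and "\<forall>\<^sub>F x in F. real (totient (snd x)) \<le> c\<^sub>2 * (real (fst x) / ln (real (fst x)))"
      and "\<forall>\<^sub>F x in F. \<bar>real ((case x of (N, q) \<Rightarrow> M N q) * snd x) - real (fst x)\<bar> \<le> real (snd x)"
      by (rule eventually_mono[OF evA], use M in \<open>auto simp: A_def\<close>)+
  qed (use assms in auto)
  from block_power_mean_asymp[OF assms(1,2)]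
  obtain C where "C > 0" and C: "\<forall>\<^sub>F x in F. norm (block_power_mean k x - (\<Sum>j=1..k. real (Stirling k j) * u x ^ j)) \<le> C * norm (err x)"
    by (rule landau_o.bigE)
  have "\<forall>\<^sub>F N in sequentially. 0 \<le> ln (ln (real N)) / ln (real N)" by real_asymp
  with C[unfolded evF] have "\<forall>\<^sub>F N in sequentially. \<forall>q\<ge>1.
     c\<^sub>1 * (real N / ln (real N)) \<le> real (totient q) \<longrightarrow> real (totient q) \<le> c\<^sub>2 * (real N / ln (real N)) \<longrightarrow>
     \<bar>(\<Sum>a\<in>totatives q. real (prime_count_block q (M N q) a) ^ k) / real (totient q) -
       (\<Sum>j=1..k. real (Stirling k j) * (real N / (real (totient q) * ln (real N))) ^ j)\<bar>
     \<le> C * (ln (ln (real N)) / ln (real N))"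
  proof eventually_elim
    case (elim N)
    show ?case
    proof (intro allI impI)
      fix q :: nat
      assume "1 \<le> q" "c\<^sub>1 * (real N / ln (real N)) \<le> real (totient q)" "real (totient q) \<le> c\<^sub>2 * (real N / ln (real N))"
      then have "(N, q) \<in> A" by (simp add: A_def)
      with elim(1) have "norm (block_power_mean k (N, q) - (\<Sum>j=1..k. real (Stirling k j) * u (N, q) ^ j)) \<le> C * norm (err (N, q))"
        by blast
      then show "\<bar>(\<Sum>a\<in>totatives q. real (prime_count_block q (M N q) a) ^ k) / real (totient q) -
         (\<Sum>j=1..k. real (Stirling k j) * (real N / (real (totient q) * ln (real N))) ^ j)\<bar>
         \<le> C * (ln (ln (real N)) / ln (real N))"
        using elim(2) unfolding block_power_mean_def u_def err_def by (simp only: real_norm_def abs_of_nonneg fst_conv snd_conv prod.case)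
    qed
  qed
  then show ?thesis by (rule that)
qed

theorem theorem1p2:
  fixes k :: nat and c\<^sub>1 c\<^sub>2 :: real
  assumes "uniform_hardy_littlewood"
    and "k \<ge> 1"
    and "0 < c\<^sub>1" and "c\<^sub>1 \<le> c\<^sub>2"
  shows "\<exists>C::real. \<forall>\<^sub>F N::nat in sequentially. \<forall>q::nat. q \<ge> 1 \<longrightarrow>
           c\<^sub>1 * (real N / ln (real N)) \<le> real (totient q) \<longrightarrow>
           real (totient q) \<le> c\<^sub>2 * (real N / ln (real N)) \<longrightarrow>
           \<bar>1 / real (totient q) * (\<Sum>a\<in>totatives q. real (primes_in_class N q a) ^ k)
             - (\<Sum>j=1..k. real (Stirling k j) * (real N / (real (totient q) * ln (real N))) ^ j)\<bar>
           \<le> C * (ln (ln (real N)) / ln (real N))"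
proof -
  have div: "real (N div q) * real q \<le> real N" "real N \<le> real (N div q) * real q + real q" if "q \<ge> 1" for N q :: nat
  proof -
    have "N div q * q \<le> N" "N \<le> N div q * q + q"
      using that mod_less_divisor[of q N] div_mult_mod_eq[of N q] by linarith+
    then show "real (N div q) * real q \<le> real N" "real N \<le> real (N div q) * real q + real q"
      by (simp_all only: of_nat_mult [symmetric] of_nat_add [symmetric] of_nat_le_iff)
  qed
  let ?S = "\<lambda>N q. \<Sum>j=1..k. real (Stirling k j) * (real N / (real (totient q) * ln (real N))) ^ j"
  let ?Q = "\<lambda>M C. \<forall>\<^sub>F N in sequentially. \<forall>q\<ge>1.
     c\<^sub>1 * (real N / ln (real N)) \<le> real (totient q) \<longrightarrow> real (totient q) \<le> c\<^sub>2 * (real N / ln (real N)) \<longrightarrow>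
     \<bar>(\<Sum>a\<in>totatives q. real (prime_count_block q (M N q) a) ^ k) / real (totient q) - ?S N q\<bar>
     \<le> C * (ln (ln (real N)) / ln (real N))"
  \<comment> \<open>Both block lengths lead to the same main term up to the error allowed, and the
    moment over primes up to \<open>N\<close> lies between the two block moments.\<close>
  obtain C1 where C1: "?Q (\<lambda>N q. N div q) C1"
    by (rule moment_of_primes_in_classes[OF assms, of "\<lambda>N q. N div q"])
       (use div in \<open>auto simp: abs_le_iff algebra_simps\<close>)
  obtain C2 where C2: "?Q (\<lambda>N q. N div q + 1) C2"
    by (rule moment_of_primes_in_classes[OF assms, of "\<lambda>N q. N div q + 1"])
       (use div in \<open>auto simp: abs_le_iff algebra_simps\<close>)
  \<comment> \<open>Nonnegativity of the error function permits replacing \<open>C1\<close> and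
    \<open>C2\<close> by their maximum.\<close>
  have ev: "\<forall>\<^sub>F N in sequentially. 0 \<le> ln (ln (real N)) / ln (real N)" by real_asymp
  show ?thesis
  proof (intro exI)
    from C1 C2 ev
    show "\<forall>\<^sub>F N::nat in sequentially. \<forall>q::nat. q \<ge> 1 \<longrightarrow>
           c\<^sub>1 * (real N / ln (real N)) \<le> real (totient q) \<longrightarrow>
           real (totient q) \<le> c\<^sub>2 * (real N / ln (real N)) \<longrightarrow>
           \<bar>1 / real (totient q) * (\<Sum>a\<in>totatives q. real (primes_in_class N q a) ^ k) - ?S N q\<bar>
           \<le> max C1 C2 * (ln (ln (real N)) / ln (real N))"
    proof eventually_elim
      case (elim N)
      define e where "e = ln (ln (real N)) / ln (real N)"
      show ?case
      proof (intro allI impI)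
        fix q :: nat
        assume q: "q \<ge> 1" "c\<^sub>1 * (real N / ln (real N)) \<le> real (totient q)"
          "real (totient q) \<le> c\<^sub>2 * (real N / ln (real N))"
        let ?f = "\<lambda>a. real (primes_in_class N q a) ^ k"
        define a where "a = (\<Sum>a\<in>totatives q. real (prime_count_block q (N div q) a) ^ k) / real (totient q)"
        define b where "b = (\<Sum>a\<in>totatives q. real (prime_count_block q (N div q + 1) a) ^ k) / real (totient q)"
        define f where "f = (\<Sum>a\<in>totatives q. ?f a) / real (totient q)"
        have "a \<le> f" unfolding a_def f_def
          using primes_in_class_bounds(1) by (intro divide_right_mono sum_mono power_mono) auto
        moreover have "f \<le> b" unfolding b_def f_def
          using primes_in_class_bounds(2) by (intro divide_right_mono sum_mono power_mono) (auto simp del: of_nat_add)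
        moreover have "\<bar>a - ?S N q\<bar> \<le> C1 * e" using elim(1) q unfolding a_def e_def by blast
        moreover have "\<bar>b - ?S N q\<bar> \<le> C2 * e" using elim(2) q unfolding b_def e_def by blast
        moreover have "e \<ge> 0" using elim(3) unfolding e_def .
        then have "C1 * e \<le> max C1 C2 * e" "C2 * e \<le> max C1 C2 * e"
          by (auto intro: mult_right_mono)
        ultimately have "\<bar>f - ?S N q\<bar> \<le> max C1 C2 * e" by linarith
        then show "\<bar>1 / real (totient q) * (\<Sum>a\<in>totatives q. ?f a) - ?S N q\<bar> \<le> max C1 C2 * (ln (ln (real N)) / ln (real N))"
          unfolding f_def e_def by simp
      qed
    qed
  qed
qed

end
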